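(* Let $\mathcal{C}$ be a $d$-uniform clutter on $[n]$ which is minimal to $d$-linearity, and let $I=I(\overline{\mathcal{C}})\subset S=K[x_1,\dots,x_n]$ be its circuit ideal. Then the minimal graded free resolution of $I$ is $$0\to S^{\beta_{n-d,n}}(-n)\to S(-n)\oplus S^{\beta_{n-d-1,n-1}}(-(n-1))\to S^{\beta_{n-d-2,n-2}}(-(n-2))\to\cdots\to S^{\beta_{1,d+1}}(-(d+1))\to S^{\beta_{0,d}}(-d)\to I\to0,$$ where (i) $\beta_{n-d,n}(I)=1-e(S/I)+\sum_{i=0}^{d-1}(-1)^{d+i-1}\binom{n}{i}$; (ii) $\beta_{i,i+d}(I)=\binom{n-d}{i}\left(\frac{d}{d+i}\binom{n}{d}-e(S/I)\right)$ for $0\le i\le n-d-1$; and $e(S/I)=\binom{n}{d}-\mu(I)$.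
   Context: $K$ is a fixed field. A $d$-uniform clutter $\mathcal{C}$ on $[n]$ is a set of $d$-element subsets (circuits) of $[n]$; $\overline{\mathcal{C}}$ is the set of all $d$-element subsets of $[n]$ not in $\mathcal{C}$, and the circuit ideal of $\mathcal{C}$ is $I(\overline{\mathcal{C}})=(\prod_{k\in T}x_k : T\in\overline{\mathcal{C}})\subset S=K[x_1,\dots,x_n]$ (with $I(\varnothing)=0$). A clique in $\mathcal{C}$ is a subset of $[n]$ all of whose $d$-element subsets belong to $\mathcal{C}$ (sets with fewer than $d$ elements are cliques); the clique complex $\Delta(\mathcal{C})$ is the simplicial complex of all cliques. A finitely generated graded module $M\neq 0$ has a $d$-linear resolution if $\operatorname{reg}(M)=d=\operatorname{indeg}(M)$, where $\operatorname{indeg}(M)=\inf\{i:M_i\ne0\}$ and $\operatorname{reg}(M)=\sup\{j-i:\beta_{i,j}(M)\ne0\}$; the zero ideal is regarded as having a $d$-linear resolution. A $d$-uniform clutter $\mathcal{C}$ is minimal to $d$-linearity (over $K$) if $I(\overline{\mathcal{C}})$ does not have a $d$-linear resolution, for every proper subclutter $\mathcal{C}'\subsetneq\mathcal{C}$ the ideal $I(\overline{\mathcal{C}'})$ (complement taken in $[n]$) has a $d$-linear resolution, and $\dim\Delta(\mathcal{C})=d-1$. $\beta_{i,j}(I)=\dim_K\operatorname{Tor}^S_i(K,I)_j$; $\mu(I)$ is the minimal number of generators of $I$; $e(S/I)$ is the multiplicity of $S/I$.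
   Formalization: The clutter is additionally assumed to cover [n] (every vertex lies in a circuit); otherwise the claim fails, e.g. for a 4-cycle plus an isolated vertex (n=5, d=2), where β_{2,4}=4 but (ii) gives 3. *)

theory Defs
  imports
    "HOL-Library.Poly_Mapping"
    "HOL-Library.Extended_Real"
    "HOL-Library.Multiset"
    "HOL-Computational_Algebra.Polynomial_FPS"
    "Jordan_Normal_Form.Matrix_Kernel"
    "Jordan_Normal_Form.DL_Rank"
    "Jordan_Normal_Form.DL_Submatrix"
begin

section \<open>The polynomial ring\<close>

text \<open>Polynomials over \<open>'k\<close> in variables indexed by all natural numbers; a power product is
  its exponent function. The ring \<open>S = K[x\<^sub>1, \<dots>, x\<^sub>n]\<close> is the subring \<open>poly_ring n\<close>.\<close>

type_synonym 'k mpoly = "(nat \<Rightarrow>\<^sub>0 nat) \<Rightarrow>\<^sub>0 'k"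

definition Var :: "nat \<Rightarrow> 'k::field mpoly" where
  "Var k = Poly_Mapping.single (Poly_Mapping.single k 1) 1"

definition poly_ring :: "nat \<Rightarrow> 'k::field mpoly set" where
  "poly_ring n = {p. \<forall>m \<in> Poly_Mapping.keys p. Poly_Mapping.keys m \<subseteq> {1..n}}"

definition total_deg :: "(nat \<Rightarrow>\<^sub>0 nat) \<Rightarrow> nat" where
  "total_deg m = (\<Sum>k\<in>Poly_Mapping.keys m. Poly_Mapping.lookup m k)"

text \<open>The graded component \<open>S\<^sub>e\<close>; it is \<open>{0}\<close> for negative \<open>e\<close>.\<close>

definition hom_part :: "nat \<Rightarrow> int \<Rightarrow> 'k::field mpoly set" where
  "hom_part n e = {p \<in> poly_ring n. \<forall>m \<in> Poly_Mapping.keys p. int (total_deg m) = e}"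

definition ideal_gen :: "nat \<Rightarrow> 'k::field mpoly set \<Rightarrow> 'k mpoly set" where
  "ideal_gen n A =
     {\<Sum>a\<in>B. q a * a | B q. finite B \<and> B \<subseteq> A \<and> (\<forall>a\<in>B. q a \<in> poly_ring n)}"

definition min_gens :: "nat \<Rightarrow> 'k::field mpoly set \<Rightarrow> nat" where
  "min_gens n I = (LEAST k. \<exists>A \<subseteq> poly_ring n. finite A \<and> card A = k \<and> ideal_gen n A = I)"

definition dim_K :: "'k::field mpoly set \<Rightarrow> nat" where
  "dim_K = vector_space.dim (\<lambda>c p. Poly_Mapping.single 0 c * p)"


section \<open>Multiplicity\<close>

text \<open>\<open>dim\<^sub>K (S/I)\<^sub>t\<close>, where \<open>(S/I)\<^sub>t = S\<^sub>t / (I \<inter> S\<^sub>t)\<close> for a homogeneous ideal \<open>I\<close>.\<close>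

definition hilbert_quot :: "nat \<Rightarrow> 'k::field mpoly set \<Rightarrow> nat \<Rightarrow> nat" where
  "hilbert_quot n I t = dim_K (hom_part n (int t) :: 'k mpoly set) - dim_K (I \<inter> hom_part n (int t))"

text \<open>The multiplicity \<open>e(S/I)\<close>: the Hilbert series of \<open>S/I \<noteq> 0\<close> is uniquely of the form
  \<open>Q(t) / (1 - t)\<^sup>\<delta>\<close> with \<open>Q(1) \<noteq> 0\<close> (then \<open>\<delta> = dim S/I\<close>), and \<open>e(S/I) = Q(1)\<close>.\<close>

definition mult_quot :: "nat \<Rightarrow> 'k::field mpoly set \<Rightarrow> int" where
  "mult_quot n I =
     (if poly_ring n \<subseteq> I then 0
      else (THE e. \<exists>(\<delta>::nat) (Q::int poly).
              Abs_fps (\<lambda>t. int (hilbert_quot n I t)) * (1 - fps_X) ^ \<delta> = fps_of_poly Q \<and>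
              poly Q 1 \<noteq> 0 \<and> e = poly Q 1))"


section \<open>Graded free resolutions, Tor and Betti numbers\<close>

text \<open>A graded free resolution \<open>\<dots> \<rightarrow> F\<^sub>1 \<rightarrow> F\<^sub>0 \<rightarrow> I \<rightarrow> 0\<close> by free modules of finite rank is given by
  the lists \<open>sh i\<close> of degrees of the basis elements of \<open>F\<^sub>i\<close>, i.e. \<open>F\<^sub>i\<close> is the direct sum of
  the \<open>S(-a)\<close> for \<open>a\<close> in \<open>sh i\<close>, and by matrices \<open>D i\<close> acting on column vectors:
  \<open>D i\<close> is \<open>F\<^sub>i \<rightarrow> F\<^sub>i\<^sub>-\<^sub>1\<close> for \<open>i > 0\<close>, and \<open>D 0\<close> is the augmentation \<open>F\<^sub>0 \<rightarrow> S\<close> with image \<open>I\<close>.\<close>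

definition target_shifts :: "(nat \<Rightarrow> int list) \<Rightarrow> nat \<Rightarrow> int list" where
  "target_shifts sh i = (case i of 0 \<Rightarrow> [0] | Suc k \<Rightarrow> sh k)"

definition free_mod :: "nat \<Rightarrow> nat \<Rightarrow> 'k::field mpoly vec set" where
  "free_mod n b = {v \<in> carrier_vec b. \<forall>c<b. vec_index v c \<in> poly_ring n}"

definition graded_free_resolution ::
  "nat \<Rightarrow> 'k::field mpoly set \<Rightarrow> (nat \<Rightarrow> int list) \<Rightarrow> (nat \<Rightarrow> 'k mpoly mat) \<Rightarrow> bool" where
  "graded_free_resolution n I sh D \<longleftrightarrow>
     (\<forall>i. D i \<in> carrier_mat (length (target_shifts sh i)) (length (sh i)) \<and>
          (\<forall>r < length (target_shifts sh i). \<forall>c < length (sh i).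
             index_mat (D i) (r, c) \<in> hom_part n (sh i ! c - target_shifts sh i ! r))) \<and>
     {vec_index (D 0 *\<^sub>v w) 0 | w. w \<in> free_mod n (length (sh 0))} = I \<and>
     (\<forall>i. {v \<in> free_mod n (length (sh i)). D i *\<^sub>v v = 0\<^sub>v (length (target_shifts sh i))} =
          {D (Suc i) *\<^sub>v w | w. w \<in> free_mod n (length (sh (Suc i)))})"

text \<open>Minimality: \<open>F\<^sub>i\<close> is mapped into \<open>(x\<^sub>1, \<dots>, x\<^sub>n) F\<^sub>i\<^sub>-\<^sub>1\<close> for \<open>i > 0\<close>.\<close>

definition minimal_graded_free_resolution ::
  "nat \<Rightarrow> 'k::field mpoly set \<Rightarrow> (nat \<Rightarrow> int list) \<Rightarrow> (nat \<Rightarrow> 'k mpoly mat) \<Rightarrow> bool" where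
  "minimal_graded_free_resolution n I sh D \<longleftrightarrow>
     graded_free_resolution n I sh D \<and>
     (\<forall>i r c. r < length (sh i) \<and> c < length (sh (Suc i)) \<longrightarrow>
        Poly_Mapping.lookup (index_mat (D (Suc i)) (r, c)) 0 = 0)"

text \<open>The degree \<open>j\<close> component of the differential \<open>K \<otimes> F\<^sub>i \<rightarrow> K \<otimes> F\<^sub>i\<^sub>-\<^sub>1\<close>, where
  \<open>K = S/(x\<^sub>1, \<dots>, x\<^sub>n)\<close>: entries are reduced to their constant coefficients, and only the basis
  elements of degree \<open>j\<close> contribute. For \<open>i = 0\<close> the target is \<open>0\<close>.\<close>

definition tensor_diff ::
  "(nat \<Rightarrow> int list) \<Rightarrow> (nat \<Rightarrow> 'k::field mpoly mat) \<Rightarrow> nat \<Rightarrow> int \<Rightarrow> 'k mat" where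
  "tensor_diff sh D i j =
     (case i of
        0 \<Rightarrow> 0\<^sub>m 0 (count_list (sh 0) j)
      | Suc k \<Rightarrow> submatrix (map_mat (\<lambda>p. Poly_Mapping.lookup p 0) (D i))
                  {r. r < length (sh k) \<and> sh k ! r = j} {c. c < length (sh i) \<and> sh i ! c = j})"

definition mat_rank :: "'k::field mat \<Rightarrow> nat" where
  "mat_rank A = vec_space.rank (dim_row A) A"

text \<open>\<open>dim\<^sub>K H\<^sub>i(K \<otimes> F)\<^sub>j\<close>, as dimension of the cycles minus dimension of the boundaries.\<close>

definition tor_dim ::
  "(nat \<Rightarrow> int list) \<Rightarrow> (nat \<Rightarrow> 'k::field mpoly mat) \<Rightarrow> nat \<Rightarrow> int \<Rightarrow> nat" where
  "tor_dim sh D i j = kernel_dim (tensor_diff sh D i j) - mat_rank (tensor_diff sh D (Suc i) j)"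

text \<open>\<open>\<beta>\<^sub>i\<^sub>,\<^sub>j(I) = dim\<^sub>K Tor\<^sub>i(K, I)\<^sub>j\<close>, with Tor computed from some (not necessarily minimal)
  graded free resolution of \<open>I\<close>; the value does not depend on the choice.\<close>

definition betti :: "nat \<Rightarrow> 'k::field mpoly set \<Rightarrow> nat \<Rightarrow> int \<Rightarrow> nat" where
  "betti n I i j =
     (case (SOME F. graded_free_resolution n I (fst F) (snd F)) of (sh, D) \<Rightarrow> tor_dim sh D i j)"

definition reg :: "nat \<Rightarrow> 'k::field mpoly set \<Rightarrow> ereal" where
  "reg n I = Sup {ereal (real_of_int j - real i) | i j. betti n I i j \<noteq> 0}"

definition indeg :: "nat \<Rightarrow> 'k::field mpoly set \<Rightarrow> nat" where
  "indeg n I = Inf {t. I \<inter> hom_part n (int t) \<noteq> {0}}"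

definition has_linear_resolution :: "nat \<Rightarrow> nat \<Rightarrow> 'k::field mpoly set \<Rightarrow> bool" where
  "has_linear_resolution n d I \<longleftrightarrow>
     I = {0} \<or> (reg n I = ereal (real d) \<and> indeg n I = d)"


section \<open>Clutters\<close>

definition d_subsets :: "nat \<Rightarrow> nat \<Rightarrow> nat set set" where
  "d_subsets n d = {T. T \<subseteq> {1..n} \<and> card T = d}"

definition uniform_clutter :: "nat \<Rightarrow> nat \<Rightarrow> nat set set \<Rightarrow> bool" where
  "uniform_clutter n d C \<longleftrightarrow> C \<subseteq> d_subsets n d"

definition clutter_complement :: "nat \<Rightarrow> nat \<Rightarrow> nat set set \<Rightarrow> nat set set" where
  "clutter_complement n d C = d_subsets n d - C"

definition circuit_ideal :: "nat \<Rightarrow> nat \<Rightarrow> nat set set \<Rightarrow> 'k::field mpoly set" where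
  "circuit_ideal n d C = ideal_gen n ((\<lambda>T. \<Prod>k\<in>T. Var k) ` clutter_complement n d C)"

definition clique_complex :: "nat \<Rightarrow> nat \<Rightarrow> nat set set \<Rightarrow> nat set set" where
  "clique_complex n d C = {A. A \<subseteq> {1..n} \<and> (\<forall>T \<subseteq> A. card T = d \<longrightarrow> T \<in> C)}"

definition complex_dim :: "nat set set \<Rightarrow> int" where
  "complex_dim \<Delta> = int (Max (card ` \<Delta>)) - 1"

definition minimal_to_linearity ::
  "'k::field itself \<Rightarrow> nat \<Rightarrow> nat \<Rightarrow> nat set set \<Rightarrow> bool" where
  "minimal_to_linearity K n d C \<longleftrightarrow>
     uniform_clutter n d C \<and>
     \<not> has_linear_resolution n d (circuit_ideal n d C :: 'k mpoly set) \<and>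
     (\<forall>C'. C' \<subset> C \<longrightarrow> has_linear_resolution n d (circuit_ideal n d C' :: 'k mpoly set)) \<and>
     complex_dim (clique_complex n d C) = int d - 1"

end

theory Submission
  imports Defs "HOL-Library.Function_Algebras"
begin

text \<open>Let \<open>S = K[x\<^sub>1, \<dots>, x\<^sub>n]\<close> and let \<open>I\<close> be the circuit ideal. It is spanned by the monomials
whose support contains a \<open>d\<close>-set outside the clutter, so membership of a monomial depends on its support only. As all cliques have at
most \<open>d\<close> elements, every squarefree monomial of degree above \<open>d\<close> lies in \<open>I\<close>, none of degree below
\<open>d\<close> does, and in degree \<open>d\<close> exactly the circuits are missing.

The graded Betti numbers of \<open>I\<close> are the dimensions of the homology of the Koszul complex of \<open>x\<^sub>1, \<dots>, x\<^sub>n\<close>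
with coefficients in \<open>I\<close> (\<open>betti_eq_kos\<close>). For the Betti numbers computed from a resolution this follows by going along its
syzygy modules: free modules have no Koszul homology in positive homological degree, so in a short exact sequence \<open>0 \<rightarrow> Z
\<rightarrow> F \<rightarrow> M \<rightarrow> 0\<close> with \<open>F\<close> free the homology of \<open>M\<close> is that of \<open>Z\<close>,
shifted by one (\<open>kos_Suc_Suc\<close>, \<open>kos_0_kernel\<close>). The same counting determines the shifts of any minimal resolution
(\<open>count_shifts_minimal\<close>) and shows that a minimal resolution with these shifts exists (\<open>minimal_resolution_exists\<close>).

The Koszul homology of \<open>I\<close> is computed by contractions. Over \<open>S\<close>, every cycle \<open>z\<close> of positive degree is the
boundary of a chain \<open>y\<close>, obtained by moving one variable from the coefficients of \<open>z\<close> to the exterior part. If that variable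
is one with exponent at least two in the multidegree, whenever there is one, then the only coefficients of \<open>y\<close> outside \<open>I\<close>
are squarefree monomials, disjoint from the exterior part (\<open>contraction_cycle\<close>). Squarefree monomials of degree above \<open>d\<close>
lie in \<open>I\<close>; hence the homology in homological degree \<open>p\<close> lives in the degrees \<open>p + d\<close> and \<open>p + d +
1\<close> only (\<open>kos_small\<close>, \<open>kos_large\<close>), and in degree \<open>p + d + 1\<close> it is spanned by the boundaries of the
elements \<open>x\<^sub>T e\<^sub>G\<close> with \<open>T\<close> a circuit and \<open>G\<close> a set of \<open>p + 1\<close> elements disjoint from
\<open>T\<close>.

Minimality now determines this upper strand (\<open>upper_strand\<close>). Let \<open>T\<^sub>0\<close> be a circuit. Removing it from the clutter
enlarges \<open>I\<close> by the generator \<open>x\<^sub>T\<^sub>0\<close>, and the enlarged ideal has a linear resolution, so the boundary of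
\<open>x\<^sub>T e\<^sub>G\<close> bounds a chain with coefficients in the enlarged ideal. In the multidegree of \<open>W = G \<union> T\<close> the
only coefficient of such a chain outside \<open>I\<close> is \<open>x\<^sub>T\<^sub>0\<close>, at \<open>W - T\<^sub>0\<close>, and it can occur only
if \<open>T\<^sub>0 \<subseteq> W\<close>. The circuits cover \<open>[n]\<close>, so if \<open>W \<noteq> [n]\<close>, then some circuit is not
contained in \<open>W\<close> and the class of the boundary vanishes; if \<open>W = [n]\<close>, then all classes are multiples of the one for
\<open>T\<^sub>0\<close>. Thus the upper strand is concentrated in degree \<open>n\<close> and has dimension at most one there, and dimension one
because \<open>I\<close> has no linear resolution.

Finally, in degree \<open>i + d\<close> only the lower strand at \<open>i\<close> and the upper strand at \<open>i - 1\<close> contribute to the Euler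
characteristic of the Koszul complex, which is a coefficient of the Hilbert series of \<open>I\<close> times \<open>(1 - t)\<^sup>n\<close>. Counting
monomials by their supports expresses it through binomial coefficients and the number of circuits (\<open>lower_strand\<close>). That number is also
the multiplicity of \<open>S/I\<close> (\<open>mult_quot_sf\<close>), and the remaining \<open>d\<close>-sets form a minimal set of generators
(\<open>min_gens_circuit_ideal\<close>).\<close>

section \<open>Finite-dimensional subspaces\<close>

locale lin_space = vector_space scale for scale :: "'a::field \<Rightarrow> 'b::ab_group_add \<Rightarrow> 'b"
begin

definition fin_dim :: "'b set \<Rightarrow> bool" where
  "fin_dim U \<longleftrightarrow> (\<exists>B. finite B \<and> U \<subseteq> span B)"

lemma fin_dim_subset: "fin_dim V \<Longrightarrow> U \<subseteq> V \<Longrightarrow> fin_dim U"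
  unfolding fin_dim_def by blast

lemma fin_dim_independent_finite:
  assumes "fin_dim U" "independent B" "B \<subseteq> U"
  shows "finite B"
  using assms independent_span_bound unfolding fin_dim_def by blast

lemma fin_dim_basis:
  assumes "fin_dim U" "subspace U"
  obtains B where "B \<subseteq> U" "independent B" "span B = U" "card B = dim U" "finite B"
proof -
  obtain B where B: "B \<subseteq> U" "independent B" "U \<subseteq> span B" "card B = dim U"
    using basis_exists by blast
  have "span B = U" using B assms(2) span_minimal by blast
  with B fin_dim_independent_finite[OF assms(1)] show thesis using that by blast
qed

text \<open>Both a basis of the subspace and the vectors that extend it are produced, with their cardinalities, since the rank-nullity theorem and the
choice of minimal generators use different halves of this splitting.\<close>

lemma fin_dim_extend_basis:
  assumes "fin_dim V" "subspace V" "U \<subseteq> V" "subspace U"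
  obtains B C where "B \<inter> C = {}" "independent (B \<union> C)" "span B = U" "span (B \<union> C) = V"
    "finite B" "finite C" "card B = dim U" "card C = dim V - dim U" "dim U \<le> dim V"
    "B \<subseteq> U" "C \<subseteq> V"
proof -
  obtain B where B: "B \<subseteq> U" "independent B" "span B = U" "card B = dim U" "finite B"
    using fin_dim_basis[OF fin_dim_subset[OF assms(1,3)] assms(4)] by blast
  obtain E where E: "B \<subseteq> E" "E \<subseteq> V" "independent E" "V \<subseteq> span E"
    using maximal_independent_subset_extend[of B V] B assms(3) by blast
  have sE: "span E = V" using E assms(2) span_minimal by blast
  have fE: "finite E" using fin_dim_independent_finite[OF assms(1) E(3) E(2)] .
  have cE: "card E = dim V" using basis_card_eq_dim[OF E(2) E(4) E(3)] .
  have un: "B \<union> (E - B) = E" using E(1) by blast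
  show thesis
    by (rule that[of B "E - B"]) (use B E sE fE cE un in \<open>auto simp: card_Diff_subset
      intro: finite_subset card_mono[THEN order_trans, rotated] dest: card_mono[OF fE]\<close>)
qed

lemma dim_mono_fin: "fin_dim V \<Longrightarrow> U \<subseteq> V \<Longrightarrow> dim U \<le> dim V"
proof -
  assume V: "fin_dim V" and UV: "U \<subseteq> V"
  obtain E where E: "E \<subseteq> V" "independent E" "V \<subseteq> span E" "card E = dim V"
    using basis_exists by blast
  have "finite E" using fin_dim_independent_finite[OF V E(2) E(1)] .
  then show "dim U \<le> dim V" using dim_le_card[of U E] UV E by auto
qed

lemma subspace_eq_if_dim_le:
  assumes "fin_dim V" "subspace V" "U \<subseteq> V" "subspace U" "dim V \<le> dim U"
  shows "U = V"
proof -
  obtain B C where "B \<inter> C = {}" "span B = U" "span (B \<union> C) = V" "finite C" "card C = dim V - dim U"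
    using fin_dim_extend_basis[OF assms(1-4)] by metis
  then show ?thesis using assms(5) by simp
qed

lemma dim_zero_space [simp]: "dim {0} = 0"
  using dim_unique[of "{}" "{0}" 0] by (simp add: independent_empty)

lemma span_disjoint_if_independent:
  assumes "independent (B \<union> C)" "B \<inter> C = {}" "x \<in> span B" "x \<in> span C"
  shows "x = 0"
proof -
  have rB: "representation (B \<union> C) x = representation B x"
    using representation_extend[OF assms(1,3)] by simp
  have rC: "representation (B \<union> C) x = representation C x"
    using representation_extend[OF assms(1,4)] by simp
  have "representation (B \<union> C) x b = 0" for b
    using representation_ne_zero[of B x b] representation_ne_zero[of C x b] assms(2) rB rC
    by (metis disjoint_iff)
  moreover have "x \<in> span (B \<union> C)" using assms(3) span_mono[of B "B \<union> C"] by blast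
  ultimately show ?thesis
    using sum_nonzero_representation_eq[OF assms(1), of x] by simp
qed

lemma fin_dim_complement:
  assumes "fin_dim V" "subspace V" "U \<subseteq> V" "subspace U"
  obtains C where "C \<subseteq> V" "finite C" "card C = dim V - dim U" "\<And>v. v \<in> V \<Longrightarrow> \<exists>u\<in>U. v - u \<in> span C"
proof -
  obtain B C where BC: "span B = U" "span (B \<union> C) = V" "finite C" "card C = dim V - dim U" "C \<subseteq> V"
    using fin_dim_extend_basis[OF assms] by metis
  show thesis
  proof (rule that[of C])
    show "\<exists>u\<in>U. v - u \<in> span C" if "v \<in> V" for v
    proof -
      have "v \<in> span (B \<union> C)" using that BC by simp
      then obtain x y where "v = x + y" "x \<in> span B" "y \<in> span C" unfolding span_Un by blast
      then show ?thesis using BC(1) by (intro bexI[of _ x]) auto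
    qed
  qed (use BC in auto)
qed

lemma dim_insert_le:
  assumes "finite B" "V \<subseteq> span (insert w B)" shows "dim V \<le> Suc (card B)"
  by (rule order_trans[OF dim_le_card[OF assms(2)]]) (use assms in \<open>auto simp: card_insert_if\<close>)

end

locale lin_space_pair = vs1: lin_space s1 + vs2: lin_space s2
  for s1 :: "'a::field \<Rightarrow> 'b::ab_group_add \<Rightarrow> 'b" and s2 :: "'a \<Rightarrow> 'c::ab_group_add \<Rightarrow> 'c"
begin

sublocale vector_space_pair s1 s2
  by unfold_locales

lemma fin_dim_image:
  assumes "Vector_Spaces.linear s1 s2 f" "vs1.fin_dim U"
  shows "vs2.fin_dim (f ` U)"
proof -
  obtain B where "finite B" "U \<subseteq> vs1.span B" using assms(2) vs1.fin_dim_def by blast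
  then show ?thesis unfolding vs2.fin_dim_def
    using linear_span_image[OF assms(1), of B] by (intro exI[of _ "f ` B"]) auto
qed

text \<open>The vectors that extend a basis of the kernel of the restriction to \<open>U\<close> to a basis of \<open>U\<close> are mapped bijectively
to a basis of the image, because their span meets the kernel in zero.\<close>

lemma rank_nullity:
  assumes lin: "Vector_Spaces.linear s1 s2 f" and U: "vs1.fin_dim U" "vs1.subspace U"
  shows "vs1.dim U = vs1.dim {x \<in> U. f x = 0} + vs2.dim (f ` U)"
proof -
  let ?N = "{x \<in> U. f x = 0}"
  have sN: "vs1.subspace ?N"
    using U(2) unfolding vs1.subspace_def
    by (auto simp: linear_add[OF lin] linear_scale[OF lin] linear_0[OF lin])
  obtain B C where BC: "B \<inter> C = {}" "vs1.independent (B \<union> C)" "vs1.span B = ?N"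
    "vs1.span (B \<union> C) = U" "finite C" "card C = vs1.dim U - vs1.dim ?N" "vs1.dim ?N \<le> vs1.dim U"
    "C \<subseteq> U" "B \<subseteq> ?N"
    using vs1.fin_dim_extend_basis[OF U _ sN] by (metis (no_types, lifting) mem_Collect_eq subsetI)
  have inj: "inj_on f (vs1.span C)"
  proof (subst linear_inj_on_iff_eq_0[OF lin vs1.subspace_span], intro ballI impI)
    fix x assume x: "x \<in> vs1.span C" "f x = 0"
    have "x \<in> U" using x(1) BC(4) vs1.span_mono[of C "B \<union> C"] by blast
    then show "x = 0"
      using vs1.span_disjoint_if_independent[OF BC(2,1)] x BC(3) by blast
  qed
  have ind: "vs2.independent (f ` C)"
    using linear_independent_injective_image[OF lin _ inj] BC(2) vs1.independent_mono by blast
  have "f ` U = vs2.span (f ` C)"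
  proof -
    have "f ` U = vs2.span (f ` (B \<union> C))" using BC(4) linear_span_image[OF lin] by metis
    also have "\<dots> = vs2.span (f ` C)"
    proof
      show "vs2.span (f ` (B \<union> C)) \<subseteq> vs2.span (f ` C)"
      proof (rule vs2.span_minimal)
        show "f ` (B \<union> C) \<subseteq> vs2.span (f ` C)"
          using BC(9) vs2.span_base[of _ "f ` C"] vs2.span_zero[of "f ` C"] by auto
      qed (rule vs2.subspace_span)
      show "vs2.span (f ` C) \<subseteq> vs2.span (f ` (B \<union> C))" by (rule vs2.span_mono) auto
    qed
    finally show ?thesis .
  qed
  then have "vs2.dim (f ` U) = card (f ` C)"
    using vs2.dim_span_eq_card_independent[OF ind] by simp
  also have "\<dots> = card C"
    using inj inj_on_subset vs1.span_superset card_image by metis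
  finally show ?thesis using BC(6,7) by simp
qed

lemma dim_image_inj:
  assumes lin: "Vector_Spaces.linear s1 s2 f" and U: "vs1.fin_dim U" "vs1.subspace U"
    and "\<And>x. x \<in> U \<Longrightarrow> f x = 0 \<Longrightarrow> x = 0"
  shows "vs2.dim (f ` U) = vs1.dim U"
proof -
  have "{x \<in> U. f x = 0} = {0}"
    using assms(4) vs1.subspace_0[OF U(2)] linear_0[OF lin] by auto
  then show ?thesis using rank_nullity[OF assms(1-3)] by simp
qed

end

section \<open>Functions into the polynomial ring as vector spaces over K\<close>

abbreviation lookup :: "('a \<Rightarrow>\<^sub>0 'b::zero) \<Rightarrow> 'a \<Rightarrow> 'b" where "lookup \<equiv> Poly_Mapping.lookup"
abbreviation keys :: "('a \<Rightarrow>\<^sub>0 'b::zero) \<Rightarrow> 'a set" where "keys \<equiv> Poly_Mapping.keys"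

text \<open>The embedding of the field as constant polynomials.\<close>

definition const :: "'k::field \<Rightarrow> 'k mpoly" where
  "const c = Poly_Mapping.single 0 c"

lemma const_0 [simp]: "const 0 = 0" and const_1 [simp]: "const 1 = 1"
  and const_add: "const (a + b) = const a + const b"
  and const_mult: "const (a * b) = const a * const b"
  by (simp_all add: const_def single_add mult_single)

lemma lookup_const_mult [simp]: "lookup (const c * p) m = c * lookup p m"
proof -
  have "const c * p = Poly_Mapping.map ((*) c) p"
    unfolding const_def using mult_map_scale_conv_mult by metis
  then show ?thesis by (simp add: map.rep_eq when_def)
qed

text \<open>Every space below is a space of functions from some index type to polynomials: the index type is \<open>nat\<close> for elements of free
modules, \<open>nat set \<times> nat\<close> for Koszul chains, and \<open>unit\<close> for single polynomials. This way all of them share one scalar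
multiplication and one theory of dimension.\<close>

definition fsc :: "'k::field \<Rightarrow> ('x \<Rightarrow> 'k mpoly) \<Rightarrow> 'x \<Rightarrow> 'k mpoly" where
  "fsc c v = (\<lambda>x. const c * v x)"

lemma fsc_apply [simp]: "fsc c v x = const c * v x"
  by (simp add: fsc_def)

interpretation fs: lin_space fsc
  by unfold_locales (auto simp: fun_eq_iff algebra_simps const_add const_mult)

interpretation mp: lin_space "\<lambda>c p. Poly_Mapping.single 0 c * (p :: 'k::field mpoly)"
  by unfold_locales (auto simp: algebra_simps single_add mult_single)

interpretation fp: lin_space_pair "fsc :: 'k::field \<Rightarrow> ('x \<Rightarrow> 'k mpoly) \<Rightarrow> _"
  "fsc :: 'k::field \<Rightarrow> ('y \<Rightarrow> 'k mpoly) \<Rightarrow> _"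
  by unfold_locales

interpretation mfp: lin_space_pair "\<lambda>c p. Poly_Mapping.single 0 c * (p :: 'k::field mpoly)"
  "fsc :: 'k::field \<Rightarrow> ('y \<Rightarrow> 'k mpoly) \<Rightarrow> _"
  by unfold_locales

definition flinear :: "(('x \<Rightarrow> 'k::field mpoly) \<Rightarrow> 'y \<Rightarrow> 'k mpoly) \<Rightarrow> bool" where
  "flinear f \<longleftrightarrow> (\<forall>u v. f (u + v) = f u + f v) \<and> (\<forall>c v. f (fsc c v) = fsc c (f v))"

lemma flinear_iff: "flinear f \<longleftrightarrow> Vector_Spaces.linear fsc fsc f"
  unfolding flinear_def Vector_Spaces.linear_iff
  by (auto intro: fs.vector_space_axioms)

lemma flinear_add: "flinear f \<Longrightarrow> f (u + v) = f u + f v"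
  and flinear_scale: "flinear f \<Longrightarrow> f (fsc c v) = fsc c (f v)"
  and flinear_0: "flinear f \<Longrightarrow> f 0 = 0"
  and flinear_diff: "flinear f \<Longrightarrow> f (u - v) = f u - f v"
  and flinear_sum: "flinear f \<Longrightarrow> f (sum g A) = (\<Sum>a\<in>A. f (g a))"
  by (simp_all only: flinear_iff fp.linear_add fp.linear_scale fp.linear_0 fp.linear_diff fp.linear_sum)

lemmas fs_rank_nullity = fp.rank_nullity[folded flinear_iff]
  and fs_dim_image_inj = fp.dim_image_inj[folded flinear_iff]
  and fs_fin_dim_image = fp.fin_dim_image[folded flinear_iff]

lemma fs_subspaceI:
  assumes "0 \<in> U" "\<And>u v. u \<in> U \<Longrightarrow> v \<in> U \<Longrightarrow> u + v \<in> U" "\<And>c v. v \<in> U \<Longrightarrow> fsc c v \<in> U"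
  shows "fs.subspace U"
  using assms unfolding fs.subspace_def by auto

lemma fs_subspace_image:
  "flinear f \<Longrightarrow> fs.subspace U \<Longrightarrow> fs.subspace (f ` U)"
  by (simp add: flinear_iff fp.linear_subspace_image)

lemma fs_subspace_kernel:
  "flinear f \<Longrightarrow> fs.subspace U \<Longrightarrow> fs.subspace {v \<in> U. f v = 0}"
  unfolding fs.subspace_def by (auto simp: flinear_add flinear_scale flinear_0)

lemma sum_fun_apply: "(sum g A) x = (\<Sum>a\<in>A. g a x)" for g :: "'a \<Rightarrow> 'x \<Rightarrow> 'b::comm_monoid_add"
  by (induction A rule: infinite_finite_induct) auto

text \<open>The functions whose coefficients vanish outside the given pairs of index and monomial. These pairs label a basis, so dimensions of such
spaces are cardinalities.\<close>

definition supp_space :: "('x \<times> (nat \<Rightarrow>\<^sub>0 nat)) set \<Rightarrow> ('x \<Rightarrow> 'k::field mpoly) set" where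
  "supp_space A = {v. \<forall>x m. lookup (v x) m \<noteq> 0 \<longrightarrow> (x, m) \<in> A}"

definition unit_fun :: "'x \<Rightarrow> (nat \<Rightarrow>\<^sub>0 nat) \<Rightarrow> 'x \<Rightarrow> 'k::field mpoly" where
  "unit_fun x m = (\<lambda>y. if y = x then Poly_Mapping.single m 1 else 0)"

lemma lookup_unit_fun:
  "lookup (unit_fun x m y) m' = (if y = x \<and> m' = m then 1 else 0)"
  by (auto simp: unit_fun_def lookup_single)

lemma subspace_supp_space: "fs.subspace (supp_space A)"
  by (rule fs_subspaceI) (auto simp: supp_space_def lookup_add, metis add_0)

lemma supp_space_basis:
  fixes A :: "('x \<times> (nat \<Rightarrow>\<^sub>0 nat)) set"
  defines "U \<equiv> (\<lambda>(x, m). unit_fun x m) ` A :: ('x \<Rightarrow> 'k::field mpoly) set"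
  assumes "finite A"
  shows "fs.independent U" "fs.span U = supp_space A" "card U = card A"
proof -
  let ?u = "\<lambda>(x, m). unit_fun x m :: 'x \<Rightarrow> 'k mpoly"
  have inj: "inj ?u"
  proof (rule injI, clarify)
    fix x m y m' assume "unit_fun x m = (unit_fun y m' :: 'x \<Rightarrow> 'k mpoly)"
    then have "lookup (unit_fun x m x) m = lookup (unit_fun y m' x :: 'k mpoly) m" by simp
    then show "x = y \<and> m = m'" by (auto simp: lookup_unit_fun split: if_splits)
  qed
  show "card U = card A" unfolding U_def
    using inj card_image inj_on_subset by (metis subset_UNIV)
  have coeff: "lookup ((\<Sum>a\<in>A. fsc (c a) (?u a)) x) m = (if (x, m) \<in> A then c (x, m) else 0)" for c x m
  proof -
    have "lookup ((\<Sum>a\<in>A. fsc (c a) (?u a)) x) m = (\<Sum>a\<in>A. c a * lookup (?u a x) m)"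
      by (simp add: sum_fun_apply lookup_sum)
    also have "\<dots> = (\<Sum>a\<in>A. if a = (x, m) then c a else 0)"
      by (rule sum.cong) (auto simp: lookup_unit_fun split: if_splits prod.splits)
    finally show ?thesis using assms(2) by simp
  qed
  have fU: "finite U" unfolding U_def using assms by auto
  show "fs.independent U"
  proof (rule fs.independent_if_scalars_zero[OF fU])
    fix g u assume z: "(\<Sum>x\<in>U. fsc (g x) x) = 0" and u: "u \<in> U"
    obtain x m where xm: "(x, m) \<in> A" "u = unit_fun x m" using u unfolding U_def by auto
    have "(\<Sum>x\<in>U. fsc (g x) x) = (\<Sum>a\<in>A. fsc (g (?u a)) (?u a))"
      unfolding U_def using sum.reindex[of ?u A] inj by (simp add: o_def inj_on_subset[OF inj])
    then have "lookup ((\<Sum>a\<in>A. fsc (g (?u a)) (?u a)) x) m = 0" using z by simp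
    then show "g u = 0" using xm coeff[of "\<lambda>a. g (?u a)" x m] by simp
  qed
  show "fs.span U = supp_space A"
  proof
    show "fs.span U \<subseteq> supp_space A"
      by (rule fs.span_minimal[OF _ subspace_supp_space])
        (auto simp: U_def supp_space_def lookup_unit_fun split: if_splits)
    show "supp_space A \<subseteq> fs.span U"
    proof
      fix v :: "'x \<Rightarrow> 'k mpoly" assume v: "v \<in> supp_space A"
      have "v = (\<Sum>a\<in>A. fsc (lookup (v (fst a)) (snd a)) (?u a))"
      proof (rule ext, rule poly_mapping_eqI)
        fix x m
        show "lookup (v x) m = lookup ((\<Sum>a\<in>A. fsc (lookup (v (fst a)) (snd a)) (?u a)) x) m"
          using v coeff[of "\<lambda>a. lookup (v (fst a)) (snd a)" x m] by (auto simp: supp_space_def)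
      qed
      moreover have "(\<Sum>a\<in>A. fsc (lookup (v (fst a)) (snd a)) (?u a)) \<in> fs.span U"
        by (rule fs.span_sum, rule fs.span_scale, rule fs.span_base) (auto simp: U_def)
      ultimately show "v \<in> fs.span U" by simp
    qed
  qed
qed

lemma fin_dim_supp_space: "finite A \<Longrightarrow> fs.fin_dim (supp_space A)"
  unfolding fs.fin_dim_def using supp_space_basis(2)[of A] by (metis finite_imageI order_refl)

lemma dim_supp_space: "finite A \<Longrightarrow> fs.dim (supp_space A :: ('x \<Rightarrow> 'k::field mpoly) set) = card A"
  using supp_space_basis[of A, where 'k='k] fs.dim_span_eq_card_independent by metis

text \<open>The dimension of spaces of polynomials is transferred to functions on the one-point type.\<close>

lemma dim_K_eq:
  fixes P :: "'k::field mpoly set"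
  assumes P: "mp.subspace P" "mp.fin_dim P"
  shows "dim_K P = fs.dim ((\<lambda>p. (\<lambda>_::unit. p)) ` P)"
proof -
  have "Vector_Spaces.linear (\<lambda>c p. Poly_Mapping.single 0 c * p) fsc (\<lambda>p. (\<lambda>_::unit. p :: 'k mpoly))"
    unfolding Vector_Spaces.linear_iff
    using fs.vector_space_axioms mp.vector_space_axioms
    by (auto simp: fun_eq_iff const_def)
  from mfp.dim_image_inj[OF this P(2,1)] show ?thesis
    unfolding dim_K_def by (simp add: fun_eq_iff)
qed

lemma dim_K_monomials:
  assumes "finite A"
  shows "dim_K {p :: 'k::field mpoly. keys p \<subseteq> A} = card A"
proof -
  let ?P = "{p :: 'k mpoly. keys p \<subseteq> A}"
  have sub: "mp.subspace ?P"
    unfolding mp.subspace_def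
  proof (intro conjI ballI allI)
    fix c :: 'k and x assume "x \<in> ?P"
    moreover have "keys (Poly_Mapping.single 0 c * x) \<subseteq> keys x"
      by (auto simp: in_keys_iff const_def[symmetric])
    ultimately show "Poly_Mapping.single 0 c * x \<in> ?P" by auto
  next
    fix x y assume "x \<in> ?P" "y \<in> ?P"
    then show "x + y \<in> ?P" using keys_add[of x y] by auto
  qed auto
  have fd: "mp.fin_dim ?P"
    unfolding mp.fin_dim_def
  proof (intro exI conjI subsetI)
    show "finite ((\<lambda>m. Poly_Mapping.single m (1::'k)) ` A)" using assms by auto
    fix p :: "'k mpoly" assume "p \<in> ?P"
    have "p = (\<Sum>m\<in>keys p. Poly_Mapping.single 0 (lookup p m) * Poly_Mapping.single m 1)"
      by (rule poly_mapping_eqI) (auto simp: lookup_sum mult_single lookup_single when_def in_keys_iff)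
    moreover have "\<dots> \<in> mp.span ((\<lambda>m. Poly_Mapping.single m (1::'k)) ` A)"
      by (rule mp.span_sum, rule mp.span_scale, rule mp.span_base) (use \<open>p \<in> ?P\<close> in auto)
    ultimately show "p \<in> mp.span ((\<lambda>m. Poly_Mapping.single m (1::'k)) ` A)" by simp
  qed
  have "(\<lambda>p. (\<lambda>_::unit. p)) ` ?P = supp_space (UNIV \<times> A)"
    by (auto simp: supp_space_def in_keys_iff fun_eq_iff image_iff)
  then show ?thesis
    using dim_K_eq[OF sub fd] dim_supp_space[of "(UNIV :: unit set) \<times> A", where 'k='k] assms
    by (simp add: card_cartesian_product finite_cartesian_product)
qed

declare fsc_apply [simp del]

section \<open>Monomials and degrees\<close>

abbreviation var_mon :: "nat \<Rightarrow> nat \<Rightarrow>\<^sub>0 nat" where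
  "var_mon k \<equiv> Poly_Mapping.single k 1"

lemma lookup_single_mult:
  fixes p :: "'k::field mpoly"
  shows "lookup (Poly_Mapping.single s c * p) (s + m) = c * lookup p m"
proof -
  have "lookup (Poly_Mapping.single s c * p) (s + m) =
      (\<Sum>l. (c when s = l) * (\<Sum>q. lookup p q when s + m = l + q))"
    by (simp add: lookup_mult lookup_single)
  also have "\<dots> = (\<Sum>l. (c * (\<Sum>q. lookup p q when s + m = s + q)) when s = l)"
    by (rule Sum_any.cong) (auto simp: when_def)
  also have "\<dots> = c * (\<Sum>q. lookup p q when m = q)" by simp
  finally show ?thesis by simp
qed

lemma lookup_single_mult_eq_0:
  fixes p :: "'k::field mpoly"
  assumes "\<And>u. m \<noteq> s + u"
  shows "lookup (Poly_Mapping.single s c * p) m = 0"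
proof -
  have "lookup (Poly_Mapping.single s c * p) m =
      (\<Sum>l. (c when s = l) * (\<Sum>q. lookup p q when m = l + q))"
    by (simp add: lookup_mult lookup_single)
  also have "\<dots> = (\<Sum>l. (c * (\<Sum>q. lookup p q when m = s + q)) when s = l)"
    by (rule Sum_any.cong) (auto simp: when_def)
  also have "\<dots> = 0" using assms by simp
  finally show ?thesis .
qed

lemma minus_var_mon_add: "lookup m k \<noteq> 0 \<Longrightarrow> var_mon k + (m - var_mon k) = m"
  by (rule poly_mapping_eqI) (auto simp: lookup_add lookup_minus lookup_single when_def)

lemma lookup_Var_mult:
  "lookup (Var k * p) m = (if lookup m k = 0 then 0 else lookup p (m - var_mon k))"
proof (cases "lookup m k = 0")
  case True
  have "m \<noteq> var_mon k + u" for u using True by (auto simp: lookup_add)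
  then show ?thesis unfolding Var_def using True by (simp add: lookup_single_mult_eq_0)
next
  case False
  then show ?thesis unfolding Var_def
    using lookup_single_mult[of "var_mon k" 1 p "m - var_mon k"] minus_var_mon_add[OF False] by simp
qed

lemma total_deg_superset:
  "finite S \<Longrightarrow> keys m \<subseteq> S \<Longrightarrow> total_deg m = (\<Sum>k\<in>S. lookup m k)"
  unfolding total_deg_def by (rule sum.mono_neutral_left) (auto simp: in_keys_iff)

lemma total_deg_add [simp]: "total_deg (m + m') = total_deg m + total_deg m'"
proof -
  let ?S = "keys m \<union> keys m'"
  have "keys (m + m') \<subseteq> ?S" by (rule keys_add)
  then show ?thesis
    using total_deg_superset[of ?S m] total_deg_superset[of ?S m'] total_deg_superset[of ?S "m + m'"]
    by (simp add: lookup_add sum.distrib)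
qed

lemma total_deg_0 [simp]: "total_deg 0 = 0" by (simp add: total_deg_def)

lemma total_deg_single [simp]: "total_deg (Poly_Mapping.single k c) = c"
  by (simp add: total_deg_def)

lemma total_deg_eq_0_iff [simp]: "total_deg m = 0 \<longleftrightarrow> m = 0"
proof
  assume "total_deg m = 0"
  then have "\<forall>k\<in>keys m. lookup m k = 0" by (simp add: total_deg_def)
  then show "m = 0" by (metis in_keys_iff lookup_zero poly_mapping_eqI)
qed simp

lemma keys_add_nat: "keys (m + m' :: nat \<Rightarrow>\<^sub>0 nat) = keys m \<union> keys m'"
  by (auto simp: in_keys_iff lookup_add)

definition monoms :: "nat \<Rightarrow> int \<Rightarrow> (nat \<Rightarrow>\<^sub>0 nat) set" where
  "monoms n e = {m. keys m \<subseteq> {1..n} \<and> int (total_deg m) = e}"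

lemma finite_monoms [simp]: "finite (monoms n e)"
proof -
  have "inj_on (\<lambda>m. restrict (lookup m) {1..n}) (monoms n e)"
  proof (rule inj_onI, rule poly_mapping_eqI)
    fix x y k assume *: "x \<in> monoms n e" "y \<in> monoms n e"
      "restrict (lookup x) {1..n} = restrict (lookup y) {1..n}"
    show "lookup x k = lookup y k"
    proof (cases "k \<in> {1..n}")
      case True then show ?thesis using fun_cong[OF *(3), of k] by simp
    next
      case False
      then show ?thesis using *(1,2) unfolding monoms_def by (metis (mono_tags, lifting) in_keys_iff mem_Collect_eq subsetD)
    qed
  qed
  moreover have "(\<lambda>m. restrict (lookup m) {1..n}) ` monoms n e \<subseteq> PiE {1..n} (\<lambda>_. {..nat e})"
  proof clarify
    fix m assume m: "m \<in> monoms n e"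
    have "lookup m k \<le> nat e" for k
    proof (cases "k \<in> keys m")
      case True
      then have "lookup m k \<le> total_deg m" unfolding total_deg_def by (intro member_le_sum) auto
      then show ?thesis using m by (auto simp: monoms_def)
    qed (simp add: in_keys_iff)
    then show "restrict (lookup m) {1..n} \<in> PiE {1..n} (\<lambda>_. {..nat e})" by auto
  qed
  moreover have "finite (PiE {1..n} (\<lambda>_. {..nat e}))" by (intro finite_PiE) auto
  ultimately show ?thesis using finite_subset inj_on_finite by blast
qed

lemma hom_part_eq: "hom_part n e = {p. keys p \<subseteq> monoms n e}"
  by (auto simp: hom_part_def poly_ring_def monoms_def)

text \<open>The exponent of the squarefree monomial with the given support.\<close>

definition chi :: "nat set \<Rightarrow> nat \<Rightarrow>\<^sub>0 nat" where
  "chi F = (\<Sum>k\<in>F. var_mon k)"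

lemma lookup_chi: "finite F \<Longrightarrow> lookup (chi F) k = (if k \<in> F then 1 else 0)"
  by (simp add: chi_def lookup_sum lookup_single when_def)

lemma chi_insert: "finite F \<Longrightarrow> k \<notin> F \<Longrightarrow> chi (insert k F) = var_mon k + chi F"
  by (simp add: chi_def)

lemma keys_chi: "finite F \<Longrightarrow> keys (chi F) = F"
  by (auto simp: in_keys_iff lookup_chi split: if_splits)

lemma total_deg_chi: "finite F \<Longrightarrow> total_deg (chi F) = card F"
  by (simp add: total_deg_def keys_chi lookup_chi)

section \<open>The Koszul differential and its contractions\<close>

text \<open>The sign of \<open>e\<^sub>k \<and> e\<^sub>F\<close> relative to the basis element of \<open>F \<union> {k}\<close> of the exterior
power.\<close>

definition ksgn :: "nat \<Rightarrow> nat set \<Rightarrow> 'a::comm_ring_1" where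
  "ksgn k F = (-1) ^ card {l \<in> F. l < k}"

lemma ksgn_insert:
  assumes "k \<notin> F" "k \<noteq> l"
  shows "ksgn l (insert k F) = (if k < l then - ksgn l F else ksgn l F :: 'a::comm_ring_1)"
proof -
  have "{m \<in> insert k F. m < l} = (if k < l then insert k {m \<in> F. m < l} else {m \<in> F. m < l})" by auto
  moreover have "finite {m \<in> F. m < l}" by simp
  ultimately show ?thesis using assms by (simp add: ksgn_def)
qed

lemma ksgn_sq [simp]: "ksgn k F * ksgn k F = (1 :: 'a::comm_ring_1)"
  "ksgn k F * (ksgn k F * y) = (y :: 'a)"
  by (simp_all add: ksgn_def power_mult_distrib[symmetric] mult.assoc[symmetric])

lemma ksgn_swap:
  assumes "k \<notin> F" "l \<notin> F" "k \<noteq> l"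
  shows "ksgn k F * ksgn l (insert k F) = - (ksgn l F * ksgn k (insert l F) :: 'a::comm_ring_1)"
  using assms ksgn_insert[of k F l, where 'a='a] ksgn_insert[of l F k, where 'a='a]
  by (cases "k < l") auto

lemma const_ksgn: "const (ksgn k F) = (ksgn k F :: 'k::field mpoly)"
  by (cases "even (card {l \<in> F. l < k})") (simp_all add: ksgn_def const_def single_uminus)

lemma lookup_ksgn_mult [simp]: "lookup (ksgn k F * p) m = ksgn k F * lookup p m" for p :: "'k::field mpoly"
  using lookup_const_mult[of "ksgn k F" p m] by (simp only: const_ksgn)

text \<open>The polynomial \<open>z (F, i)\<close> is the \<open>i\<close>-th coordinate of the coefficient of \<open>e\<^sub>F\<close>, where
\<open>e\<^sub>F\<close> is the exterior product of the \<open>e\<^sub>k\<close> with \<open>k\<close> in \<open>F\<close>. The differential sends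
\<open>e\<^sub>F\<close> to the alternating sum of the \<open>x\<^sub>k e\<^bsub>F - {k}\<^esub>\<close>.\<close>

definition koszul_diff :: "nat \<Rightarrow> (nat set \<times> nat \<Rightarrow> 'k::field mpoly) \<Rightarrow> nat set \<times> nat \<Rightarrow> 'k mpoly" where
  "koszul_diff n z = (\<lambda>(F, i). \<Sum>k\<in>{1..n} - F. ksgn k F * (Var k * z (insert k F, i)))"

lemma flinear_koszul_diff: "flinear (koszul_diff n)"
  unfolding flinear_def koszul_diff_def
  by (auto simp: fsc_apply fun_eq_iff sum.distrib algebra_simps sum_distrib_left)

text \<open>The terms for \<open>k, l\<close> and for \<open>l, k\<close> cancel.\<close>

lemma koszul_diff_sq: "koszul_diff n (koszul_diff n z) = 0"
proof (rule ext, clarify)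
  fix F i
  define g where "g k l = ksgn k F * ksgn l (insert k F) * (Var k * Var l * z (insert l (insert k F), i))" for k l
  let ?R = "{1..n} - F"
  have anti: "g k l = - g l k" if "k \<in> ?R" "l \<in> ?R" "k \<noteq> l" for k l
  proof -
    have "ksgn k F * ksgn l (insert k F) = - (ksgn l F * ksgn k (insert l F) :: 'a mpoly)"
      using that by (intro ksgn_swap) auto
    then show ?thesis
      by (simp only: g_def insert_commute[of l k] mult.commute[of "Var k" "Var l"] mult_minus_left)
  qed
  have "koszul_diff n (koszul_diff n z) (F, i) = (\<Sum>k\<in>?R. \<Sum>l\<in>{1..n} - insert k F. g k l)"
    unfolding koszul_diff_def prod.case sum_distrib_left g_def
    by (intro sum.cong refl) (simp only: mult_ac)
  also have "\<dots> = (\<Sum>k\<in>?R. \<Sum>l\<in>?R. if l = k then 0 else g k l)"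
    by (rule sum.cong[OF refl], rule sum.mono_neutral_cong_left) auto
  also have "\<dots> = (\<Sum>k\<in>?R. (\<Sum>l\<in>?R. if l < k then g k l else 0) + (\<Sum>l\<in>?R. if k < l then g k l else 0))"
    by (rule sum.cong[OF refl], subst sum.distrib[symmetric], rule sum.cong) auto
  also have "\<dots> = (\<Sum>k\<in>?R. \<Sum>l\<in>?R. if l < k then g k l else 0) + (\<Sum>k\<in>?R. \<Sum>l\<in>?R. if k < l then g k l else 0)"
    by (simp add: sum.distrib)
  also have "(\<Sum>k\<in>?R. \<Sum>l\<in>?R. if k < l then g k l else 0) = (\<Sum>l\<in>?R. \<Sum>k\<in>?R. if k < l then g k l else 0)"
    by (rule sum.swap)
  also have "\<dots> = - (\<Sum>l\<in>?R. \<Sum>k\<in>?R. if k < l then g l k else 0)"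
    unfolding sum_negf[symmetric]
  proof (intro sum.cong refl)
    fix l k assume "l \<in> ?R" "k \<in> ?R"
    show "(if k < l then g k l else 0) = - (if k < l then g l k else 0)"
    proof (cases "k < l")
      case True
      then have "g k l = - g l k" using anti[OF \<open>k \<in> ?R\<close> \<open>l \<in> ?R\<close>] by blast
      with True show ?thesis by (simp only: if_True)
    qed simp
  qed
  finally show "koszul_diff n (koszul_diff n z) (F, i) = 0 (F, i)"
    by (simp only: right_minus zero_fun_apply)
qed

text \<open>The multidegree of the term \<open>x\<^sup>u e\<^sub>F\<close> is \<open>u + chi F\<close>. In multidegree \<open>a\<close> the
contraction divides the monomial by \<open>x\<^sub>k\<close> and multiplies the exterior part by \<open>e\<^sub>k\<close>, for \<open>k = \<kappa>
a\<close>. The variable may be chosen separately for each multidegree since the differential preserves multidegrees.\<close>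

definition contraction ::
  "nat \<Rightarrow> ((nat \<Rightarrow>\<^sub>0 nat) \<Rightarrow> nat) \<Rightarrow> (nat set \<times> nat \<Rightarrow> 'k::field mpoly) \<Rightarrow> nat set \<times> nat \<Rightarrow> 'k mpoly" where
  "contraction n \<kappa> z = (\<lambda>(G, i). Abs_poly_mapping (\<lambda>u.
     let k = \<kappa> (u + chi G) in
     if G \<subseteq> {1..n} \<and> k \<in> G then ksgn k (G - {k}) * lookup (z (G - {k}, i)) (u + var_mon k) else 0))"

lemma lookup_contraction:
  "lookup (contraction n \<kappa> z (G, i)) u =
    (let k = \<kappa> (u + chi G) in
     if G \<subseteq> {1..n} \<and> k \<in> G then ksgn k (G - {k}) * lookup (z (G - {k}, i)) (u + var_mon k) else 0)"
proof -
  let ?f = "\<lambda>u. let k = \<kappa> (u + chi G) in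
     if G \<subseteq> {1..n} \<and> k \<in> G then ksgn k (G - {k}) * lookup (z (G - {k}, i)) (u + var_mon k) else 0"
  have "finite {u. ?f u \<noteq> 0}"
  proof (cases "G \<subseteq> {1..n}")
    case True
    then have "finite G" by (rule finite_subset) simp
    then have "finite (\<Union>k\<in>G. (\<lambda>m. m - var_mon k) ` keys (z (G - {k}, i)))" by auto
    moreover have "{u. ?f u \<noteq> 0} \<subseteq> (\<Union>k\<in>G. (\<lambda>m. m - var_mon k) ` keys (z (G - {k}, i)))"
    proof
      fix u assume "u \<in> {u. ?f u \<noteq> 0}"
      then have "\<kappa> (u + chi G) \<in> G" "lookup (z (G - {\<kappa> (u + chi G)}, i)) (u + var_mon (\<kappa> (u + chi G))) \<noteq> 0"
        by (auto simp: Let_def split: if_splits)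
      then show "u \<in> (\<Union>k\<in>G. (\<lambda>m. m - var_mon k) ` keys (z (G - {k}, i)))"
        by (intro UN_I[of "\<kappa> (u + chi G)"] image_eqI[of _ _ "u + var_mon (\<kappa> (u + chi G))"])
           (auto simp: in_keys_iff)
    qed
    ultimately show ?thesis by (rule rev_finite_subset)
  qed simp
  from lookup_Abs_poly_mapping[OF this] show ?thesis unfolding contraction_def prod.case by (rule fun_cong)
qed

lemma lookup_koszul_diff:
  "lookup (koszul_diff n z (F, i)) u =
    (\<Sum>l\<in>{1..n} - F. if lookup u l = 0 then 0 else ksgn l F * lookup (z (insert l F, i)) (u - var_mon l))"
  by (simp add: koszul_diff_def lookup_sum lookup_Var_mult if_distrib cong: if_cong)

lemma chi_shift:
  assumes "finite G" "l \<notin> G" "lookup u l \<noteq> 0"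
  shows "(u - var_mon l) + chi (insert l G) = u + chi G"
proof -
  have "(u - var_mon l) + chi (insert l G) = (var_mon l + (u - var_mon l)) + chi G"
    unfolding chi_insert[OF assms(1,2)] by (simp only: ac_simps)
  then show ?thesis unfolding minus_var_mon_add[OF assms(3)] .
qed

text \<open>In a multidegree whose exponent at \<open>k\<close> is positive, the contraction \<open>h\<close> along \<open>k\<close> satisfies
\<open>\<partial> h + h \<partial> = id\<close>, so on cycles it is a right inverse of the differential. For a coefficient at \<open>G\<close> with
\<open>k \<notin> G\<close> only the summand that moves \<open>x\<^sub>k\<close> back survives; for \<open>k \<in> G\<close> the cycle condition at
\<open>G - {k}\<close> is what makes the sum equal to the coefficient.\<close>

lemma koszul_diff_contraction:
  assumes cyc: "koszul_diff n z = 0"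
    and \<kappa>: "\<And>G i u. lookup (z (G, i)) u \<noteq> 0 \<Longrightarrow>
      G \<subseteq> {1..n} \<and> \<kappa> (u + chi G) \<in> {1..n} \<and> lookup (u + chi G) (\<kappa> (u + chi G)) \<noteq> 0"
  shows "koszul_diff n (contraction n \<kappa> z) = z"
proof (rule ext, rule poly_mapping_eqI)
  fix Gi :: "nat set \<times> nat" and u
  obtain G i where Gi: "Gi = (G, i)" by (cases Gi)
  define k where "k = \<kappa> (u + chi G)"
  have summand: "lookup (contraction n \<kappa> z (insert l G, i)) (u - var_mon l) =
      (if k \<in> insert l G then ksgn k (insert l G - {k}) * lookup (z (insert l G - {k}, i)) (u - var_mon l + var_mon k) else 0)"
    if "G \<subseteq> {1..n}" "l \<in> {1..n} - G" "lookup u l \<noteq> 0" for l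
  proof -
    have "finite G" using that(1) by (rule finite_subset) simp
    then have e: "u - var_mon l + chi (insert l G) = u + chi G" using chi_shift that(2,3) by blast
    have "insert l G \<subseteq> {1..n}" using that by blast
    then show ?thesis unfolding lookup_contraction e k_def[symmetric] Let_def by simp
  qed
  consider "\<not> G \<subseteq> {1..n}" | "G \<subseteq> {1..n}" "k \<notin> G" | "G \<subseteq> {1..n}" "k \<in> G" by blast
  then have "lookup (koszul_diff n (contraction n \<kappa> z) (G, i)) u = lookup (z (G, i)) u"
  proof cases
    case 1
    then have "lookup (z (G, i)) u = 0" using \<kappa> by blast
    moreover have "lookup (contraction n \<kappa> z (insert l G, i)) v = 0" for l v
      using 1 by (auto simp: lookup_contraction)
    ultimately show ?thesis by (simp add: lookup_koszul_diff)
  next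
    case 2
    have fG: "finite G" using 2(1) by (rule finite_subset) simp
    have "lookup (koszul_diff n (contraction n \<kappa> z) (G, i)) u =
      (\<Sum>l\<in>{1..n} - G. if l = k then (if lookup u k = 0 then 0 else lookup (z (G, i)) u) else 0)"
      unfolding lookup_koszul_diff
    proof (rule sum.cong[OF refl])
      fix l assume l: "l \<in> {1..n} - G"
      show "(if lookup u l = 0 then 0 else ksgn l G * lookup (contraction n \<kappa> z (insert l G, i)) (u - var_mon l)) =
        (if l = k then (if lookup u k = 0 then 0 else lookup (z (G, i)) u) else 0)"
      proof (cases "lookup u l = 0")
        case False
        have "l = k \<Longrightarrow> u - var_mon k + var_mon k = u"
          using minus_var_mon_add[OF False] by (metis add.commute)
        then show ?thesis using summand[OF 2(1) l False] 2(2) l False by (cases "l = k") simp_all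
      qed auto
    qed
    also have "\<dots> = (if k \<in> {1..n} \<and> lookup u k \<noteq> 0 then lookup (z (G, i)) u else 0)"
      using 2(2) by (simp add: sum.delta)
    also have "\<dots> = lookup (z (G, i)) u"
    proof (cases "lookup (z (G, i)) u = 0")
      case False
      then have "k \<in> {1..n}" "lookup (u + chi G) k \<noteq> 0" using \<kappa>[of G i u] unfolding k_def by blast+
      then show ?thesis using 2(2) by (simp add: lookup_add lookup_chi[OF fG])
    qed simp
    finally show ?thesis .
  next
    case 3
    define H where "H = G - {k}"
    have H: "G = insert k H" "k \<notin> H" using 3 by (auto simp: H_def)
    have kn: "k \<in> {1..n}" using 3 by auto
    \<comment> \<open>The cycle condition is evaluated at \<open>H\<close> and \<open>u + var_mon k\<close>; its summand for \<open>k\<close> is the coefficient in question.\<close>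
    let ?t = "\<lambda>l. if lookup u l = 0 then 0 else lookup (z (insert l H, i)) (u - var_mon l + var_mon k)"
    define f where "f l = (if lookup (u + var_mon k) l = 0 then 0
        else ksgn l H * lookup (z (insert l H, i)) (u + var_mon k - var_mon l))" for l
    have fk: "f k = ksgn k H * lookup (z (G, i)) u"
      unfolding f_def H(1)[symmetric] by (simp add: lookup_add)
    have fl: "f l = ksgn l H * ?t l" if "l \<in> {1..n} - G" for l
    proof -
      have "l \<noteq> k" using that 3(2) by auto
      moreover have "u + var_mon k - var_mon l = u - var_mon l + var_mon k" if "lookup u l \<noteq> 0"
        using \<open>l \<noteq> k\<close> that
        by (intro poly_mapping_eqI) (auto simp: lookup_add lookup_minus lookup_single when_def)
      ultimately show ?thesis by (simp add: f_def lookup_add lookup_single)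
    qed
    have "0 = lookup (koszul_diff n z (H, i)) (u + var_mon k)" using cyc by simp
    also have "\<dots> = sum f ({1..n} - H)"
      unfolding lookup_koszul_diff f_def by (rule refl)
    also have "{1..n} - H = insert k ({1..n} - G)" using kn H by auto
    also have "sum f (insert k ({1..n} - G)) = f k + sum f ({1..n} - G)"
      by (rule sum.insert) (use 3(2) in auto)
    also have "sum f ({1..n} - G) = (\<Sum>l\<in>{1..n} - G. ksgn l H * ?t l)"
      by (rule sum.cong[OF refl fl])
    finally have z0: "ksgn k H * lookup (z (G, i)) u + (\<Sum>l\<in>{1..n} - G. ksgn l H * ?t l) = 0"
      unfolding fk by (rule sym)
    then have c0: "ksgn k H * lookup (z (G, i)) u = - (\<Sum>l\<in>{1..n} - G. ksgn l H * ?t l)"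
      by (rule eq_neg_iff_add_eq_0[THEN iffD2])
    have c: "ksgn k H * (ksgn k H * lookup (z (G, i)) u) = - (\<Sum>l\<in>{1..n} - G. ksgn k H * (ksgn l H * ?t l))"
      unfolding c0 mult_minus_right sum_distrib_left by (rule refl)
    have "lookup (koszul_diff n (contraction n \<kappa> z) (G, i)) u =
      (\<Sum>l\<in>{1..n} - G. - (ksgn k H * (ksgn l H * ?t l)))"
      unfolding lookup_koszul_diff
    proof (rule sum.cong[OF refl])
      fix l assume l: "l \<in> {1..n} - G"
      have lk: "l \<noteq> k" "l \<notin> H" using l 3 H by auto
      have ins: "insert l G - {k} = insert l H" using lk H by auto
      have s: "ksgn l G * ksgn k (insert l H) = (- (ksgn k H * ksgn l H) :: 'a)"
        unfolding H(1) ksgn_insert[OF H(2) lk(1)[symmetric]] ksgn_insert[OF lk(2) lk(1)]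
        using lk(1) by (cases "k < l") (simp_all add: mult.commute)
      show "(if lookup u l = 0 then 0 else ksgn l G * lookup (contraction n \<kappa> z (insert l G, i)) (u - var_mon l)) =
        - (ksgn k H * (ksgn l H * ?t l))"
      proof (cases "lookup u l = 0")
        case False
        have "ksgn l G * (ksgn k (insert l H) * y) = - (ksgn k H * (ksgn l H * y))" for y :: 'a
          unfolding mult.assoc[symmetric] s by simp
        then show ?thesis using summand[OF 3(1) l False] 3(2) ins False by simp
      qed simp
    qed
    also have "\<dots> = ksgn k H * (ksgn k H * lookup (z (G, i)) u)" unfolding c by (rule sum_negf)
    also have "\<dots> = lookup (z (G, i)) u" by (rule ksgn_sq(2))
    finally show ?thesis .
  qed
  then show "lookup (koszul_diff n (contraction n \<kappa> z) Gi) u = lookup (z Gi) u" by (simp add: Gi)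
qed

section \<open>Koszul homology of graded modules\<close>

definition xmul :: "nat \<Rightarrow> (nat \<Rightarrow> 'k::field mpoly) \<Rightarrow> nat \<Rightarrow> 'k mpoly" where
  "xmul k v = (\<lambda>i. Var k * v i)"

text \<open>A family \<open>M\<close> of graded components, given as spaces of tuples and closed under multiplication by the variables.\<close>

definition graded_module :: "nat \<Rightarrow> (int \<Rightarrow> (nat \<Rightarrow> 'k::field mpoly) set) \<Rightarrow> bool" where
  "graded_module n M \<longleftrightarrow>
     (\<forall>e. fs.subspace (M e) \<and> fs.fin_dim (M e)) \<and>
     (\<forall>e. \<forall>k\<in>{1..n}. \<forall>v\<in>M e. xmul k v \<in> M (e + 1))"

text \<open>The coefficient of \<open>e\<^sub>F\<close>, as a tuple.\<close>

definition slice :: "(nat set \<times> nat \<Rightarrow> 'k::field mpoly) \<Rightarrow> nat set \<Rightarrow> nat \<Rightarrow> 'k mpoly" where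
  "slice z F = (\<lambda>i. z (F, i))"

lemma slice_add [simp]: "slice (y + z) F = slice y F + slice z F"
  and slice_fsc [simp]: "slice (fsc c z) F = fsc c (slice z F)"
  and slice_0 [simp]: "slice 0 F = 0"
  by (auto simp: slice_def fun_eq_iff fsc_apply)

lemma chain_eqI: "(\<And>F. slice y F = slice z F) \<Longrightarrow> y = z"
  by (auto simp: slice_def fun_eq_iff)

lemma xmul_0 [simp]: "xmul k 0 = 0"
  by (simp add: xmul_def fun_eq_iff)

lemma fsc_0_right [simp]: "fsc c 0 = 0"
  by (simp add: fsc_apply fun_eq_iff)

lemma slice_koszul_diff:
  "slice (koszul_diff n z) F = (\<Sum>k\<in>{1..n} - F. fsc (ksgn k F) (xmul k (slice z (insert k F))))"
  by (auto simp: fun_eq_iff slice_def koszul_diff_def xmul_def sum_fun_apply const_ksgn fsc_apply)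

text \<open>Chains of homological degree \<open>p\<close> and internal degree \<open>j\<close>. Since \<open>e\<^sub>F\<close> has degree \<open>card
F\<close>, its coefficients are taken from degree \<open>j - p\<close> of \<open>M\<close>.\<close>

definition kchain :: "nat \<Rightarrow> (int \<Rightarrow> (nat \<Rightarrow> 'k::field mpoly) set) \<Rightarrow> nat \<Rightarrow> int \<Rightarrow> (nat set \<times> nat \<Rightarrow> 'k mpoly) set" where
  "kchain n M p j = {z. \<forall>F. slice z F \<in> (if F \<subseteq> {1..n} \<and> card F = p then M (j - int p) else {0})}"

definition kcyc :: "nat \<Rightarrow> (int \<Rightarrow> (nat \<Rightarrow> 'k::field mpoly) set) \<Rightarrow> nat \<Rightarrow> int \<Rightarrow> (nat set \<times> nat \<Rightarrow> 'k mpoly) set" where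
  "kcyc n M p j = {z \<in> kchain n M p j. koszul_diff n z = 0}"

definition kbd :: "nat \<Rightarrow> (int \<Rightarrow> (nat \<Rightarrow> 'k::field mpoly) set) \<Rightarrow> nat \<Rightarrow> int \<Rightarrow> (nat set \<times> nat \<Rightarrow> 'k mpoly) set" where
  "kbd n M p j = koszul_diff n ` kchain n M (Suc p) j"

text \<open>The dimension of the Koszul homology of \<open>M\<close> in homological degree \<open>p\<close> and internal degree \<open>j\<close>; for
graded modules the subtraction does not truncate, by \<open>dim_kbd_le\<close>.\<close>

definition kos :: "nat \<Rightarrow> (int \<Rightarrow> (nat \<Rightarrow> 'k::field mpoly) set) \<Rightarrow> nat \<Rightarrow> int \<Rightarrow> nat" where
  "kos n M p j = fs.dim (kcyc n M p j) - fs.dim (kbd n M p j)"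

lemma graded_moduleD:
  assumes "graded_module n M"
  shows "fs.subspace (M e)" "fs.fin_dim (M e)"
    "k \<in> {1..n} \<Longrightarrow> v \<in> M e \<Longrightarrow> xmul k v \<in> M (e + 1)"
  using assms unfolding graded_module_def by blast+

lemma subspace_if_zero: "fs.subspace U \<Longrightarrow> fs.subspace (if b then U else {0})"
  by (simp add: fs.subspace_single_0)

lemma subspace_kchain:
  assumes "graded_module n M" shows "fs.subspace (kchain n M p j)"
proof -
  define S where "S F = (if F \<subseteq> {1..n} \<and> card F = p then M (j - int p) else {0})" for F :: "nat set"
  have "fs.subspace (S F)" for F
    unfolding S_def by (rule subspace_if_zero[OF graded_moduleD(1)[OF assms]])
  then have "fs.subspace {z. \<forall>F. slice z F \<in> S F}"
    by (intro fs_subspaceI) (auto simp: fs.subspace_0 fs.subspace_add fs.subspace_scale)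
  then show ?thesis by (simp add: kchain_def S_def)
qed

text \<open>The chain \<open>v e\<^sub>F\<close>.\<close>

definition chain_at :: "nat set \<Rightarrow> (nat \<Rightarrow> 'k::field mpoly) \<Rightarrow> nat set \<times> nat \<Rightarrow> 'k mpoly" where
  "chain_at F v = (\<lambda>(G, i). if G = F then v i else 0)"

lemma slice_chain_at: "slice (chain_at F v) G = (if G = F then v else 0)"
  by (auto simp: slice_def chain_at_def fun_eq_iff)

lemma flinear_chain_at: "flinear (chain_at F)"
  by (auto simp: flinear_def slice_chain_at intro!: chain_eqI)

lemma slice_sum: "slice (sum f A) F = (\<Sum>a\<in>A. slice (f a) F)"
  by (auto simp: fun_eq_iff slice_def sum_fun_apply)

lemma fin_dim_kchain:
  assumes "graded_module n M" shows "fs.fin_dim (kchain n M p j)"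
proof -
  obtain B where B: "finite B" "M (j - int p) \<subseteq> fs.span B"
    using graded_moduleD(2)[OF assms] unfolding fs.fin_dim_def by blast
  let ?C = "\<Union>F\<in>Pow {1..n}. chain_at F ` B"
  have "kchain n M p j \<subseteq> fs.span ?C"
  proof
    fix z assume z: "z \<in> kchain n M p j"
    have s: "slice z F \<in> (if F \<subseteq> {1..n} \<and> card F = p then M (j - int p) else {0})" for F
      using z by (simp add: kchain_def)
    have eq: "(\<Sum>F\<in>Pow {1..n}. chain_at F (slice z F)) = z"
    proof (rule chain_eqI)
      fix G
      show "slice (\<Sum>F\<in>Pow {1..n}. chain_at F (slice z F)) G = slice z G"
        using s[of G] by (auto simp: slice_sum slice_chain_at sum.delta' split: if_splits)
    qed
    have "chain_at F (slice z F) \<in> fs.span ?C" if F: "F \<in> Pow {1..n}" for F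
    proof -
      have "slice z F \<in> fs.span B"
        using s[of F] B(2) fs.span_zero[of B] by (auto split: if_splits)
      then have "chain_at F (slice z F) \<in> fs.span (chain_at F ` B)"
        using fp.linear_span_image[OF flinear_chain_at[unfolded flinear_iff], of F B] by blast
      then show ?thesis using fs.span_mono[of "chain_at F ` B" ?C] F by blast
    qed
    then have "(\<Sum>F\<in>Pow {1..n}. chain_at F (slice z F)) \<in> fs.span ?C" by (rule fs.span_sum)
    then show "z \<in> fs.span ?C" unfolding eq .
  qed
  moreover have "finite ?C" using B by auto
  ultimately show ?thesis unfolding fs.fin_dim_def by blast
qed

lemma kchainD:
  assumes "z \<in> kchain n M p j"
  shows "F \<subseteq> {1..n} \<Longrightarrow> card F = p \<Longrightarrow> slice z F \<in> M (j - int p)"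
    and "\<not> (F \<subseteq> {1..n} \<and> card F = p) \<Longrightarrow> slice z F = 0"
proof -
  have "slice z F \<in> (if F \<subseteq> {1..n} \<and> card F = p then M (j - int p) else {0})"
    using assms unfolding kchain_def by blast
  then show "F \<subseteq> {1..n} \<Longrightarrow> card F = p \<Longrightarrow> slice z F \<in> M (j - int p)"
    and "\<not> (F \<subseteq> {1..n} \<and> card F = p) \<Longrightarrow> slice z F = 0" by (auto split: if_splits)
qed

lemma kchainI:
  assumes "\<And>F. F \<subseteq> {1..n} \<Longrightarrow> card F = p \<Longrightarrow> slice z F \<in> M (j - int p)"
    and "\<And>F. \<not> (F \<subseteq> {1..n} \<and> card F = p) \<Longrightarrow> slice z F = 0"
  shows "z \<in> kchain n M p j"
  unfolding kchain_def using assms by auto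

lemma koszul_diff_kchain:
  assumes M: "graded_module n M" and z: "z \<in> kchain n M (Suc p) j"
  shows "koszul_diff n z \<in> kchain n M p j"
proof (rule kchainI)
  fix F :: "nat set" assume F: "F \<subseteq> {1..n}" "card F = p"
  then have fF: "finite F" using finite_subset by blast
  have "xmul k (slice z (insert k F)) \<in> M (j - int p)" if k: "k \<in> {1..n} - F" for k
  proof -
    have "slice z (insert k F) \<in> M (j - int (Suc p))"
      by (rule kchainD(1)[OF z]) (use k F fF in auto)
    then show ?thesis using graded_moduleD(3)[OF M, of k _ "j - int (Suc p)"] k by (simp add: algebra_simps)
  qed
  then show "slice (koszul_diff n z) F \<in> M (j - int p)"
    unfolding slice_koszul_diff
    by (intro fs.subspace_sum fs.subspace_scale graded_moduleD(1)[OF M])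
next
  fix F :: "nat set" assume F: "\<not> (F \<subseteq> {1..n} \<and> card F = p)"
  have "slice z (insert k F) = 0" if k: "k \<in> {1..n} - F" for k
  proof (rule kchainD(2)[OF z], rule notI)
    assume *: "insert k F \<subseteq> {1..n} \<and> card (insert k F) = Suc p"
    then have "finite F" using finite_subset[of F "{1..n}"] by blast
    then show False using * k F by auto
  qed
  then show "slice (koszul_diff n z) F = 0"
    unfolding slice_koszul_diff by (intro sum.neutral) simp
qed

lemma kbd_subset_kcyc: "graded_module n M \<Longrightarrow> kbd n M p j \<subseteq> kcyc n M p j"
  using koszul_diff_kchain[of n M] by (auto simp: kbd_def kcyc_def koszul_diff_sq)

lemma subspace_kcyc: "graded_module n M \<Longrightarrow> fs.subspace (kcyc n M p j)"
  unfolding kcyc_def by (intro fs_subspace_kernel flinear_koszul_diff subspace_kchain)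

lemma fin_dim_kcyc: "graded_module n M \<Longrightarrow> fs.fin_dim (kcyc n M p j)"
  by (rule fs.fin_dim_subset[OF fin_dim_kchain]) (auto simp: kcyc_def)

lemma subspace_kbd: "graded_module n M \<Longrightarrow> fs.subspace (kbd n M p j)"
  unfolding kbd_def by (intro fs_subspace_image flinear_koszul_diff subspace_kchain)

lemma dim_kchain_Suc:
  assumes "graded_module n M"
  shows "fs.dim (kchain n M (Suc p) j) = fs.dim (kcyc n M (Suc p) j) + fs.dim (kbd n M p j)"
  unfolding kcyc_def kbd_def
  by (rule fs_rank_nullity[OF flinear_koszul_diff fin_dim_kchain[OF assms] subspace_kchain[OF assms]])

lemma dim_kbd_le: "graded_module n M \<Longrightarrow> fs.dim (kbd n M p j) \<le> fs.dim (kcyc n M p j)"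
  by (intro fs.dim_mono_fin fin_dim_kcyc kbd_subset_kcyc)

lemma kcyc_0: "kcyc n M 0 j = kchain n M 0 j"
proof -
  have "koszul_diff n z = 0" if z: "z \<in> kchain n M 0 j" for z
  proof (rule chain_eqI)
    fix F
    have "slice z (insert k F) = 0" for k
    proof (rule kchainD(2)[OF z], rule notI)
      assume *: "insert k F \<subseteq> {1..n} \<and> card (insert k F) = 0"
      have "finite (insert k F)" by (rule finite_subset[OF conjunct1[OF *]]) (rule finite_atLeastAtMost)
      then show False using conjunct2[OF *] unfolding card_eq_0_iff by blast
    qed
    then show "slice (koszul_diff n z) F = slice 0 F"
      unfolding slice_koszul_diff by (simp only: xmul_0 fsc_0_right sum.neutral_const slice_0)
  qed
  then show ?thesis unfolding kcyc_def by blast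
qed

lemma kchain_gt: assumes "n < p" shows "kchain n M p j = {0}"
proof -
  have no: "\<not> (F \<subseteq> {1..n} \<and> card F = p)" for F
    using assms card_mono[of "{1..n}" F] by auto
  have "z = 0" if "z \<in> kchain n M p j" for z
    by (rule chain_eqI) (use kchainD(2)[OF that] no in simp)
  moreover have "0 \<in> kchain n M p j" by (rule kchainI) (use no in auto)
  ultimately show ?thesis by blast
qed

lemma kos_gt: assumes "n < p" shows "kos n M p j = 0"
proof -
  have "kcyc n M p j \<subseteq> {0}" using kchain_gt[OF assms] by (auto simp: kcyc_def)
  then have "fs.dim (kcyc n M p j) = 0"
    using fs.dim_le_card[of "kcyc n M p j" "{}"] by simp
  then show ?thesis by (simp add: kos_def)
qed

text \<open>Rank-nullity turns the alternating sum into a telescoping one; no chains exist beyond homological degree \<open>n\<close>.\<close>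

lemma euler_characteristic:
  assumes M: "graded_module n M"
  shows "(\<Sum>p\<le>n. (-1) ^ p * int (kos n M p j)) = (\<Sum>p\<le>n. (-1) ^ p * int (fs.dim (kchain n M p j)))"
proof -
  have kos_int: "int (kos n M p j) = int (fs.dim (kcyc n M p j)) - int (fs.dim (kbd n M p j))" for p
    using dim_kbd_le[OF M, of p j] by (simp add: kos_def)
  have "(\<Sum>p\<le>N. (-1) ^ p * int (kos n M p j)) =
      (\<Sum>p\<le>N. (-1) ^ p * int (fs.dim (kchain n M p j))) - (-1) ^ N * int (fs.dim (kbd n M N j))" for N
  proof (induction N)
    case 0
    then show ?case by (simp add: kos_int kcyc_0)
  next
    case (Suc N)
    then show ?case by (simp add: kos_int dim_kchain_Suc[OF M] algebra_simps)
  qed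
  moreover have "kbd n M n j = {0}"
    using kchain_gt[of n "Suc n" M j] flinear_0[OF flinear_koszul_diff] by (simp add: kbd_def)
  ultimately show ?thesis by simp
qed

section \<open>Dimension shift along exact sequences\<close>

definition lift_map :: "((nat \<Rightarrow> 'k::field mpoly) \<Rightarrow> nat \<Rightarrow> 'k mpoly) \<Rightarrow> (nat set \<times> nat \<Rightarrow> 'k mpoly) \<Rightarrow> nat set \<times> nat \<Rightarrow> 'k mpoly" where
  "lift_map \<phi> z = (\<lambda>(F, i). \<phi> (slice z F) i)"

lemma slice_lift_map [simp]: "slice (lift_map \<phi> z) F = \<phi> (slice z F)"
  by (simp add: slice_def lift_map_def)

text \<open>Additive maps of tuples that commute with scalars and variables are the module homomorphisms that occur.\<close>

definition xlinear :: "((nat \<Rightarrow> 'k::field mpoly) \<Rightarrow> nat \<Rightarrow> 'k mpoly) \<Rightarrow> bool" where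
  "xlinear \<phi> \<longleftrightarrow> flinear \<phi> \<and> (\<forall>k v. \<phi> (xmul k v) = xmul k (\<phi> v))"

lemma flinear_lift_map: "flinear \<phi> \<Longrightarrow> flinear (lift_map \<phi>)"
proof -
  assume lin: "flinear \<phi>"
  show "flinear (lift_map \<phi>)" unfolding flinear_def
    by (intro conjI allI chain_eqI) (simp_all only: slice_lift_map slice_add slice_fsc flinear_add[OF lin] flinear_scale[OF lin])
qed

lemma koszul_diff_lift_map:
  assumes "xlinear \<phi>"
  shows "koszul_diff n (lift_map \<phi> z) = lift_map \<phi> (koszul_diff n z)"
proof (rule chain_eqI)
  fix F
  have lin: "flinear \<phi>" and x: "\<phi> (xmul k v) = xmul k (\<phi> v)" for k v
    using assms by (auto simp: xlinear_def)
  show "slice (koszul_diff n (lift_map \<phi> z)) F = slice (lift_map \<phi> (koszul_diff n z)) F"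
    by (simp add: slice_koszul_diff flinear_sum[OF lin] flinear_scale[OF lin] x)
qed

text \<open>A short exact sequence \<open>0 \<rightarrow> Z \<rightarrow> F \<rightarrow> M \<rightarrow> 0\<close> of graded modules, with
\<open>Z\<close> the kernel and \<open>M\<close> the image of \<open>\<phi>\<close>.\<close>

locale graded_exact =
  fixes n :: nat and F M Z :: "int \<Rightarrow> (nat \<Rightarrow> 'k::field mpoly) set" and \<phi>
  assumes F: "graded_module n F" and \<phi>: "xlinear \<phi>"
    and M_eq: "\<And>e. M e = \<phi> ` F e" and Z_eq: "\<And>e. Z e = {v \<in> F e. \<phi> v = 0}"
begin

lemma lin: "flinear \<phi>" using \<phi> by (simp add: xlinear_def)

lemma \<phi>x: "\<phi> (xmul k v) = xmul k (\<phi> v)" using \<phi> by (simp add: xlinear_def)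

lemma Z: "graded_module n Z"
proof -
  have "fs.subspace (Z e)" for e unfolding Z_eq
    by (rule fs_subspace_kernel[OF lin graded_moduleD(1)[OF F]])
  moreover have "fs.fin_dim (Z e)" for e
    by (rule fs.fin_dim_subset[OF graded_moduleD(2)[OF F, of e]]) (auto simp: Z_eq)
  ultimately show ?thesis using graded_moduleD(3)[OF F]
    unfolding graded_module_def by (auto simp: Z_eq \<phi>x)
qed

lemma lift_map_kchain: "lift_map \<phi> ` kchain n F p j = kchain n M p j"
proof
  show "lift_map \<phi> ` kchain n F p j \<subseteq> kchain n M p j"
  proof clarify
    fix z assume z: "z \<in> kchain n F p j"
    show "lift_map \<phi> z \<in> kchain n M p j" unfolding kchain_def
    proof clarify
      fix G
      have "slice z G \<in> (if G \<subseteq> {1..n} \<and> card G = p then F (j - int p) else {0})"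
        using z by (simp add: kchain_def)
      then show "slice (lift_map \<phi> z) G \<in> (if G \<subseteq> {1..n} \<and> card G = p then M (j - int p) else {0})"
        by (auto simp: M_eq flinear_0[OF lin] split: if_splits)
    qed
  qed
  show "kchain n M p j \<subseteq> lift_map \<phi> ` kchain n F p j"
  proof
    fix z assume z: "z \<in> kchain n M p j"
    have "\<forall>G. \<exists>w. w \<in> (if G \<subseteq> {1..n} \<and> card G = p then F (j - int p) else {0}) \<and> slice z G = \<phi> w"
    proof
      fix G
      have "slice z G \<in> (if G \<subseteq> {1..n} \<and> card G = p then M (j - int p) else {0})"
        using z by (simp add: kchain_def)
      then show "\<exists>w. w \<in> (if G \<subseteq> {1..n} \<and> card G = p then F (j - int p) else {0}) \<and> slice z G = \<phi> w"
        by (auto simp: M_eq flinear_0[OF lin] split: if_splits)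
    qed
    then obtain w where w: "\<And>G. w G \<in> (if G \<subseteq> {1..n} \<and> card G = p then F (j - int p) else {0})"
        "\<And>G. slice z G = \<phi> (w G)"
      by metis
    define y where "y = (\<lambda>(G, i). w G i)"
    have "slice y G = w G" for G by (simp add: y_def slice_def)
    then have "y \<in> kchain n F p j" "lift_map \<phi> y = z"
      using w by (simp_all add: kchain_def chain_eqI)
    then show "z \<in> lift_map \<phi> ` kchain n F p j" by blast
  qed
qed

lemma kernel_lift_map: "{z \<in> kchain n F p j. lift_map \<phi> z = 0} = kchain n Z p j"
proof -
  have "lift_map \<phi> z = 0 \<longleftrightarrow> (\<forall>G. \<phi> (slice z G) = 0)" for z
    by (metis chain_eqI slice_0 slice_lift_map)
  moreover have "(slice z G \<in> (if b then F e else {0}) \<and> \<phi> (slice z G) = 0) \<longleftrightarrow>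
      slice z G \<in> (if b then Z e else {0})" for z G b e
    by (auto simp: Z_eq flinear_0[OF lin])
  ultimately show ?thesis unfolding kchain_def by blast
qed

lemma M: "graded_module n M"
proof -
  have "fs.subspace (M e)" for e unfolding M_eq
    by (rule fs_subspace_image[OF lin graded_moduleD(1)[OF F]])
  moreover have "fs.fin_dim (M e)" for e unfolding M_eq
    by (rule fs_fin_dim_image[OF lin graded_moduleD(2)[OF F]])
  ultimately show ?thesis using graded_moduleD(3)[OF F]
    unfolding graded_module_def by (auto simp: M_eq \<phi>x[symmetric])
qed

text \<open>In place of the long exact homology sequence, the dimension of the space \<open>A\<close> of chains of \<open>F\<close> whose image in
\<open>M\<close> is a cycle is computed in two ways: by mapping \<open>A\<close> to \<open>M\<close>, which hits all cycles and has the chains of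
\<open>Z\<close> as kernel, and by applying the differential, which gives the boundaries of \<open>F\<close> that lie in \<open>Z\<close> and has the
cycles of \<open>F\<close> as kernel. By acyclicity these cycles are boundaries, and mapping them to \<open>M\<close> relates the boundaries of
\<open>M\<close> to the cycles of \<open>Z\<close>.\<close>

lemma kos_shift:
  assumes acyc: "kcyc n F (Suc p) j = kbd n F (Suc p) j"
  shows "kos n M (Suc p) j = fs.dim (kbd n F p j \<inter> kchain n Z p j) - fs.dim (kbd n Z p j)"
proof -
  let ?d = "koszul_diff n" and ?L = "lift_map \<phi>"
  let ?KF = "kchain n F (Suc p) j" and ?KZ = "kchain n Z (Suc p) j" and ?X = "kbd n F p j \<inter> kchain n Z p j"
  note linL = flinear_lift_map[OF lin]
  define A where "A = {f \<in> ?KF. ?L (?d f) = 0}"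
  have ZF: "z \<in> ?KZ \<longleftrightarrow> z \<in> ?KF \<and> ?L z = 0" for z
    using kernel_lift_map[of "Suc p" j] by blast
  have ZF': "z \<in> kchain n Z p j \<longleftrightarrow> z \<in> kchain n F p j \<and> ?L z = 0" for z
    using kernel_lift_map[of p j] by blast
  have sub: "fs.subspace A"
  proof -
    have "flinear (\<lambda>f. ?L (?d f))"
      unfolding flinear_def by (simp add: flinear_add[OF linL] flinear_scale[OF linL]
          flinear_add[OF flinear_koszul_diff] flinear_scale[OF flinear_koszul_diff])
    from fs_subspace_kernel[OF this subspace_kchain[OF F]] show ?thesis by (simp add: A_def)
  qed
  have fd: "fs.fin_dim A" by (rule fs.fin_dim_subset[OF fin_dim_kchain[OF F]]) (auto simp: A_def)
  have "{x \<in> A. ?L x = 0} = ?KZ"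
    using flinear_0[OF flinear_koszul_diff[of n]]
    by (auto simp: A_def ZF koszul_diff_lift_map[OF \<phi>, of n, symmetric])
  moreover have "?L ` A = kcyc n M (Suc p) j"
    unfolding A_def kcyc_def lift_map_kchain[symmetric] koszul_diff_lift_map[OF \<phi>, of n, symmetric]
    by blast
  ultimately have dA: "fs.dim A = fs.dim ?KZ + fs.dim (kcyc n M (Suc p) j)"
    using fs_rank_nullity[OF linL fd sub] by simp
  have "{x \<in> A. ?d x = 0} = kcyc n F (Suc p) j"
    by (auto simp: A_def kcyc_def flinear_0[OF linL])
  moreover have "?d ` A = ?X"
    using koszul_diff_kchain[OF F] by (auto simp: A_def kbd_def ZF')
  ultimately have dA': "fs.dim A = fs.dim (kbd n F (Suc p) j) + fs.dim ?X"
    using fs_rank_nullity[OF flinear_koszul_diff[of n] fd sub] acyc by simp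
  have "{x \<in> kbd n F (Suc p) j. ?L x = 0} = kcyc n Z (Suc p) j"
    unfolding acyc[symmetric] by (auto simp: kcyc_def ZF)
  moreover have "?L ` kbd n F (Suc p) j = kbd n M (Suc p) j"
    unfolding kbd_def lift_map_kchain[symmetric] image_image koszul_diff_lift_map[OF \<phi>] by (rule refl)
  ultimately have dU: "fs.dim (kbd n F (Suc p) j) = fs.dim (kcyc n Z (Suc p) j) + fs.dim (kbd n M (Suc p) j)"
    using fs_rank_nullity[OF linL fs.fin_dim_subset[OF fin_dim_kcyc[OF F] kbd_subset_kcyc[OF F]] subspace_kbd[OF F]]
    by simp
  show ?thesis
    using dA dA' dU dim_kchain_Suc[OF Z, of p j] unfolding kos_def by linarith
qed

lemma kos_shift_Suc:
  assumes "kcyc n F (Suc (Suc p)) j = kbd n F (Suc (Suc p)) j" "kcyc n F (Suc p) j = kbd n F (Suc p) j"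
  shows "kos n M (Suc (Suc p)) j = kos n Z (Suc p) j"
proof -
  have "kbd n F (Suc p) j \<inter> kchain n Z (Suc p) j = kcyc n Z (Suc p) j"
    unfolding assms(2)[symmetric] kcyc_def using kernel_lift_map[of "Suc p" j] by blast
  then show ?thesis using kos_shift[OF assms(1)] by (simp add: kos_def)
qed

end

section \<open>Modules spanned by monomials\<close>

lemma supp_space_iff: "v \<in> supp_space A \<longleftrightarrow> (\<forall>x m. lookup (v x) m \<noteq> 0 \<longrightarrow> (x, m) \<in> A)"
  by (simp add: supp_space_def)

lemma lookup_slice [simp]: "slice z F i = z (F, i)"
  by (simp add: slice_def)

lemma kchain_supp_space:
  "kchain n (\<lambda>e. supp_space (A e)) p j =
    supp_space {((F, i), u). F \<subseteq> {1..n} \<and> card F = p \<and> (i, u) \<in> A (j - int p)}" (is "?K = ?S")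
proof
  show "?K \<subseteq> ?S"
  proof
    fix z assume z: "z \<in> ?K"
    show "z \<in> ?S" unfolding supp_space_iff
    proof (intro allI impI)
      fix x u assume nz: "lookup (z x) u \<noteq> 0"
      obtain F i where x: "x = (F, i)" by (cases x)
      have "slice z F \<noteq> 0"
      proof
        assume "slice z F = 0"
        then have "slice z F i = 0" by simp
        then show False using nz x by simp
      qed
      then have F: "F \<subseteq> {1..n} \<and> card F = p" using kchainD(2)[OF z] by blast
      then have "slice z F \<in> supp_space (A (j - int p))" using kchainD(1)[OF z] by blast
      then have "(i, u) \<in> A (j - int p)" using nz x unfolding supp_space_iff by simp
      then show "(x, u) \<in> {((F, i), u). F \<subseteq> {1..n} \<and> card F = p \<and> (i, u) \<in> A (j - int p)}"
        using F x by simp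
    qed
  qed
  show "?S \<subseteq> ?K"
  proof
    fix z assume z: "z \<in> ?S"
    then have *: "F \<subseteq> {1..n} \<and> card F = p \<and> (i, u) \<in> A (j - int p)" if "lookup (z (F, i)) u \<noteq> 0" for F i u
      using that unfolding supp_space_iff by blast
    show "z \<in> ?K"
    proof (rule kchainI)
      fix F show "slice z F \<in> supp_space (A (j - int p))"
        unfolding supp_space_iff using * by auto
    next
      fix F assume "\<not> (F \<subseteq> {1..n} \<and> card F = p)"
      then have "lookup (z (F, i)) u = 0" for i u using * by blast
      then show "slice z F = 0" by (intro ext poly_mapping_eqI) simp
    qed
  qed
qed

lemma kchain_supp_spaceD:
  assumes "z \<in> kchain n (\<lambda>e. supp_space (A e)) p j" "lookup (z (F, i)) u \<noteq> 0"
  shows "F \<subseteq> {1..n}" "card F = p" "(i, u) \<in> A (j - int p)"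
  using assms unfolding kchain_supp_space supp_space_iff by blast+

lemma dim_kchain_supp_space:
  assumes "finite (A (j - int p))"
  shows "fs.dim (kchain n (\<lambda>e. supp_space (A e)) p j :: (_ \<Rightarrow> 'k::field mpoly) set) = (n choose p) * card (A (j - int p))"
proof -
  let ?X = "{F. F \<subseteq> {1..n} \<and> card F = p} \<times> A (j - int p)"
  let ?h = "\<lambda>(F, i, u). ((F, i), u)"
  have im: "{((F, i), u). F \<subseteq> {1..n} \<and> card F = p \<and> (i, u) \<in> A (j - int p)} = ?h ` ?X"
  proof (rule Set.set_eqI)
    fix x :: "(nat set \<times> nat) \<times> (nat \<Rightarrow>\<^sub>0 nat)"
    obtain F i u where x: "x = ((F, i), u)" by (cases x) auto
    have "x \<in> ?h ` ?X \<longleftrightarrow> (F, i, u) \<in> ?X"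
    proof
      assume "x \<in> ?h ` ?X"
      then obtain y where "y \<in> ?X" "x = ?h y" by blast
      then show "(F, i, u) \<in> ?X" unfolding x by (cases y) auto
    next
      assume "(F, i, u) \<in> ?X"
      then show "x \<in> ?h ` ?X" unfolding x by (rule rev_image_eqI) simp
    qed
    then show "x \<in> {((F, i), u). F \<subseteq> {1..n} \<and> card F = p \<and> (i, u) \<in> A (j - int p)} \<longleftrightarrow> x \<in> ?h ` ?X"
      unfolding x by simp
  qed
  have "inj_on ?h ?X" by (auto simp: inj_on_def)
  then have "card (?h ` ?X) = card ?X" by (rule card_image)
  also have "\<dots> = (n choose p) * card (A (j - int p))"
    unfolding card_cartesian_product n_subsets[OF finite_atLeastAtMost] by simp
  finally have c: "card (?h ` ?X) = (n choose p) * card (A (j - int p))" .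
  have "finite (?h ` ?X)" using assms by simp
  from dim_supp_space[OF this, where 'k='k] show ?thesis unfolding kchain_supp_space im c .
qed

lemma graded_module_supp_space:
  assumes "\<And>e. finite (A e)"
    and "\<And>e i m k. (i, m) \<in> A e \<Longrightarrow> k \<in> {1..n} \<Longrightarrow> (i, var_mon k + m) \<in> A (e + 1)"
  shows "graded_module n (\<lambda>e. supp_space (A e))"
  unfolding graded_module_def
proof (intro conjI allI ballI subspace_supp_space fin_dim_supp_space assms(1))
  fix e k and v :: "nat \<Rightarrow> 'a mpoly" assume k: "k \<in> {1..n}" and v: "v \<in> supp_space (A e)"
  show "xmul k v \<in> supp_space (A (e + 1))" unfolding supp_space_iff xmul_def
  proof (intro allI impI)
    fix i m assume "lookup (Var k * v i) m \<noteq> 0"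
    then have nz: "lookup m k \<noteq> 0" "lookup (v i) (m - var_mon k) \<noteq> 0"
      by (auto simp: lookup_Var_mult split: if_splits)
    then have "(i, m - var_mon k) \<in> A e" using v unfolding supp_space_iff by blast
    from assms(2)[OF this k] show "(i, m) \<in> A (e + 1)" using minus_var_mon_add[OF nz(1)] by simp
  qed
qed

text \<open>A contraction stays in the module spanned by given monomials as soon as dividing by the chosen variable does.\<close>

lemma contraction_kchain:
  assumes "\<And>G i u. G \<subseteq> {1..n} \<Longrightarrow> card G = Suc p \<Longrightarrow> \<kappa> (u + chi G) \<in> G \<Longrightarrow>
      lookup (z (G - {\<kappa> (u + chi G)}, i)) (u + var_mon (\<kappa> (u + chi G))) \<noteq> 0 \<Longrightarrow> (i, u) \<in> A (j - int (Suc p))"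
    and z: "z \<in> kchain n M p j"
  shows "contraction n \<kappa> z \<in> kchain n (\<lambda>e. supp_space (A e)) (Suc p) j"
  unfolding kchain_supp_space supp_space_iff
proof (intro allI impI)
  fix x u assume nz: "lookup (contraction n \<kappa> z x) u \<noteq> 0"
  obtain G i where x: "x = (G, i)" by (cases x)
  define k where "k = \<kappa> (u + chi G)"
  have G: "G \<subseteq> {1..n}" "k \<in> G" and l: "lookup (z (G - {k}, i)) (u + var_mon k) \<noteq> 0"
    using nz unfolding x lookup_contraction Let_def k_def[symmetric] by (auto split: if_splits)
  have "slice z (G - {k}) \<noteq> 0"
  proof
    assume "slice z (G - {k}) = 0"
    then have "slice z (G - {k}) i = 0" by simp
    then show False using l by simp
  qed
  then have "card (G - {k}) = p" using kchainD(2)[OF z] by blast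
  moreover have "finite G" using G(1) by (rule finite_subset) simp
  ultimately have c: "card G = Suc p" using G(2) by (metis card_Suc_Diff1)
  have "(i, u) \<in> A (j - int (Suc p))"
    by (rule assms(1)[OF G(1) c]) (use G l in \<open>simp_all add: k_def[symmetric]\<close>)
  then show "(x, u) \<in> {((F, i), u). F \<subseteq> {1..n} \<and> card F = Suc p \<and> (i, u) \<in> A (j - int (Suc p))}"
    using G c x by simp
qed

section \<open>Free modules have no higher Koszul homology\<close>

text \<open>The monomial basis of degree \<open>e\<close> of the direct sum of the \<open>S(-a)\<close> for \<open>a\<close> in
\<open>sh\<close>.\<close>

definition free_monoms :: "nat \<Rightarrow> int list \<Rightarrow> int \<Rightarrow> (nat \<times> (nat \<Rightarrow>\<^sub>0 nat)) set" where
  "free_monoms n sh e = {(i, m). i < length sh \<and> m \<in> monoms n (e - sh ! i)}"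

definition gfree :: "nat \<Rightarrow> int list \<Rightarrow> int \<Rightarrow> (nat \<Rightarrow> 'k::field mpoly) set" where
  "gfree n sh e = supp_space (free_monoms n sh e)"

lemma finite_free_monoms: "finite (free_monoms n sh e)"
proof -
  have "free_monoms n sh e = (SIGMA i:{..<length sh}. monoms n (e - sh ! i))"
    by (auto simp: free_monoms_def)
  then show ?thesis by simp
qed

lemma monoms_add_var: "k \<in> {1..n} \<Longrightarrow> var_mon k + m \<in> monoms n (e + 1) \<longleftrightarrow> m \<in> monoms n e"
  by (auto simp: monoms_def keys_add_nat)

lemma graded_module_gfree: "graded_module n (gfree n sh)"
proof -
  have "(i, var_mon k + m) \<in> free_monoms n sh (e + 1)"
    if "(i, m) \<in> free_monoms n sh e" "k \<in> {1..n}" for i m e k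
    using that monoms_add_var[OF that(2), of m "e - sh ! i"] by (simp add: free_monoms_def algebra_simps)
  then show ?thesis
    using graded_module_supp_space[of "free_monoms n sh" n] finite_free_monoms
    unfolding gfree_def[abs_def] by blast
qed

text \<open>Reduction modulo \<open>(x\<^sub>1, \<dots>, x\<^sub>n)\<close>, with the quotient realised as constant tuples.\<close>

definition eps :: "(nat \<Rightarrow> 'k::field mpoly) \<Rightarrow> nat \<Rightarrow> 'k mpoly" where
  "eps v = (\<lambda>i. const (lookup (v i) 0))"

lemma flinear_eps: "flinear eps"
  by (auto simp: flinear_def eps_def fun_eq_iff fsc_apply lookup_add const_add const_mult)

lemma const_eq_0_iff [simp]: "const c = 0 \<longleftrightarrow> c = 0"
  by (metis const_0 const_def lookup_single_eq)

lemma eps_eq_0_iff: "eps v = 0 \<longleftrightarrow> (\<forall>i. lookup (v i) 0 = 0)"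
  by (auto simp: eps_def fun_eq_iff)

text \<open>A cycle of a free module is contracted along any variable that occurs in its multidegree. The only multidegree without variables is zero,
which occurs only for constant coefficients of \<open>e\<^bsub>{}\<^esub>\<close>.\<close>

lemma gfree_boundary:
  assumes z: "z \<in> kcyc n (gfree n sh) p j"
    and nz: "\<And>i. p = 0 \<Longrightarrow> lookup (z ({}, i)) 0 = 0"
  shows "z \<in> kbd n (gfree n sh) p j"
proof -
  let ?A = "free_monoms n sh"
  define \<kappa> :: "(nat \<Rightarrow>\<^sub>0 nat) \<Rightarrow> nat" where "\<kappa> a = (SOME k. k \<in> keys a)" for a
  have zc: "z \<in> kchain n (\<lambda>e. supp_space (?A e)) p j" and cyc: "koszul_diff n z = 0"
    using z by (auto simp: kcyc_def gfree_def[abs_def])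
  have \<kappa>: "G \<subseteq> {1..n} \<and> \<kappa> (u + chi G) \<in> {1..n} \<and> lookup (u + chi G) (\<kappa> (u + chi G)) \<noteq> 0"
    if "lookup (z (G, i)) u \<noteq> 0" for G i u
  proof -
    have G: "G \<subseteq> {1..n}" "card G = p" "(i, u) \<in> ?A (j - int p)"
      using kchain_supp_spaceD[OF zc that] by blast+
    have fG: "finite G" using G(1) by (rule finite_subset) simp
    have "u + chi G \<noteq> 0"
    proof
      assume "u + chi G = 0"
      then have "total_deg u + card G = 0" using total_deg_add[of u "chi G"] total_deg_chi[OF fG] by simp
      then have "u = 0" "p = 0" "G = {}" using G(2) fG by auto
      then show False using nz that by blast
    qed
    then obtain k where "k \<in> keys (u + chi G)" by (metis keys_eq_empty ex_in_conv)
    then have k: "\<kappa> (u + chi G) \<in> keys (u + chi G)" unfolding \<kappa>_def by (rule someI)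
    moreover have "keys (u + chi G) \<subseteq> {1..n}"
      using G fG by (auto simp: keys_add_nat keys_chi free_monoms_def monoms_def)
    ultimately show ?thesis using G(1) unfolding in_keys_iff[symmetric] by blast
  qed
  have "contraction n \<kappa> z \<in> kchain n (\<lambda>e. supp_space (?A e)) (Suc p) j"
  proof (rule contraction_kchain[OF _ zc])
    fix G i u
    assume G: "G \<subseteq> {1..n}" "\<kappa> (u + chi G) \<in> G"
      and l: "lookup (z (G - {\<kappa> (u + chi G)}, i)) (u + var_mon (\<kappa> (u + chi G))) \<noteq> 0"
    have "(i, u + var_mon (\<kappa> (u + chi G))) \<in> ?A (j - int p)"
      using kchain_supp_spaceD(3)[OF zc l] .
    then show "(i, u) \<in> ?A (j - int (Suc p))"
      using monoms_add_var[of "\<kappa> (u + chi G)" n u "j - int (Suc p) - sh ! i"] G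
      by (auto simp: free_monoms_def add.commute algebra_simps)
  qed
  then have "koszul_diff n (contraction n \<kappa> z) \<in> kbd n (gfree n sh) p j"
    by (simp add: kbd_def gfree_def[abs_def])
  moreover have "koszul_diff n (contraction n \<kappa> z) = z"
    by (rule koszul_diff_contraction[OF cyc \<kappa>])
  ultimately show ?thesis by simp
qed

lemma gfree_acyclic: "kcyc n (gfree n sh) (Suc p) j = kbd n (gfree n sh) (Suc p) j"
  using gfree_boundary[of _ n sh "Suc p" j] kbd_subset_kcyc[OF graded_module_gfree, of n sh "Suc p" j] by blast

lemma kchain_zero: "kchain n M 0 j = chain_at {} ` M j"
proof
  show "kchain n M 0 j \<subseteq> chain_at {} ` M j"
  proof
    fix z assume z: "z \<in> kchain n M 0 j"
    have "slice z {} \<in> M j" using kchainD(1)[OF z, of "{}"] by simp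
    moreover have "z = chain_at {} (slice z {})"
    proof (rule chain_eqI)
      fix F show "slice z F = slice (chain_at {} (slice z {})) F"
      proof (cases "F = {}")
        case False
        have "\<not> (F \<subseteq> {1..n} \<and> card F = 0)"
        proof
          assume *: "F \<subseteq> {1..n} \<and> card F = 0"
          have "finite F" by (rule finite_subset[OF conjunct1[OF *]]) simp
          then show False using * False by simp
        qed
        then show ?thesis using kchainD(2)[OF z, of F] False by (simp add: slice_chain_at)
      qed (simp add: slice_chain_at)
    qed
    ultimately show "z \<in> chain_at {} ` M j" by blast
  qed
  show "chain_at {} ` M j \<subseteq> kchain n M 0 j"
  proof clarify
    fix v assume v: "v \<in> M j"
    show "chain_at {} v \<in> kchain n M 0 j"
    proof (rule kchainI)
      fix F :: "nat set" assume F: "F \<subseteq> {1..n}" "card F = 0"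
      have "finite F" using F(1) by (rule finite_subset) simp
      then have "F = {}" using F(2) by simp
      then show "slice (chain_at {} v) F \<in> M (j - int 0)" using v by (simp add: slice_chain_at)
    next
      fix F :: "nat set" assume "\<not> (F \<subseteq> {1..n} \<and> card F = 0)"
      then have "F \<noteq> {}" by auto
      then show "slice (chain_at {} v) F = 0" by (simp add: slice_chain_at)
    qed
  qed
qed

lemma chain_at_eq_0_iff: "chain_at F v = 0 \<longleftrightarrow> v = 0"
proof
  assume "chain_at F v = 0"
  then have "slice (chain_at F v) F = slice 0 F" by (rule arg_cong)
  then show "v = 0" by (simp add: slice_chain_at)
qed (simp add: flinear_0[OF flinear_chain_at])

lemma dim_chain_at: "fs.fin_dim U \<Longrightarrow> fs.subspace U \<Longrightarrow> fs.dim (chain_at F ` U) = fs.dim U"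
  by (rule fs_dim_image_inj[OF flinear_chain_at]) (auto simp: chain_at_eq_0_iff)

text \<open>The boundaries in homological degree zero are the tuples in \<open>(x\<^sub>1, \<dots>, x\<^sub>n) F\<close>.\<close>

lemma kbd_gfree_0:
  "(kbd n (gfree n sh) 0 j :: (_ \<Rightarrow> 'k::field mpoly) set) = chain_at {} ` {v \<in> gfree n sh j. eps v = 0}"
proof
  show "(kbd n (gfree n sh) 0 j :: (_ \<Rightarrow> 'k mpoly) set) \<subseteq> chain_at {} ` {v \<in> gfree n sh j. eps v = 0}"
  proof
    fix z :: "nat set \<times> nat \<Rightarrow> 'k mpoly" assume z: "z \<in> kbd n (gfree n sh) 0 j"
    then have "z \<in> kchain n (gfree n sh) 0 j"
      using kbd_subset_kcyc[OF graded_module_gfree, of n sh 0 j] unfolding kcyc_0 by blast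
    then obtain v where v: "v \<in> gfree n sh j" "z = chain_at {} v" unfolding kchain_zero by blast
    obtain y where y: "z = koszul_diff n y" using z unfolding kbd_def by blast
    have "lookup (v i) 0 = 0" for i
    proof -
      have "v i = z ({}, i)" by (simp add: v(2) chain_at_def)
      then show ?thesis by (simp add: y lookup_koszul_diff)
    qed
    then show "z \<in> chain_at {} ` {v \<in> gfree n sh j. eps v = 0}" using v by (auto simp: eps_eq_0_iff)
  qed
  show "chain_at {} ` {v \<in> gfree n sh j. eps v = 0} \<subseteq> (kbd n (gfree n sh) 0 j :: (_ \<Rightarrow> 'k mpoly) set)"
  proof clarify
    fix v :: "nat \<Rightarrow> 'k mpoly" assume v: "v \<in> gfree n sh j" "eps v = 0"
    show "chain_at {} v \<in> kbd n (gfree n sh) 0 j"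
    proof (rule gfree_boundary)
      show "chain_at {} v \<in> kcyc n (gfree n sh) 0 j" unfolding kcyc_0 kchain_zero using v by blast
      show "lookup (chain_at {} v ({}, i)) 0 = 0" for i using v(2) by (simp add: chain_at_def eps_eq_0_iff)
    qed
  qed
qed

lemma card_free_monoms_0: "card {x. \<exists>i<length sh. sh ! i = j \<and> x = (i, 0 :: nat \<Rightarrow>\<^sub>0 nat)} = count_list sh j"
proof -
  have "{x. \<exists>i<length sh. sh ! i = j \<and> x = (i, 0 :: nat \<Rightarrow>\<^sub>0 nat)} = (\<lambda>i. (i, 0)) ` {i. i < length sh \<and> sh ! i = j}"
    by auto
  moreover have "card ((\<lambda>i. (i, 0 :: nat \<Rightarrow>\<^sub>0 nat)) ` {i. i < length sh \<and> sh ! i = j}) = card {i. i < length sh \<and> sh ! i = j}"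
    by (rule card_image) (auto simp: inj_on_def)
  moreover have "card {i. i < length sh \<and> sh ! i = j} = count_list sh j"
    by (simp add: count_list_eq_length_filter length_filter_conv_card eq_commute)
  ultimately show ?thesis by (simp only:)
qed

lemma eps_gfree: "(eps ` gfree n sh j :: (nat \<Rightarrow> 'k::field mpoly) set) = supp_space {x. \<exists>i<length sh. sh ! i = j \<and> x = (i, 0)}"
proof
  show "(eps ` gfree n sh j :: (nat \<Rightarrow> 'k::field mpoly) set) \<subseteq> supp_space {x. \<exists>i<length sh. sh ! i = j \<and> x = (i, 0)}"
    by (force simp: eps_def const_def gfree_def supp_space_iff lookup_single when_def free_monoms_def monoms_def split: if_splits)
  show "supp_space {x. \<exists>i<length sh. sh ! i = j \<and> x = (i, 0)} \<subseteq> (eps ` gfree n sh j :: (nat \<Rightarrow> 'k::field mpoly) set)"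
  proof
    fix v :: "nat \<Rightarrow> 'k mpoly" assume v: "v \<in> supp_space {x. \<exists>i<length sh. sh ! i = j \<and> x = (i, 0)}"
    have "v = eps v"
    proof (rule ext, rule poly_mapping_eqI)
      fix i m show "lookup (v i) m = lookup (eps v i) m"
        using v by (auto simp: eps_def const_def supp_space_iff lookup_single when_def)
    qed
    moreover have "v \<in> gfree n sh j"
      using v by (force simp: gfree_def supp_space_iff free_monoms_def monoms_def)
    ultimately show "v \<in> eps ` gfree n sh j" by (rule image_eqI)
  qed
qed

lemma dim_eps_gfree: "fs.dim (eps ` gfree n sh j :: (nat \<Rightarrow> 'k::field mpoly) set) = count_list sh j"
proof -
  let ?X = "{x. \<exists>i<length sh. sh ! i = j \<and> x = (i, 0 :: nat \<Rightarrow>\<^sub>0 nat)}"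
  have "?X = (\<lambda>i. (i, 0)) ` {i. i < length sh \<and> sh ! i = j}" by auto
  then have "finite ?X" by simp
  then show ?thesis unfolding eps_gfree using dim_supp_space[of ?X, where 'k='k] card_free_monoms_0[of sh j] by simp
qed

lemma subspace_eps_kernel: "fs.subspace U \<Longrightarrow> fs.subspace {v \<in> U. eps v = 0}"
  by (rule fs_subspace_kernel[OF flinear_eps])

text \<open>Here \<open>Z\<close> consists of the relations between the images of the basis elements of a free module.\<close>

locale free_exact = graded_exact n "gfree n sh" M Z \<phi>
  for n sh and M Z :: "int \<Rightarrow> (nat \<Rightarrow> 'k::field mpoly) set" and \<phi>
begin

text \<open>The number of basis elements of degree \<open>j\<close> exceeds the number of generators of \<open>M\<close> needed in that degree by the
rank of the relations modulo the maximal ideal, i.e. by the number of superfluous generators.\<close>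

lemma kos_0_add: "count_list sh j = kos n M 0 j + fs.dim (eps ` Z j)"
proof -
  let ?F = "gfree n sh j :: (nat \<Rightarrow> 'k mpoly) set"
  let ?U = "{v \<in> ?F. eps v = 0}"
  note fF = graded_moduleD(1,2)[OF F, of j] and fZ = graded_moduleD(1,2)[OF Z, of j] and fM = graded_moduleD(1,2)[OF M, of j]
  have sU: "fs.subspace ?U" by (rule subspace_eps_kernel[OF fF(1)])
  have dU: "fs.fin_dim ?U" by (rule fs.fin_dim_subset[OF fF(2)]) blast
  have 1: "fs.dim ?F = fs.dim ?U + count_list sh j"
    using fs_rank_nullity[OF flinear_eps fF(2,1)] dim_eps_gfree by simp
  have 2: "fs.dim ?F = fs.dim (Z j) + fs.dim (M j)"
    using fs_rank_nullity[OF lin fF(2,1)] by (simp add: M_eq Z_eq)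
  have 3: "fs.dim (Z j) = fs.dim {v \<in> Z j. eps v = 0} + fs.dim (eps ` Z j)"
    using fs_rank_nullity[OF flinear_eps fZ(2,1)] .
  have "{v \<in> ?U. \<phi> v = 0} = {v \<in> Z j. eps v = 0}" by (auto simp: Z_eq)
  then have 4: "fs.dim ?U = fs.dim {v \<in> Z j. eps v = 0} + fs.dim (\<phi> ` ?U)"
    using fs_rank_nullity[OF lin dU sU] by simp
  have la: "lift_map \<phi> (chain_at {} v) = chain_at {} (\<phi> v)" for v
    by (rule chain_eqI) (simp only: slice_lift_map slice_chain_at flinear_0[OF lin] if_distrib[of \<phi>])
  have "kbd n M 0 j = lift_map \<phi> ` kbd n (gfree n sh) 0 j"
    unfolding kbd_def lift_map_kchain[symmetric] image_image koszul_diff_lift_map[OF \<phi>] by (rule refl)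
  also have "\<dots> = chain_at {} ` (\<phi> ` ?U)" unfolding kbd_gfree_0 image_image la by (rule refl)
  finally have kb: "kbd n M 0 j = chain_at {} ` (\<phi> ` ?U)" .
  have 5: "fs.dim (kbd n M 0 j) = fs.dim (\<phi> ` ?U)"
    unfolding kb by (rule dim_chain_at[OF fs_fin_dim_image[OF lin dU] fs_subspace_image[OF lin sU]])
  have 6: "fs.dim (kcyc n M 0 j) = fs.dim (M j)"
    unfolding kcyc_0 kchain_zero by (rule dim_chain_at[OF fM(2,1)])
  show ?thesis using 1 2 3 4 5 6 dim_kbd_le[OF M, of 0 j] unfolding kos_def by linarith
qed

text \<open>The relations need as many generators as the first Koszul homology of \<open>M\<close> predicts, plus those that express superfluous
generators of \<open>M\<close>.\<close>

lemma kos_0_kernel: "kos n Z 0 j = kos n M 1 j + fs.dim (eps ` Z j)"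
proof -
  note fZ = graded_moduleD(1,2)[OF Z, of j]
  have sU: "fs.subspace {v \<in> Z j. eps v = 0}" by (rule subspace_eps_kernel[OF fZ(1)])
  have dU: "fs.fin_dim {v \<in> Z j. eps v = 0}" by (rule fs.fin_dim_subset[OF fZ(2)]) blast
  have inj: "inj (chain_at {} :: (nat \<Rightarrow> 'k mpoly) \<Rightarrow> _)"
  proof (rule injI)
    fix v w :: "nat \<Rightarrow> 'k mpoly" assume "chain_at {} v = chain_at {} w"
    then have "slice (chain_at {} v) {} = slice (chain_at {} w) {}" by simp
    then show "v = w" unfolding slice_chain_at by simp
  qed
  have "{v \<in> gfree n sh j :: (nat \<Rightarrow> 'k mpoly) set. eps v = 0} \<inter> Z j = {v \<in> Z j. eps v = 0}" by (auto simp: Z_eq)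
  then have eq: "kbd n (gfree n sh) 0 j \<inter> kchain n Z 0 j = chain_at {} ` {v \<in> Z j. eps v = 0}"
    unfolding kbd_gfree_0 kchain_zero image_Int[OF inj, symmetric] by simp
  have 1: "kos n M 1 j = fs.dim {v \<in> Z j. eps v = 0} - fs.dim (kbd n Z 0 j)"
    using kos_shift[OF gfree_acyclic, of 0 j] unfolding eq dim_chain_at[OF dU sU] One_nat_def .
  have sub: "kbd n Z 0 j \<subseteq> kbd n (gfree n sh) 0 j \<inter> kchain n Z 0 j"
  proof -
    have "kchain n Z (Suc 0) j \<subseteq> kchain n (gfree n sh) (Suc 0) j"
      using kernel_lift_map by blast
    then show ?thesis using kbd_subset_kcyc[OF Z, of 0 j] unfolding kcyc_0 kbd_def by blast
  qed
  have "fs.dim (kbd n Z 0 j) \<le> fs.dim {v \<in> Z j. eps v = 0}"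
    using fs.dim_mono_fin[OF fs_fin_dim_image[OF flinear_chain_at dU] sub[unfolded eq]]
    unfolding dim_chain_at[OF dU sU] .
  moreover have "fs.dim (kcyc n Z 0 j) = fs.dim (Z j)"
    unfolding kcyc_0 kchain_zero by (rule dim_chain_at[OF fZ(2,1)])
  moreover have "fs.dim (Z j) = fs.dim {v \<in> Z j. eps v = 0} + fs.dim (eps ` Z j)"
    using fs_rank_nullity[OF flinear_eps fZ(2,1)] .
  ultimately show ?thesis using 1 unfolding kos_def by linarith
qed

lemma kos_Suc_Suc: "kos n M (Suc (Suc p)) j = kos n Z (Suc p) j"
  by (rule kos_shift_Suc[OF gfree_acyclic gfree_acyclic])

end

section \<open>Ranks and kernels of matrices as dimensions of subspaces\<close>

text \<open>Column vectors over the field become constant tuples; ranks and kernel dimensions of matrices are thereby compared with dimensions of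
spaces of functions.\<close>

definition vec_fun :: "'k::field vec \<Rightarrow> nat \<Rightarrow> 'k mpoly" where
  "vec_fun x = (\<lambda>i. if i < dim_vec x then const (x $ i) else 0)"

lemma const_sum: "const (sum f A) = (\<Sum>a\<in>A. const (f a))"
  by (induction A rule: infinite_finite_induct) (auto simp: const_add)

lemma lookup_const_0 [simp]: "lookup (const c) 0 = c"
  by (simp add: const_def)

lemma const_inject [simp]: "const a = const b \<longleftrightarrow> a = b"
  by (metis lookup_const_0)

lemma inj_on_vec_fun: "inj_on vec_fun (carrier_vec n)"
proof (rule inj_onI)
  fix x y :: "'k::field vec" assume c: "x \<in> carrier_vec n" "y \<in> carrier_vec n" and e: "vec_fun x = vec_fun y"
  show "x = y"
  proof (rule eq_vecI)
    fix i assume "i < dim_vec y"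
    then show "x $ i = y $ i" using fun_cong[OF e, of i] c by (simp add: vec_fun_def)
  qed (use c in auto)
qed

lemma (in vec_space) vec_fun_lincomb:
  assumes X: "X \<subseteq> carrier_vec n" "finite X"
  shows "vec_fun (lincomb a X) = (\<Sum>x\<in>X. fsc (a x) (vec_fun x))"
proof (rule ext)
  fix i
  show "vec_fun (lincomb a X) i = (\<Sum>x\<in>X. fsc (a x) (vec_fun x)) i"
  proof (cases "i < n")
    case True
    have "(\<Sum>x\<in>X. fsc (a x) (vec_fun x)) i = (\<Sum>x\<in>X. const (a x * x $ i))"
      unfolding sum_fun_apply using X True by (intro sum.cong refl) (auto simp: fsc_apply vec_fun_def const_mult)
    then show ?thesis using lincomb_index[OF True X(1), of a] lincomb_dim[OF X(2,1), of a] True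
      by (simp add: vec_fun_def const_sum)
  next
    case False
    have "(\<Sum>x\<in>X. fsc (a x) (vec_fun x)) i = 0"
      unfolding sum_fun_apply using X False by (intro sum.neutral) (auto simp: fsc_apply vec_fun_def)
    then show ?thesis using lincomb_dim[OF X(2,1), of a] False by (simp add: vec_fun_def)
  qed
qed

lemma (in vec_space) dim_submodule_eq:
  assumes sub: "submodule class_ring W V" and B: "finite B" "vectorspace.basis class_ring (vs W) B"
  shows "vectorspace.dim class_ring (vs W) = fs.dim (vec_fun ` W)"
proof -
  have WV: "W \<subseteq> carrier_vec n" using sub unfolding submodule_def by simp
  have vs: "vectorspace class_ring (vs W)"
    by (rule subspace_is_vs) (simp add: subspace_def vec_vs sub)
  have BW: "B \<subseteq> W" and ind: "LinearCombinations.module.lin_indpt class_ring (vs W) B"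
    and gen: "LinearCombinations.module.span class_ring (vs W) B = W"
    using B(2) unfolding vectorspace.basis_def[OF vs] by auto
  have ind': "lin_indpt B" using ind span_li_not_depend(2)[OF BW sub] by simp
  have gen': "span B = W" using gen span_li_not_depend(1)[OF BW sub] by simp
  have BV: "B \<subseteq> carrier_vec n" using BW WV by blast
  have inj: "inj_on vec_fun B" using inj_on_vec_fun BV inj_on_subset by blast
  have "fs.independent (vec_fun ` B)"
  proof (rule fs.independent_if_scalars_zero)
    fix g u assume z: "(\<Sum>x\<in>vec_fun ` B. fsc (g x) x) = 0" and u: "u \<in> vec_fun ` B"
    obtain b where b: "b \<in> B" "u = vec_fun b" using u by blast
    have "(\<Sum>x\<in>vec_fun ` B. fsc (g x) x) = vec_fun (lincomb (\<lambda>x. g (vec_fun x)) B)"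
      unfolding vec_fun_lincomb[OF BV B(1)] by (simp add: sum.reindex[OF inj])
    then have "vec_fun (lincomb (\<lambda>x. g (vec_fun x)) B) = vec_fun (0\<^sub>v n)"
      using z by (simp add: vec_fun_def fun_eq_iff)
    then have "lincomb (\<lambda>x. g (vec_fun x)) B = 0\<^sub>v n"
      using inj_on_vec_fun[of n] BV lincomb_closed[OF BV] by (auto dest!: inj_onD)
    then have "lin_dep B" if "g (vec_fun b) \<noteq> 0"
      using lin_dep_crit[OF B(1) order_refl _ b(1), of "\<lambda>x. g (vec_fun x)"] that by simp
    then show "g u = 0" using ind' b(2) by blast
  qed (use B in simp)
  moreover have "vec_fun ` W \<subseteq> fs.span (vec_fun ` B)"
  proof clarify
    fix w assume "w \<in> W"
    then have "w \<in> span B" using gen' by simp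
    then obtain a where "w = lincomb a B" using B(1) BV finite_span[of B] by auto
    then have "vec_fun w = (\<Sum>x\<in>B. fsc (a x) (vec_fun x))" using vec_fun_lincomb[OF BV B(1)] by simp
    moreover have "(\<Sum>x\<in>B. fsc (a x) (vec_fun x)) \<in> fs.span (vec_fun ` B)"
      by (intro fs.span_sum fs.span_scale fs.span_base) auto
    ultimately show "vec_fun w \<in> fs.span (vec_fun ` B)" by simp
  qed
  moreover have "vec_fun ` B \<subseteq> vec_fun ` W" using BW by blast
  ultimately have "fs.dim (vec_fun ` W) = card (vec_fun ` B)"
    using fs.basis_card_eq_dim by metis
  then show ?thesis
    using vectorspace.dim_basis[OF vs B] card_image[OF inj] by simp
qed

lemma mat_rank_eq:
  assumes A: "A \<in> carrier_mat nr nc"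
  shows "mat_rank A = fs.dim (vec_fun ` ((\<lambda>x. A *\<^sub>v x) ` carrier_vec nc))"
proof -
  interpret V: vec_space "TYPE('a)" nr .
  let ?C = "set (cols A)"
  have C: "?C \<subseteq> carrier_vec nr" using cols_dim[of A] A by simp
  have sub: "submodule class_ring (V.span ?C) V.V" using V.span_is_submodule C by simp
  have "vectorspace class_ring (V.span_vs ?C)"
    by (rule V.subspace_is_vs) (simp add: subspace_def vec_vs sub)
  then obtain B where "finite B" "vectorspace.basis class_ring (V.span_vs ?C) B"
    using vectorspace.finite_basis_exists V.fin_dim_span_cols[OF A] by blast
  from V.dim_submodule_eq[OF sub this]
  have "V.rank A = fs.dim (vec_fun ` V.span ?C)" unfolding V.rank_def .
  moreover have "V.span ?C = (\<lambda>x. A *\<^sub>v x) ` carrier_vec nc"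
    using V.col_space_eq[OF A] A unfolding V.col_space_def by auto
  ultimately show ?thesis using A by (simp add: mat_rank_def)
qed

lemma kernel_dim_eq:
  assumes A: "A \<in> carrier_mat nr nc"
  shows "kernel_dim A = fs.dim (vec_fun ` mat_kernel A)"
proof -
  interpret K: kernel nr nc A by unfold_locales (rule A)
  obtain B where B: "finite B" "K.basis B" using kernel_basis_exists[OF A] by blast
  have sub: "submodule class_ring (mat_kernel A) K.NC.V"
    by (unfold_locales)
       (insert A mult_add_distrib_mat_vec[OF A] mult_mat_vec[OF A] mat_kernel[OF A], auto simp: class_ring_simps module_vec_simps)
  show ?thesis using K.NC.dim_submodule_eq[OF sub B] A by (simp add: kernel_dim_def)
qed

definition mat_map :: "'k::field mpoly mat \<Rightarrow> (nat \<Rightarrow> 'k mpoly) \<Rightarrow> nat \<Rightarrow> 'k mpoly" where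
  "mat_map A v = (\<lambda>r. if r < dim_row A then \<Sum>c<dim_col A. A $$ (r, c) * v c else 0)"

lemma xlinear_mat_map: "xlinear (mat_map A)"
proof -
  have "flinear (mat_map A)"
    by (auto simp: flinear_def mat_map_def fun_eq_iff fsc_apply sum.distrib algebra_simps sum_distrib_left)
  moreover have "mat_map A (xmul k v) = xmul k (mat_map A v)" for k v
    by (auto simp: mat_map_def xmul_def fun_eq_iff sum_distrib_left algebra_simps)
  ultimately show ?thesis by (simp add: xlinear_def)
qed

lemma flinear_mat_map: "flinear (mat_map A)"
  using xlinear_mat_map[of A] by (simp add: xlinear_def)

lemma mat_map_vec_fun:
  assumes "A \<in> carrier_mat nr nc" "x \<in> carrier_vec nc"
  shows "mat_map (map_mat const A) (vec_fun x) = vec_fun (A *\<^sub>v x)"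
  using assms by (auto simp: fun_eq_iff mat_map_def vec_fun_def scalar_prod_def const_sum const_mult lessThan_atLeast0 intro!: sum.cong)

lemma vec_fun_carrier: "vec_fun ` carrier_vec nc = supp_space {(i, m). i < nc \<and> m = 0}"
proof
  show "vec_fun ` carrier_vec nc \<subseteq> supp_space {(i, m). i < nc \<and> m = 0}"
    by (auto simp: supp_space_iff vec_fun_def const_def lookup_single when_def split: if_splits)
  show "supp_space {(i, m). i < nc \<and> m = 0} \<subseteq> (vec_fun ` carrier_vec nc :: (nat \<Rightarrow> 'k::field mpoly) set)"
  proof
    fix v :: "nat \<Rightarrow> 'k mpoly" assume v: "v \<in> supp_space {(i, m). i < nc \<and> m = 0}"
    have "v = vec_fun (vec nc (\<lambda>i. lookup (v i) 0))"
    proof (rule ext, rule poly_mapping_eqI)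
      fix i m show "lookup (v i) m = lookup (vec_fun (vec nc (\<lambda>i. lookup (v i) 0)) i) m"
        using v by (auto simp: vec_fun_def const_def supp_space_iff lookup_single when_def)
    qed
    then show "v \<in> vec_fun ` carrier_vec nc" by (rule image_eqI) simp
  qed
qed

text \<open>Rank-nullity for matrices, transferred from the one for spaces of functions.\<close>

lemma rank_kernel_dim:
  fixes A :: "'k::field mat"
  assumes A: "A \<in> carrier_mat nr nc"
  shows "kernel_dim A + mat_rank A = nc"
proof -
  let ?U = "supp_space {(i, m). i < nc \<and> m = 0} :: (nat \<Rightarrow> 'k mpoly) set"
  let ?f = "mat_map (map_mat const A)"
  have eq: "{(i, m :: nat \<Rightarrow>\<^sub>0 nat). i < nc \<and> m = 0} = {..<nc} \<times> {0}" by auto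
  then have fin: "finite {(i, m :: nat \<Rightarrow>\<^sub>0 nat). i < nc \<and> m = 0}" by simp
  have nc: "fs.dim ?U = nc" using dim_supp_space[OF fin, where 'k='k] eq by (simp add: card_cartesian_product)
  have f0: "?f (vec_fun x) = 0 \<longleftrightarrow> A *\<^sub>v x = 0\<^sub>v nr" if x: "x \<in> carrier_vec nc" for x
  proof -
    have z: "vec_fun (0\<^sub>v nr) = (0 :: nat \<Rightarrow> 'k mpoly)" by (auto simp: vec_fun_def fun_eq_iff)
    show ?thesis unfolding mat_map_vec_fun[OF A x] z[symmetric]
      using inj_onD[OF inj_on_vec_fun[of nr], of "A *\<^sub>v x" "0\<^sub>v nr"] A x by auto
  qed
  have "{v \<in> ?U. ?f v = 0} = vec_fun ` mat_kernel A"
    unfolding vec_fun_carrier[symmetric] mat_kernel[OF A] using f0 by blast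
  moreover have "?f ` ?U = vec_fun ` ((\<lambda>x. A *\<^sub>v x) ` carrier_vec nc)"
    unfolding vec_fun_carrier[symmetric] image_image using mat_map_vec_fun[OF A] by (rule image_cong[OF refl])
  ultimately show ?thesis
    using fs_rank_nullity[OF flinear_mat_map fin_dim_supp_space[OF fin] subspace_supp_space, of "map_mat const A"]
      nc mat_rank_eq[OF A] kernel_dim_eq[OF A] by simp
qed

section \<open>Homogeneous components\<close>

text \<open>The homogeneous component of degree \<open>e\<close>.\<close>

definition pcomp :: "int \<Rightarrow> 'k::field mpoly \<Rightarrow> 'k mpoly" where
  "pcomp e p = Abs_poly_mapping (\<lambda>m. if int (total_deg m) = e then lookup p m else 0)"

lemma lookup_pcomp: "lookup (pcomp e p) m = (if int (total_deg m) = e then lookup p m else 0)"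
proof -
  have "finite {m. (if int (total_deg m) = e then lookup p m else 0) \<noteq> 0}"
    by (rule finite_subset[OF _ finite_keys[of p]]) (auto simp: in_keys_iff)
  from lookup_Abs_poly_mapping[OF this] show ?thesis unfolding pcomp_def by (rule fun_cong)
qed

lemma pcomp_add: "pcomp e (p + q) = pcomp e p + pcomp e q"
  by (rule poly_mapping_eqI) (simp add: lookup_pcomp lookup_add)

lemma pcomp_0 [simp]: "pcomp e 0 = 0"
  by (rule poly_mapping_eqI) (simp add: lookup_pcomp)

lemma pcomp_sum: "pcomp e (sum f A) = (\<Sum>a\<in>A. pcomp e (f a))"
  by (induction A rule: infinite_finite_induct) (auto simp: pcomp_add)

lemma pcomp_single_mult:
  "pcomp e (Poly_Mapping.single s c * q) = Poly_Mapping.single s c * pcomp (e - int (total_deg s)) q"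
proof (rule poly_mapping_eqI)
  fix m
  show "lookup (pcomp e (Poly_Mapping.single s c * q)) m =
      lookup (Poly_Mapping.single s c * pcomp (e - int (total_deg s)) q) m"
  proof (cases "\<exists>u. m = s + u")
    case True
    then obtain u where m: "m = s + u" by blast
    show ?thesis unfolding m lookup_pcomp lookup_single_mult by auto
  next
    case False
    then have "\<And>u. m \<noteq> s + u" by blast
    then show ?thesis unfolding lookup_pcomp by (simp add: lookup_single_mult_eq_0)
  qed
qed

lemma mpoly_as_sum: "(\<Sum>m\<in>keys p. Poly_Mapping.single m (lookup p m)) = p"
  by (rule poly_mapping_eqI) (auto simp: lookup_sum lookup_single when_def in_keys_iff)

lemma pcomp_mult:
  assumes "p \<in> hom_part n a"
  shows "pcomp e (p * q) = p * pcomp (e - a) q"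
proof -
  have deg: "int (total_deg m) = a" if "m \<in> keys p" for m
    using assms that by (simp add: hom_part_def)
  have "pcomp e (p * q) = pcomp e ((\<Sum>m\<in>keys p. Poly_Mapping.single m (lookup p m)) * q)"
    unfolding mpoly_as_sum by (rule refl)
  also have "\<dots> = (\<Sum>m\<in>keys p. Poly_Mapping.single m (lookup p m) * pcomp (e - a) q)"
    unfolding sum_distrib_right pcomp_sum pcomp_single_mult using deg by (intro sum.cong) auto
  also have "\<dots> = p * pcomp (e - a) q"
    unfolding sum_distrib_right[symmetric] mpoly_as_sum by (rule refl)
  finally show ?thesis .
qed

lemma pcomp_hom_part: "p \<in> poly_ring n \<Longrightarrow> pcomp e p \<in> hom_part n e"
  by (auto simp: hom_part_def poly_ring_def in_keys_iff lookup_pcomp split: if_splits)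

lemma pcomp_id: "p \<in> hom_part n e \<Longrightarrow> pcomp e p = p"
  by (rule poly_mapping_eqI) (auto simp: lookup_pcomp hom_part_def in_keys_iff)

lemma poly_ring_add: "p \<in> poly_ring n \<Longrightarrow> q \<in> poly_ring n \<Longrightarrow> p + q \<in> poly_ring n"
  unfolding poly_ring_def using keys_add[of p q] by blast

lemma poly_ring_0 [simp]: "0 \<in> poly_ring n" by (simp add: poly_ring_def)

lemma poly_ring_sum: "(\<And>a. a \<in> A \<Longrightarrow> f a \<in> poly_ring n) \<Longrightarrow> sum f A \<in> poly_ring n"
  by (induction A rule: infinite_finite_induct) (auto intro: poly_ring_add)

lemma poly_ring_mult: "p \<in> poly_ring n \<Longrightarrow> q \<in> poly_ring n \<Longrightarrow> p * q \<in> poly_ring n"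
proof -
  assume p: "p \<in> poly_ring n" and q: "q \<in> poly_ring n"
  have "keys m \<subseteq> {1..n}" if m: "m \<in> keys (p * q)" for m
  proof -
    obtain a b where "m = a + b" "a \<in> keys p" "b \<in> keys q" using m keys_mult[of p q] by blast
    then show ?thesis using p q unfolding poly_ring_def by (simp add: keys_add_nat)
  qed
  then show "p * q \<in> poly_ring n" by (simp add: poly_ring_def)
qed

lemma hom_part_0 [simp]: "0 \<in> hom_part n e" by (simp add: hom_part_def)

lemma hom_part_add: "p \<in> hom_part n e \<Longrightarrow> q \<in> hom_part n e \<Longrightarrow> p + q \<in> hom_part n e"
  unfolding hom_part_eq using keys_add[of p q] by blast

lemma hom_part_sum: "(\<And>a. a \<in> A \<Longrightarrow> f a \<in> hom_part n e) \<Longrightarrow> sum f A \<in> hom_part n e"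
  by (induction A rule: infinite_finite_induct) (auto intro: hom_part_add)

lemma hom_part_mult: "p \<in> hom_part n a \<Longrightarrow> q \<in> hom_part n b \<Longrightarrow> p * q \<in> hom_part n (a + b)"
  using keys_mult[of p q] poly_ring_mult[of p n q] by (fastforce simp: hom_part_def)

lemma hom_part_poly_ring: "p \<in> hom_part n e \<Longrightarrow> p \<in> poly_ring n" by (simp add: hom_part_def)

lemma gfree_iff:
  "v \<in> gfree n sh e \<longleftrightarrow> (\<forall>i<length sh. v i \<in> hom_part n (e - sh ! i)) \<and> (\<forall>i\<ge>length sh. v i = 0)"
proof
  assume v: "v \<in> gfree n sh e"
  have "v i \<in> hom_part n (e - sh ! i)" if "i < length sh" for i
    using v unfolding gfree_def supp_space_iff free_monoms_def hom_part_eq by (auto simp: in_keys_iff)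
  moreover have "v i = 0" if "i \<ge> length sh" for i
    using v that unfolding gfree_def supp_space_iff free_monoms_def by (intro poly_mapping_eqI) force
  ultimately show "(\<forall>i<length sh. v i \<in> hom_part n (e - sh ! i)) \<and> (\<forall>i\<ge>length sh. v i = 0)" by blast
next
  assume v: "(\<forall>i<length sh. v i \<in> hom_part n (e - sh ! i)) \<and> (\<forall>i\<ge>length sh. v i = 0)"
  show "v \<in> gfree n sh e" unfolding gfree_def supp_space_iff free_monoms_def
  proof (intro allI impI)
    fix i m assume nz: "lookup (v i) m \<noteq> 0"
    then have i: "i < length sh" using v by (metis lookup_zero not_le)
    then have "m \<in> monoms n (e - sh ! i)" using v nz unfolding hom_part_eq in_keys_iff[symmetric] by blast
    then show "(i, m) \<in> {(i, m). i < length sh \<and> m \<in> monoms n (e - sh ! i)}" using i by simp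
  qed
qed

text \<open>The component of degree \<open>e\<close> of an element of the free module with basis degrees \<open>sh\<close>.\<close>

definition hcomp :: "int list \<Rightarrow> int \<Rightarrow> (nat \<Rightarrow> 'k::field mpoly) \<Rightarrow> nat \<Rightarrow> 'k mpoly" where
  "hcomp sh e v = (\<lambda>i. if i < length sh then pcomp (e - sh ! i) (v i) else 0)"

lemma hcomp_gfree: "(\<And>i. i < length sh \<Longrightarrow> v i \<in> poly_ring n) \<Longrightarrow> hcomp sh e v \<in> gfree n sh e"
  by (auto simp: gfree_iff hcomp_def pcomp_hom_part)

lemma hcomp_id: "v \<in> gfree n sh e \<Longrightarrow> hcomp sh e v = v"
  by (auto simp: gfree_iff hcomp_def fun_eq_iff pcomp_id)

text \<open>Matrices of degree zero maps between free modules with basis degrees \<open>sh\<close> and \<open>ts\<close>.\<close>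

definition hom_mat :: "nat \<Rightarrow> int list \<Rightarrow> int list \<Rightarrow> 'k::field mpoly mat \<Rightarrow> bool" where
  "hom_mat n ts sh A \<longleftrightarrow> A \<in> carrier_mat (length ts) (length sh) \<and>
     (\<forall>r < length ts. \<forall>c < length sh. A $$ (r, c) \<in> hom_part n (sh ! c - ts ! r))"

lemma mat_map_hcomp:
  assumes "hom_mat n ts sh A"
  shows "mat_map A (hcomp sh e v) = hcomp ts e (mat_map A v)"
proof (rule ext)
  fix r
  have dims: "dim_row A = length ts" "dim_col A = length sh" using assms by (auto simp: hom_mat_def)
  show "mat_map A (hcomp sh e v) r = hcomp ts e (mat_map A v) r"
  proof (cases "r < length ts")
    case True
    have "A $$ (r, c) * pcomp (e - sh ! c) (v c) = pcomp (e - ts ! r) (A $$ (r, c) * v c)" if "c < length sh" for c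
      using pcomp_mult[of "A $$ (r, c)" n "sh ! c - ts ! r" "e - ts ! r" "v c"] assms that True
      by (simp add: hom_mat_def)
    then show ?thesis using True dims by (simp add: mat_map_def hcomp_def pcomp_sum)
  qed (use dims in \<open>simp add: mat_map_def hcomp_def\<close>)
qed

lemma mat_map_gfree:
  assumes A: "hom_mat n ts sh A" and v: "v \<in> gfree n sh e"
  shows "mat_map A v \<in> gfree n ts e"
proof -
  have dims: "dim_row A = length ts" "dim_col A = length sh" using A by (auto simp: hom_mat_def)
  have "A $$ (r, c) * v c \<in> hom_part n (e - ts ! r)" if "r < length ts" "c < length sh" for r c
    using hom_part_mult[of "A $$ (r, c)" n "sh ! c - ts ! r" "v c" "e - sh ! c"] A v that
    by (simp add: hom_mat_def gfree_iff)
  then show ?thesis unfolding gfree_iff by (auto simp: mat_map_def dims intro!: hom_part_sum)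
qed

section \<open>Graded free resolutions as maps of tuples\<close>

definition poly_fun :: "'k::field mpoly vec \<Rightarrow> nat \<Rightarrow> 'k mpoly" where
  "poly_fun x = (\<lambda>i. if i < dim_vec x then x $ i else 0)"

lemma mat_map_poly_fun:
  assumes "A \<in> carrier_mat nr nc" "x \<in> carrier_vec nc"
  shows "poly_fun (A *\<^sub>v x) = mat_map A (poly_fun x)"
  using assms by (auto simp: fun_eq_iff mat_map_def poly_fun_def scalar_prod_def lessThan_atLeast0 intro!: sum.cong)

lemma inj_on_poly_fun: "inj_on poly_fun (carrier_vec n)"
proof (rule inj_onI)
  fix x y :: "'k::field mpoly vec" assume c: "x \<in> carrier_vec n" "y \<in> carrier_vec n" and e: "poly_fun x = poly_fun y"
  show "x = y"
  proof (rule eq_vecI)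
    fix i assume "i < dim_vec y"
    then show "x $ i = y $ i" using fun_cong[OF e, of i] c by (simp add: poly_fun_def)
  qed (use c in auto)
qed

lemma poly_fun_vec: "(\<And>i. i \<ge> b \<Longrightarrow> v i = 0) \<Longrightarrow> poly_fun (vec b v) = v"
  by (auto simp: poly_fun_def fun_eq_iff)

lemma poly_fun_eq_0_iff: "x \<in> carrier_vec b \<Longrightarrow> poly_fun x = 0 \<longleftrightarrow> x = 0\<^sub>v b"
  by (auto simp: poly_fun_def fun_eq_iff)

definition fun_free :: "nat \<Rightarrow> nat \<Rightarrow> (nat \<Rightarrow> 'k::field mpoly) set" where
  "fun_free n b = {v. (\<forall>i<b. v i \<in> poly_ring n) \<and> (\<forall>i\<ge>b. v i = 0)}"

lemma poly_fun_free_mod: "poly_fun ` free_mod n b = (fun_free n b :: (nat \<Rightarrow> 'k::field mpoly) set)"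
proof
  show "poly_fun ` free_mod n b \<subseteq> (fun_free n b :: (nat \<Rightarrow> 'k mpoly) set)"
    by (auto simp: free_mod_def fun_free_def poly_fun_def)
  show "(fun_free n b :: (nat \<Rightarrow> 'k mpoly) set) \<subseteq> poly_fun ` free_mod n b"
  proof
    fix v :: "nat \<Rightarrow> 'k mpoly" assume v: "v \<in> fun_free n b"
    have "poly_fun (vec b v) = v" by (rule poly_fun_vec) (use v in \<open>simp add: fun_free_def\<close>)
    moreover have "vec b v \<in> free_mod n b" using v by (simp add: free_mod_def fun_free_def)
    ultimately show "v \<in> poly_fun ` free_mod n b" by (metis image_eqI)
  qed
qed

lemma free_mod_carrier: "free_mod n b \<subseteq> carrier_vec b" by (auto simp: free_mod_def)

lemma gfree_fun_free: "gfree n sh e \<subseteq> fun_free n (length sh)"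
  unfolding gfree_iff[abs_def] fun_free_def subset_iff mem_Collect_eq using hom_part_poly_ring
  by (metis gfree_iff)

text \<open>Vectors of varying lengths are replaced by functions that vanish beyond the length, so that all free modules of a resolution live in one
type and matrices act as endomorphisms of it.\<close>

lemma graded_free_resolution_iff:
  "graded_free_resolution n I sh D \<longleftrightarrow>
    (\<forall>i. hom_mat n (target_shifts sh i) (sh i) (D i)) \<and>
    {mat_map (D 0) w 0 | w. w \<in> fun_free n (length (sh 0))} = I \<and>
    (\<forall>i. {v \<in> fun_free n (length (sh i)). mat_map (D i) v = 0} =
         mat_map (D (Suc i)) ` fun_free n (length (sh (Suc i))))"
proof (cases "\<forall>i. hom_mat n (target_shifts sh i) (sh i) (D i)")
  case True
  have car: "D i \<in> carrier_mat (length (target_shifts sh i)) (length (sh i))" for i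
    using True by (simp add: hom_mat_def)
  have car0: "D 0 \<in> carrier_mat 1 (length (sh 0))" using car[of 0] by (simp add: target_shifts_def)
  have carS: "D (Suc i) \<in> carrier_mat (length (sh i)) (length (sh (Suc i)))" for i
    using car[of "Suc i"] by (simp add: target_shifts_def)
  have 1: "{vec_index (D 0 *\<^sub>v w) 0 | w. w \<in> free_mod n (length (sh 0))} =
      {mat_map (D 0) w 0 | w. w \<in> fun_free n (length (sh 0))}"
  proof -
    have "vec_index (D 0 *\<^sub>v w) 0 = mat_map (D 0) (poly_fun w) 0" if "w \<in> free_mod n (length (sh 0))" for w
    proof -
      have w: "w \<in> carrier_vec (length (sh 0))" using that free_mod_carrier by blast
      have "poly_fun (D 0 *\<^sub>v w) 0 = vec_index (D 0 *\<^sub>v w) 0" using car0 by (simp add: poly_fun_def)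
      then show ?thesis unfolding mat_map_poly_fun[OF car0 w] by (rule sym)
    qed
    then have "(\<lambda>w. vec_index (D 0 *\<^sub>v w) 0) ` free_mod n (length (sh 0)) =
        (\<lambda>w. mat_map (D 0) (poly_fun w) 0) ` free_mod n (length (sh 0))" by (intro image_cong) auto
    also have "\<dots> = (\<lambda>w. mat_map (D 0) w 0) ` fun_free n (length (sh 0))"
      unfolding poly_fun_free_mod[symmetric] image_image by (rule refl)
    finally show ?thesis by (simp add: Setcompr_eq_image)
  qed
  have 2: "({v \<in> free_mod n (length (sh i)). D i *\<^sub>v v = 0\<^sub>v (length (target_shifts sh i))} =
      {D (Suc i) *\<^sub>v w | w. w \<in> free_mod n (length (sh (Suc i)))}) \<longleftrightarrow>
    ({v \<in> fun_free n (length (sh i)). mat_map (D i) v = 0} =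
         mat_map (D (Suc i)) ` fun_free n (length (sh (Suc i))))" (is "?A = ?B \<longleftrightarrow> ?A' = ?B'") for i
  proof -
    have k: "D i *\<^sub>v v = 0\<^sub>v (length (target_shifts sh i)) \<longleftrightarrow> mat_map (D i) (poly_fun v) = 0"
      if "v \<in> free_mod n (length (sh i))" for v
    proof -
      have v: "v \<in> carrier_vec (length (sh i))" using that free_mod_carrier by blast
      have Dv: "D i *\<^sub>v v \<in> carrier_vec (length (target_shifts sh i))"
        using car v by (rule mult_mat_vec_carrier)
      show ?thesis unfolding mat_map_poly_fun[OF car v, symmetric] poly_fun_eq_0_iff[OF Dv] by (rule refl)
    qed
    have A: "poly_fun ` ?A = ?A'" unfolding poly_fun_free_mod[symmetric] by (auto simp: k)
    have "poly_fun ` ?B = (\<lambda>w. poly_fun (D (Suc i) *\<^sub>v w)) ` free_mod n (length (sh (Suc i)))"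
      unfolding Setcompr_eq_image image_image by (rule refl)
    also have "\<dots> = (\<lambda>w. mat_map (D (Suc i)) (poly_fun w)) ` free_mod n (length (sh (Suc i)))"
      by (rule image_cong[OF refl mat_map_poly_fun[OF carS subsetD[OF free_mod_carrier]]])
    also have "\<dots> = ?B'" unfolding poly_fun_free_mod[symmetric] image_image by (rule refl)
    finally have B: "poly_fun ` ?B = ?B'" .
    have "?A \<subseteq> carrier_vec (length (sh i))" using free_mod_carrier by blast
    moreover have "?B \<subseteq> carrier_vec (length (sh i))"
    proof clarify
      fix w :: "'a mpoly vec" assume "w \<in> free_mod n (length (sh (Suc i)))"
      then have "w \<in> carrier_vec (length (sh (Suc i)))" using free_mod_carrier by blast
      then show "D (Suc i) *\<^sub>v w \<in> carrier_vec (length (sh i))" by (rule mult_mat_vec_carrier[OF carS])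
    qed
    ultimately have "poly_fun ` ?A = poly_fun ` ?B \<longleftrightarrow> ?A = ?B"
      by (rule inj_on_image_eq_iff[OF inj_on_poly_fun])
    then show ?thesis unfolding A B by (rule sym)
  qed
  have 3: "\<forall>i. D i \<in> carrier_mat (length (target_shifts sh i)) (length (sh i)) \<and>
          (\<forall>r < length (target_shifts sh i). \<forall>c < length (sh i).
             index_mat (D i) (r, c) \<in> hom_part n (sh i ! c - target_shifts sh i ! r))"
    using True unfolding hom_mat_def .
  show ?thesis unfolding graded_free_resolution_def 1 2
    by (insert 3 True, intro iffI; elim conjE; intro conjI; assumption)
next
  case False
  then show ?thesis unfolding graded_free_resolution_def hom_mat_def by blast
qed

text \<open>The graded component of an ideal, as a space of tuples of length one.\<close>

definition ideal_part :: "nat \<Rightarrow> 'k::field mpoly set \<Rightarrow> int \<Rightarrow> (nat \<Rightarrow> 'k mpoly) set" where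
  "ideal_part n I e = {v \<in> gfree n [0] e. v 0 \<in> I}"

text \<open>The module that \<open>F\<^sub>i\<close> covers: the ideal itself for \<open>i = 0\<close>, and then the kernel of the previous
map.\<close>

definition syzygies :: "nat \<Rightarrow> 'k::field mpoly set \<Rightarrow> (nat \<Rightarrow> int list) \<Rightarrow> (nat \<Rightarrow> 'k mpoly mat) \<Rightarrow> nat \<Rightarrow> int \<Rightarrow> (nat \<Rightarrow> 'k mpoly) set" where
  "syzygies n I sh D i e = (case i of 0 \<Rightarrow> ideal_part n I e
     | Suc k \<Rightarrow> {v \<in> gfree n (sh k) e. mat_map (D k) v = 0})"

text \<open>Exactness of a resolution is a statement about all elements; taking homogeneous components of preimages makes it exact in every
degree.\<close>

lemma resolution_exact:
  assumes res: "graded_free_resolution n I sh D"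
  shows "syzygies n I sh D i e = mat_map (D i) ` gfree n (sh i) e"
proof -
  have hm: "hom_mat n (target_shifts sh i) (sh i) (D i)" for i
    using res unfolding graded_free_resolution_iff by blast
  have im0: "{mat_map (D 0) w 0 | w. w \<in> fun_free n (length (sh 0))} = I"
    using res unfolding graded_free_resolution_iff by blast
  have ex: "{v \<in> fun_free n (length (sh i)). mat_map (D i) v = 0} =
         mat_map (D (Suc i)) ` fun_free n (length (sh (Suc i)))" for i
    using res unfolding graded_free_resolution_iff by blast+
  have comp: "hcomp (sh i) e w \<in> gfree n (sh i) e" if "w \<in> fun_free n (length (sh i))" for w i
    using that by (intro hcomp_gfree) (simp add: fun_free_def)
  show ?thesis
  proof (cases i)
    case 0
    have hm0: "hom_mat n [0] (sh 0) (D 0)" using hm[of 0] by (simp add: target_shifts_def)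
    have "ideal_part n I e = mat_map (D 0) ` gfree n (sh 0) e"
    proof
      show "ideal_part n I e \<subseteq> mat_map (D 0) ` gfree n (sh 0) e"
      proof
        fix v assume v: "v \<in> ideal_part n I e"
        then obtain w where w: "w \<in> fun_free n (length (sh 0))" "v 0 = mat_map (D 0) w 0"
          using im0 by (auto simp: ideal_part_def)
        have "mat_map (D 0) w i = v i" for i
          using w(2) v hm0 by (cases "i = 0") (auto simp: ideal_part_def gfree_iff mat_map_def hom_mat_def)
        then have "mat_map (D 0) w = v" by blast
        then have "v = mat_map (D 0) (hcomp (sh 0) e w)"
          using v hcomp_id unfolding mat_map_hcomp[OF hm0] by (metis (no_types, lifting) ideal_part_def mem_Collect_eq)
        then show "v \<in> mat_map (D 0) ` gfree n (sh 0) e" using comp[OF w(1)] by blast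
      qed
      show "mat_map (D 0) ` gfree n (sh 0) e \<subseteq> ideal_part n I e"
        using mat_map_gfree[OF hm0] im0 gfree_fun_free unfolding ideal_part_def by blast
    qed
    then show ?thesis using 0 by (simp add: syzygies_def)
  next
    case (Suc k)
    have hmS: "hom_mat n (sh k) (sh (Suc k)) (D (Suc k))" using hm[of "Suc k"] by (simp add: target_shifts_def)
    have "{v \<in> gfree n (sh k) e. mat_map (D k) v = 0} = mat_map (D (Suc k)) ` gfree n (sh (Suc k)) e"
    proof
      show "{v \<in> gfree n (sh k) e. mat_map (D k) v = 0} \<subseteq> mat_map (D (Suc k)) ` gfree n (sh (Suc k)) e"
      proof clarify
        fix v assume v: "v \<in> gfree n (sh k) e" "mat_map (D k) v = 0"
        then have "v \<in> {v \<in> fun_free n (length (sh k)). mat_map (D k) v = 0}" using gfree_fun_free by blast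
        then obtain w where w: "w \<in> fun_free n (length (sh (Suc k)))" "v = mat_map (D (Suc k)) w"
          unfolding ex by blast
        have "v = mat_map (D (Suc k)) (hcomp (sh (Suc k)) e w)"
          unfolding mat_map_hcomp[OF hmS] w(2)[symmetric] hcomp_id[OF v(1)] by (rule refl)
        then show "v \<in> mat_map (D (Suc k)) ` gfree n (sh (Suc k)) e" using comp[OF w(1)] by blast
      qed
      show "mat_map (D (Suc k)) ` gfree n (sh (Suc k)) e \<subseteq> {v \<in> gfree n (sh k) e. mat_map (D k) v = 0}"
        using mat_map_gfree[OF hmS] ex[of k] gfree_fun_free by blast
    qed
    then show ?thesis using Suc by (simp add: syzygies_def)
  qed
qed

lemma free_exact_resolution:
  assumes "graded_free_resolution n I sh D"
  shows "free_exact n (sh i) (syzygies n I sh D i) (syzygies n I sh D (Suc i)) (mat_map (D i))"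
  by unfold_locales
     (simp_all add: graded_module_gfree xlinear_mat_map resolution_exact[OF assms, of i] syzygies_def[of n I sh D "Suc i"])

section \<open>Betti numbers are dimensions of Koszul homology\<close>

lemma lookup_mult_0: "lookup (p * q) 0 = lookup p 0 * lookup q 0" for p q :: "'k::field mpoly"
proof -
  have s: "lookup (Poly_Mapping.single m c * q) 0 = (if m = 0 then c * lookup q 0 else 0)" for m c
  proof (cases "m = 0")
    case True
    then show ?thesis using lookup_single_mult[of 0 c q 0] by simp
  next
    case False
    have "0 \<noteq> m + u" for u
    proof
      assume "0 = m + u"
      then have "total_deg (m + u) = 0" by simp
      then show False using False by simp
    qed
    then show ?thesis using False by (simp add: lookup_single_mult_eq_0)
  qed
  have "lookup (p * q) 0 = lookup ((\<Sum>m\<in>keys p. Poly_Mapping.single m (lookup p m)) * q) 0"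
    unfolding mpoly_as_sum by (rule refl)
  also have "\<dots> = (\<Sum>m\<in>keys p. if m = 0 then lookup p m * lookup q 0 else 0)"
    unfolding sum_distrib_right lookup_sum s by (rule refl)
  also have "\<dots> = lookup p 0 * lookup q 0"
    by (simp add: sum.delta in_keys_iff)
  finally show ?thesis .
qed

lemma hom_part_lookup_0: "p \<in> hom_part n e \<Longrightarrow> e \<noteq> 0 \<Longrightarrow> lookup p 0 = 0"
  by (auto simp: hom_part_def in_keys_iff)

lemma card_below_less: "finite R \<Longrightarrow> r \<in> R \<Longrightarrow> card {a \<in> R. a < r} < card R" for R :: "nat set"
  by (rule psubset_card_mono) auto

text \<open>An entry of a homogeneous matrix can have a nonzero constant coefficient only between basis elements of equal degree. Thus the image in
degree \<open>j\<close>, reduced modulo the maximal ideal, is the image of the submatrix of constant coefficients at the basis elements of degree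
\<open>j\<close>.\<close>

lemma rank_constant_part:
  fixes D :: "'k::field mpoly mat"
  assumes D: "hom_mat n ts sh D"
  shows "fs.dim (eps ` mat_map D ` gfree n sh j) =
    mat_rank (submatrix (map_mat (\<lambda>p. lookup p 0) D)
      {r. r < length ts \<and> ts ! r = j} {c. c < length sh \<and> sh ! c = j})" (is "_ = mat_rank ?A")
proof -
  define R where "R = {r. r < length ts \<and> ts ! r = j}"
  define S where "S = {c. c < length sh \<and> sh ! c = j}"
  define B where "B = map_mat (\<lambda>p. lookup p 0) D"
  define A where "A = submatrix B R S"
  define rk where "rk r = card {a \<in> R. a < r}" for r
  define sk where "sk c = card {a \<in> S. a < c}" for c
  have fin: "finite R" "finite S" by (auto simp: R_def S_def)
  have dims: "dim_row D = length ts" "dim_col D = length sh" using D by (auto simp: hom_mat_def)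
  have dA: "A \<in> carrier_mat (card R) (card S)"
  proof -
    have "{i. i < dim_row B \<and> i \<in> R} = R" "{c. c < dim_col B \<and> c \<in> S} = S"
      by (auto simp: B_def dims R_def S_def)
    then show ?thesis unfolding carrier_mat_def A_def by (simp add: dim_submatrix)
  qed
  have A_index: "A $$ (rk r, sk c) = lookup (D $$ (r, c)) 0" if "r \<in> R" "c \<in> S" for r c
  proof -
    have "r < dim_row B" "c < dim_col B" using that by (auto simp: R_def S_def B_def dims)
    then show ?thesis using submatrix_index_card[of r B c R S] that dims
      by (simp add: A_def rk_def sk_def B_def)
  qed
  have rk_less: "rk r < card R" if "r \<in> R" for r unfolding rk_def by (rule card_below_less[OF fin(1) that])
  have sk_less: "sk c < card S" if "c \<in> S" for c unfolding sk_def by (rule card_below_less[OF fin(2) that])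
  have pick_rk: "pick R k \<in> R" "rk (pick R k) = k" if "k < card R" for k
    using that pick_in_set[of k R] card_pick[of k R] by (auto simp: rk_def)
  have pick_sk: "pick S k \<in> S" "sk (pick S k) = k" if "k < card S" for k
    using that pick_in_set[of k S] card_pick[of k S] by (auto simp: sk_def)
  have sk_pick: "pick S (sk c) = c" if "c \<in> S" for c
    using pick_card_in_set[OF that] by (simp add: sk_def)
  \<comment> \<open>\<open>psi\<close> undoes the renumbering of rows by \<open>submatrix\<close>, and \<open>coeffs\<close> extracts the coordinates that it keeps.\<close>
  define psi :: "(nat \<Rightarrow> 'k mpoly) \<Rightarrow> nat \<Rightarrow> 'k mpoly" where
    "psi u = (\<lambda>r. if r \<in> R then u (rk r) else 0)" for u
  define X where "X = vec_fun ` ((\<lambda>x. A *\<^sub>v x) ` carrier_vec (card S))"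
  have lin: "flinear psi" by (auto simp: flinear_def psi_def fun_eq_iff fsc_apply)
  define coeffs where "coeffs w = vec (card S) (\<lambda>k. lookup (w (pick S k)) 0)" for w :: "nat \<Rightarrow> 'k mpoly"
  have key: "eps (mat_map D w) = psi (vec_fun (A *\<^sub>v coeffs w))" if w: "w \<in> gfree n sh j" for w
  proof (rule ext)
    fix r
    show "eps (mat_map D w) r = psi (vec_fun (A *\<^sub>v coeffs w)) r"
    proof (cases "r \<in> R")
      case True
      then have r: "r < length ts" by (simp add: R_def)
      have w0: "lookup (w c) 0 = 0" if "c < length sh" "c \<notin> S" for c
        using w that hom_part_lookup_0[of "w c" n "j - sh ! c"] by (auto simp: gfree_iff S_def)
      have "eps (mat_map D w) r = const (\<Sum>c<length sh. lookup (D $$ (r, c)) 0 * lookup (w c) 0)"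
        using r by (simp add: eps_def mat_map_def dims lookup_sum lookup_mult_0)
      also have "(\<Sum>c<length sh. lookup (D $$ (r, c)) 0 * lookup (w c) 0) =
          (\<Sum>c\<in>S. lookup (D $$ (r, c)) 0 * lookup (w c) 0)"
        by (rule sum.mono_neutral_right) (use w0 in \<open>auto simp: S_def\<close>)
      also have "\<dots> = (\<Sum>k<card S. A $$ (rk r, k) * coeffs w $ k)"
        by (rule sum.reindex_bij_witness[of _ "pick S" sk])
           (use sk_pick pick_sk sk_less A_index[OF True] in \<open>auto simp: coeffs_def\<close>)
      also have "\<dots> = (A *\<^sub>v coeffs w) $ rk r"
        using dA rk_less[OF True] by (simp add: scalar_prod_def coeffs_def lessThan_atLeast0)
      also have "const ((A *\<^sub>v coeffs w) $ rk r) = psi (vec_fun (A *\<^sub>v coeffs w)) r"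
        using dA rk_less[OF True] True by (simp add: psi_def vec_fun_def)
      finally show ?thesis .
    next
      case False
      have "lookup (mat_map D w r) 0 = 0"
      proof (cases "r < length ts")
        case r: True
        have "mat_map D w r \<in> hom_part n (j - ts ! r)"
          using mat_map_gfree[OF D w] r unfolding gfree_iff by blast
        then show ?thesis using False r by (intro hom_part_lookup_0) (auto simp: R_def)
      qed (simp add: mat_map_def dims)
      then show ?thesis using False by (simp add: eps_def psi_def)
    qed
  qed
  have onto: "\<exists>w\<in>gfree n sh j. coeffs w = x" if x: "x \<in> carrier_vec (card S)" for x
  proof
    let ?w = "\<lambda>c. if c \<in> S then const (x $ sk c) else 0"
    show "?w \<in> gfree n sh j" unfolding gfree_iff
      by (auto simp: S_def const_def hom_part_def poly_ring_def)
    show "coeffs ?w = x" using x pick_sk by (intro eq_vecI) (auto simp: coeffs_def)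
  qed
  have cw: "coeffs w \<in> carrier_vec (card S)" for w by (simp add: coeffs_def)
  have "eps ` mat_map D ` gfree n sh j = (\<lambda>w. psi (vec_fun (A *\<^sub>v coeffs w))) ` gfree n sh j"
    unfolding image_image using key by (rule image_cong[OF refl])
  also have "\<dots> = psi ` X" unfolding X_def image_image
  proof
    show "(\<lambda>w. psi (vec_fun (A *\<^sub>v coeffs w))) ` gfree n sh j \<subseteq> (\<lambda>x. psi (vec_fun (A *\<^sub>v x))) ` carrier_vec (card S)"
      using cw by blast
    show "(\<lambda>x. psi (vec_fun (A *\<^sub>v x))) ` carrier_vec (card S) \<subseteq> (\<lambda>w. psi (vec_fun (A *\<^sub>v coeffs w))) ` gfree n sh j"
    proof clarify
      fix x :: "'k vec" assume "x \<in> carrier_vec (card S)"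
      then obtain w where "w \<in> gfree n sh j" "coeffs w = x" using onto by blast
      then show "psi (vec_fun (A *\<^sub>v x)) \<in> (\<lambda>w. psi (vec_fun (A *\<^sub>v coeffs w))) ` gfree n sh j" by blast
    qed
  qed
  finally have im: "eps ` mat_map D ` gfree n sh j = psi ` X" .
  let ?U = "{(i, m :: nat \<Rightarrow>\<^sub>0 nat). i < card S \<and> m = 0}"
  have Uf: "finite ?U"
  proof -
    have "?U = {..<card S} \<times> {0}" by auto
    then show ?thesis by simp
  qed
  have X: "X = mat_map (map_mat const A) ` supp_space ?U"
    unfolding X_def vec_fun_carrier[symmetric] image_image
    by (rule image_cong[OF refl mat_map_vec_fun[OF dA, symmetric]])
  have "fs.subspace X" "fs.fin_dim X" unfolding X
    by (intro fs_subspace_image fs_fin_dim_image flinear_mat_map subspace_supp_space fin_dim_supp_space Uf)+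
  moreover have "u = 0" if u: "u \<in> X" "psi u = 0" for u
  proof (rule ext)
    fix k
    show "u k = 0 k"
    proof (cases "k < card R")
      case True
      have "u k = psi u (pick R k)" using pick_rk[OF True] by (simp add: psi_def)
      then show ?thesis using u(2) by simp
    next
      case False
      then show ?thesis using u(1) dA unfolding X_def by (auto simp: vec_fun_def)
    qed
  qed
  ultimately have "fs.dim (psi ` X) = fs.dim X" by (intro fs_dim_image_inj[OF lin]) auto
  then show ?thesis unfolding im unfolding X_def mat_rank_eq[OF dA, symmetric]
    unfolding A_def B_def R_def S_def .
qed

lemma count_list_eq_card: "count_list xs j = card {c. c < length xs \<and> xs ! c = j}"
  by (simp add: count_list_eq_length_filter length_filter_conv_card eq_commute)

lemma count_list_replicate: "count_list (replicate k a) j = (if a = j then k else 0)"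
  by (induction k) auto

context
  fixes n :: nat and I :: "'k::field mpoly set" and sh D
  assumes res: "graded_free_resolution n I sh D"
begin

text \<open>Iterated dimension shift along the resolution.\<close>

lemma kos_syzygies: "kos n (syzygies n I sh D i) (Suc p) j = kos n (ideal_part n I) (Suc p + i) j"
proof (induction i arbitrary: p)
  case 0
  have "syzygies n I sh D 0 = ideal_part n I" by (rule ext) (simp add: syzygies_def)
  then show ?case by simp
next
  case (Suc i)
  interpret free_exact n "sh i" "syzygies n I sh D i" "syzygies n I sh D (Suc i)" "mat_map (D i)"
    by (rule free_exact_resolution[OF res])
  show ?case using Suc[of "Suc p"] kos_Suc_Suc[of p j] by simp
qed

lemma hom_mat_resolution: "hom_mat n (target_shifts sh i) (sh i) (D i)"
  using res unfolding graded_free_resolution_iff by blast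

lemma mat_rank_tensor_diff:
  "mat_rank (tensor_diff sh D (Suc i) j) = fs.dim (eps ` syzygies n I sh D (Suc i) j)"
proof -
  have "hom_mat n (sh i) (sh (Suc i)) (D (Suc i))"
    using hom_mat_resolution[of "Suc i"] by (simp add: target_shifts_def)
  from rank_constant_part[OF this, of j] show ?thesis
    by (simp add: tensor_diff_def resolution_exact[OF res])
qed

lemma tensor_diff_carrier:
  "tensor_diff sh D (Suc i) j \<in> carrier_mat (count_list (sh i) j) (count_list (sh (Suc i)) j)"
proof -
  have "hom_mat n (sh i) (sh (Suc i)) (D (Suc i))"
    using hom_mat_resolution[of "Suc i"] by (simp add: target_shifts_def)
  then have d: "dim_row (D (Suc i)) = length (sh i)" "dim_col (D (Suc i)) = length (sh (Suc i))"
    by (auto simp: hom_mat_def)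
  have "{r. r < length (sh i) \<and> r \<in> {r. r < length (sh i) \<and> sh i ! r = j}} = {r. r < length (sh i) \<and> sh i ! r = j}"
    "{r. r < length (sh (Suc i)) \<and> r \<in> {r. r < length (sh (Suc i)) \<and> sh (Suc i) ! r = j}} = {r. r < length (sh (Suc i)) \<and> sh (Suc i) ! r = j}"
    by auto
  then show ?thesis
    unfolding carrier_mat_def tensor_diff_def by (simp add: dim_submatrix d count_list_eq_card)
qed

lemma count_shifts_0:
  "count_list (sh 0) j = kos n (ideal_part n I) 0 j + fs.dim (eps ` syzygies n I sh D (Suc 0) j)"
proof -
  interpret free_exact n "sh 0" "syzygies n I sh D 0" "syzygies n I sh D (Suc 0)" "mat_map (D 0)"
    by (rule free_exact_resolution[OF res])
  have "syzygies n I sh D 0 = ideal_part n I" by (rule ext) (simp add: syzygies_def)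
  then show ?thesis using kos_0_add[of j] by simp
qed

lemma count_shifts_Suc:
  "count_list (sh (Suc i)) j = kos n (ideal_part n I) (Suc i) j
    + fs.dim (eps ` syzygies n I sh D (Suc i) j) + fs.dim (eps ` syzygies n I sh D (Suc (Suc i)) j)"
proof -
  interpret E: free_exact n "sh i" "syzygies n I sh D i" "syzygies n I sh D (Suc i)" "mat_map (D i)"
    by (rule free_exact_resolution[OF res])
  interpret E': free_exact n "sh (Suc i)" "syzygies n I sh D (Suc i)" "syzygies n I sh D (Suc (Suc i))" "mat_map (D (Suc i))"
    by (rule free_exact_resolution[OF res])
  show ?thesis using E'.kos_0_add[of j] E.kos_0_kernel[of j] kos_syzygies[of i 0 j] by simp
qed

text \<open>By \<open>rank_constant_part\<close> the ranks of the differentials of \<open>K \<otimes> F\<close> are the dimensions of the reduced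
syzygies, the same quantities that appear when the shifts are counted by \<open>kos_0_add\<close> and \<open>kos_0_kernel\<close>.\<close>

lemma tor_dim_eq_kos: "tor_dim sh D i j = kos n (ideal_part n I) i j"
proof (cases i)
  case 0
  have A: "tensor_diff sh D 0 j \<in> carrier_mat 0 (count_list (sh 0) j)" by (simp add: tensor_diff_def)
  have "vec_fun ` ((\<lambda>x. tensor_diff sh D 0 j *\<^sub>v x) ` carrier_vec (count_list (sh 0) j)) \<subseteq> fs.span {}"
  proof clarify
    fix x
    have "vec_fun (tensor_diff sh D 0 j *\<^sub>v x) = 0" using A by (simp add: vec_fun_def fun_eq_iff)
    then show "vec_fun (tensor_diff sh D 0 j *\<^sub>v x) \<in> fs.span {}" using fs.span_zero by metis
  qed
  from fs.dim_le_card[OF this] have "mat_rank (tensor_diff sh D 0 j) = 0"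
    unfolding mat_rank_eq[OF A] by simp
  then have "kernel_dim (tensor_diff sh D 0 j) = count_list (sh 0) j" using rank_kernel_dim[OF A] by simp
  then show ?thesis
    using 0 count_shifts_0[of j] by (simp add: tor_dim_def mat_rank_tensor_diff)
next
  case (Suc k)
  have "kernel_dim (tensor_diff sh D (Suc k) j) = count_list (sh (Suc k)) j - fs.dim (eps ` syzygies n I sh D (Suc k) j)"
    using rank_kernel_dim[OF tensor_diff_carrier[of k j]] mat_rank_tensor_diff[of k j] by simp
  then show ?thesis
    using Suc count_shifts_Suc[of k j] by (simp add: tor_dim_def mat_rank_tensor_diff)
qed

lemma eps_syzygies_minimal:
  assumes "\<forall>i r c. r < length (sh i) \<and> c < length (sh (Suc i)) \<longrightarrow> lookup (D (Suc i) $$ (r, c)) 0 = 0"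
  shows "eps ` syzygies n I sh D (Suc i) j \<subseteq> {0}"
proof clarify
  fix v assume "v \<in> syzygies n I sh D (Suc i) j"
  then obtain w where v: "v = mat_map (D (Suc i)) w" using resolution_exact[OF res] by blast
  have "hom_mat n (sh i) (sh (Suc i)) (D (Suc i))"
    using hom_mat_resolution[of "Suc i"] by (simp add: target_shifts_def)
  then have d: "dim_row (D (Suc i)) = length (sh i)" "dim_col (D (Suc i)) = length (sh (Suc i))"
    by (auto simp: hom_mat_def)
  show "eps v = 0" unfolding eps_eq_0_iff v
    using assms d by (auto simp: mat_map_def lookup_sum lookup_mult_0)
qed

text \<open>In a minimal resolution the syzygies reduce to zero modulo the maximal ideal, so the counting formulas lose their error terms.\<close>

lemma count_shifts_minimal:
  assumes min: "minimal_graded_free_resolution n I sh D"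
  shows "count_list (sh i) j = kos n (ideal_part n I) i j"
proof -
  have "eps ` syzygies n I sh D (Suc i) j \<subseteq> {0}" for i
    using min by (intro eps_syzygies_minimal) (simp add: minimal_graded_free_resolution_def)
  then have "fs.dim (eps ` syzygies n I sh D (Suc i) j) = 0" for i
    using fs.dim_le_card[of "eps ` syzygies n I sh D (Suc i) j" "{}"] by simp
  then show ?thesis using count_shifts_0[of j] count_shifts_Suc by (cases i) simp_all
qed

end

lemma betti_eq_kos:
  assumes "graded_free_resolution n I sh D"
  shows "betti n I i j = kos n (ideal_part n I) i j"
proof -
  define F where "F = (SOME F. graded_free_resolution n I (fst F) (snd F))"
  have "graded_free_resolution n I (fst F) (snd F)"
    unfolding F_def by (rule someI[of _ "(sh, D)"]) (simp add: assms)
  then show ?thesis unfolding betti_def F_def[symmetric]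
    using tor_dim_eq_kos[of n I "fst F" "snd F" i j] by (simp add: case_prod_unfold)
qed

section \<open>Existence of minimal resolutions\<close>

definition pmul :: "'k::field mpoly \<Rightarrow> (nat \<Rightarrow> 'k mpoly) \<Rightarrow> nat \<Rightarrow> 'k mpoly" where
  "pmul p v = (\<lambda>i. p * v i)"

lemma pmul_monomial:
  assumes M: "graded_module n M" and v: "v \<in> M e" and m: "keys m \<subseteq> {1..n}"
  shows "pmul (Poly_Mapping.single m c) v \<in> M (e + int (total_deg m))"
  using m
proof (induction "total_deg m" arbitrary: m)
  case 0
  then have "pmul (Poly_Mapping.single m c) v = fsc c v"
    by (simp add: pmul_def fsc_def const_def)
  moreover have "fsc c v \<in> M e" using graded_moduleD(1)[OF M] v by (rule fs.subspace_scale)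
  ultimately show ?case using 0 by simp
next
  case (Suc d)
  then have "m \<noteq> 0" by auto
  then obtain k where k: "k \<in> keys m" by (metis keys_eq_empty ex_in_conv)
  then have "lookup m k \<noteq> 0" by (simp add: in_keys_iff)
  from minus_var_mon_add[OF this] obtain u where u: "m = var_mon k + u" by metis
  have d: "d = total_deg u" using Suc(2) u by simp
  have "keys u \<subseteq> {1..n}" using Suc(3) unfolding u keys_add_nat by blast
  from Suc(1)[OF d this] have "pmul (Poly_Mapping.single u c) v \<in> M (e + int (total_deg u))" .
  moreover have "k \<in> {1..n}" using k Suc(3) by blast
  ultimately have "xmul k (pmul (Poly_Mapping.single u c) v) \<in> M (e + int (total_deg u) + 1)"
    using graded_moduleD(3)[OF M] by blast
  moreover have "xmul k (pmul (Poly_Mapping.single u c) v) = pmul (Poly_Mapping.single m c) v"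
    unfolding xmul_def pmul_def Var_def u mult.assoc[symmetric] mult_single by simp
  ultimately show ?case using u by (simp add: algebra_simps)
qed

lemma pmul_graded_module:
  assumes M: "graded_module n M" and v: "v \<in> M e" and p: "p \<in> hom_part n a"
  shows "pmul p v \<in> M (e + a)"
proof -
  have "pmul p v = (\<Sum>m\<in>keys p. pmul (Poly_Mapping.single m (lookup p m)) v)"
  proof (rule ext)
    fix i
    have "pmul p v i = (\<Sum>m\<in>keys p. Poly_Mapping.single m (lookup p m)) * v i"
      unfolding mpoly_as_sum pmul_def by (rule refl)
    then show "pmul p v i = (\<Sum>m\<in>keys p. pmul (Poly_Mapping.single m (lookup p m)) v) i"
      by (simp add: sum_fun_apply pmul_def sum_distrib_right)
  qed
  moreover have "pmul (Poly_Mapping.single m (lookup p m)) v \<in> M (e + a)" if "m \<in> keys p" for m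
    using pmul_monomial[OF M v, of m "lookup p m"] p that by (simp add: hom_part_def poly_ring_def)
  ultimately show ?thesis by (simp only:) (rule fs.subspace_sum[OF graded_moduleD(1)[OF M]])
qed

lemma gfree_bounded_below: "\<exists>e0. \<forall>e<e0. gfree n sh e = {0}"
proof (intro exI allI impI)
  fix e assume e: "e < Min (insert 0 (set sh))"
  have "v = 0" if v: "v \<in> gfree n sh e" for v
  proof (rule ext)
    fix i show "v i = 0 i"
    proof (cases "i < length sh")
      case True
      then have "e < sh ! i" using e by (intro less_le_trans[OF e] Min_le) auto
      then have "monoms n (e - sh ! i) = {}" by (auto simp: monoms_def)
      moreover have "v i \<in> hom_part n (e - sh ! i)" using v True by (simp add: gfree_iff)
      ultimately show ?thesis by (simp add: hom_part_eq)
    qed (use v in \<open>simp add: gfree_iff\<close>)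
  qed
  moreover have "0 \<in> gfree n sh e" by (simp add: gfree_iff)
  ultimately show "gfree n sh e = {0}" by blast
qed

definition unit_vec_fun :: "nat \<Rightarrow> nat \<Rightarrow> 'k::field mpoly" where
  "unit_vec_fun c = (\<lambda>i. if i = c then 1 else 0)"

lemma unit_vec_fun_gfree: "c < length sh \<Longrightarrow> unit_vec_fun c \<in> gfree n sh (sh ! c)"
  by (auto simp: gfree_iff unit_vec_fun_def hom_part_def poly_ring_def)

text \<open>The boundaries in homological degree zero are \<open>(x\<^sub>1, \<dots>, x\<^sub>n) M\<close>, so \<open>kos n M 0 j\<close> is the
dimension of a complement of this submodule in degree \<open>j\<close>. Bases of such complements generate \<open>M\<close>, by induction on the
degree, which starts because \<open>M\<close> sits in a free module and is zero in small degrees.\<close>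

lemma minimal_generators:
  fixes M :: "int \<Rightarrow> (nat \<Rightarrow> 'k::field mpoly) set"
  assumes M: "graded_module n M" and sub: "\<And>e. M e \<subseteq> gfree n ts e"
    and count: "\<And>j. count_list sh j = kos n M 0 j"
  shows "\<exists>A. hom_mat n ts sh A \<and> (\<forall>e. mat_map A ` gfree n sh e = M e)"
proof -
  \<comment> \<open>\<open>N j\<close> is the degree \<open>j\<close> part of \<open>(x\<^sub>1, \<dots>, x\<^sub>n) M\<close>.\<close>
  define N where "N j = {v \<in> M j. chain_at {} v \<in> kbd n M 0 j}" for j
  define cols where "cols j = {c. c < length sh \<and> sh ! c = j}" for j
  have NM: "N j \<subseteq> M j" for j by (auto simp: N_def)
  have sN: "fs.subspace (N j)" for j
  proof (rule fs_subspaceI)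
    note sM = graded_moduleD(1)[OF M, of j] and sB = subspace_kbd[OF M, of 0 j]
    show "0 \<in> N j" unfolding N_def mem_Collect_eq flinear_0[OF flinear_chain_at]
      using fs.subspace_0[OF sM] fs.subspace_0[OF sB] by blast
    show "u + v \<in> N j" if "u \<in> N j" "v \<in> N j" for u v
      using that fs.subspace_add[OF sM] fs.subspace_add[OF sB]
      unfolding N_def mem_Collect_eq flinear_add[OF flinear_chain_at] by blast
    show "fsc c v \<in> N j" if "v \<in> N j" for c v
      using that fs.subspace_scale[OF sM] fs.subspace_scale[OF sB]
      unfolding N_def mem_Collect_eq flinear_scale[OF flinear_chain_at] by blast
  qed
  have "chain_at {} ` N j = kbd n M 0 j" for j
  proof -
    have "kbd n M 0 j \<subseteq> chain_at {} ` M j"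
      using kbd_subset_kcyc[OF M, of 0 j] unfolding kcyc_0 kchain_zero .
    then show ?thesis unfolding N_def by blast
  qed
  then have dN: "fs.dim (kbd n M 0 j) = fs.dim (N j)" for j
    using dim_chain_at[OF fs.fin_dim_subset[OF graded_moduleD(2)[OF M, of j] NM] sN[of j], of "{}"] by simp
  have kos: "kos n M 0 j = fs.dim (M j) - fs.dim (N j)" for j
    unfolding kos_def dN kcyc_0 kchain_zero
    by (simp only: dim_chain_at[OF graded_moduleD(2)[OF M, of j] graded_moduleD(1)[OF M, of j]])
  have "\<exists>f. f ` cols j \<subseteq> M j \<and> (\<forall>v\<in>M j. \<exists>u\<in>N j. v - u \<in> fs.span (f ` cols j))" for j
  proof -
    obtain C where C: "C \<subseteq> M j" "finite C" "card C = fs.dim (M j) - fs.dim (N j)"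
      "\<And>v. v \<in> M j \<Longrightarrow> \<exists>u\<in>N j. v - u \<in> fs.span C"
      by (rule fs.fin_dim_complement[OF graded_moduleD(2)[OF M, of j] graded_moduleD(1)[OF M, of j] NM sN]) blast
    have "card (cols j) = card C" unfolding cols_def C(3) count_list_eq_card[symmetric] count kos by (rule refl)
    moreover have "finite (cols j)" by (simp add: cols_def)
    ultimately obtain f where "bij_betw f (cols j) C"
      using finite_same_card_bij[OF _ C(2)] by blast
    then have "f ` cols j = C" by (rule bij_betw_imp_surj_on)
    then show ?thesis using C(1,4) by (intro exI[of _ f]) simp
  qed
  then have "\<exists>f. \<forall>j. f j ` cols j \<subseteq> M j \<and> (\<forall>v\<in>M j. \<exists>u\<in>N j. v - u \<in> fs.span (f j ` cols j))"
    by (intro choice allI)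
  then obtain f where f: "\<And>j. f j ` cols j \<subseteq> M j"
    "\<And>j v. v \<in> M j \<Longrightarrow> \<exists>u\<in>N j. v - u \<in> fs.span (f j ` cols j)" by blast
  define g where "g c = f (sh ! c) c" for c
  have gM: "g c \<in> M (sh ! c)" if "c < length sh" for c
  proof -
    have "c \<in> cols (sh ! c)" using that by (simp add: cols_def)
    then show ?thesis using f(1)[of "sh ! c"] unfolding g_def by blast
  qed
  define A where "A = mat (length ts) (length sh) (\<lambda>(r, c). g c r)"
  have dA: "A \<in> carrier_mat (length ts) (length sh)" by (simp add: A_def)
  have homA: "hom_mat n ts sh A"
    using gM sub unfolding hom_mat_def by (auto simp: A_def gfree_iff subset_iff)
  have mapA: "mat_map A v = (\<Sum>c<length sh. pmul (v c) (g c))" for v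
  proof (rule ext)
    fix r
    show "mat_map A v r = (\<Sum>c<length sh. pmul (v c) (g c)) r"
    proof (cases "r < length ts")
      case True
      then show ?thesis by (simp add: mat_map_def A_def sum_fun_apply pmul_def mult.commute)
    next
      case False
      have "g c r = 0" if "c < length sh" for c
        using gM[OF that] sub[of "sh ! c"] False by (auto simp: gfree_iff)
      then show ?thesis using False by (simp add: mat_map_def A_def sum_fun_apply pmul_def)
    qed
  qed
  have into: "mat_map A v \<in> M e" if "v \<in> gfree n sh e" for v e
    unfolding mapA
  proof (rule fs.subspace_sum[OF graded_moduleD(1)[OF M]])
    fix c assume "c \<in> {..<length sh}"
    then show "pmul (v c) (g c) \<in> M e"
      using pmul_graded_module[OF M gM[of c], of "v c" "e - sh ! c"] that by (simp add: gfree_iff)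
  qed
  have col: "mat_map A (unit_vec_fun c) = g c" if "c < length sh" for c
  proof -
    have "mat_map A (unit_vec_fun c) = (\<Sum>d<length sh. if d = c then g c else 0)"
      unfolding mapA by (rule sum.cong) (auto simp: pmul_def unit_vec_fun_def fun_eq_iff)
    then show ?thesis using that by (simp add: sum.delta)
  qed
  let ?Im = "\<lambda>e. mat_map A ` gfree n sh e"
  have sIm: "fs.subspace (?Im e)" for e
    by (rule fs_subspace_image[OF flinear_mat_map graded_moduleD(1)[OF graded_module_gfree]])
  have im_step: "M e \<subseteq> ?Im e" if IH: "M (e - 1) \<subseteq> ?Im (e - 1)" for e
  proof
    fix v assume "v \<in> M e"
    then obtain u where u: "u \<in> M e" "chain_at {} u \<in> kbd n M 0 e" and s: "v - u \<in> fs.span (f e ` cols e)"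
      using f(2)[of v e] unfolding N_def by blast
    have "f e ` cols e \<subseteq> ?Im e"
    proof
      fix x assume "x \<in> f e ` cols e"
      then obtain c where c: "c < length sh" "sh ! c = e" "x = f e c" unfolding cols_def by blast
      then have "x = mat_map A (unit_vec_fun c)" using col[of c] by (simp add: g_def)
      then show "x \<in> ?Im e" using unit_vec_fun_gfree[OF c(1), of n] c(2) by blast
    qed
    then have 1: "v - u \<in> ?Im e" using s fs.span_minimal[OF _ sIm] by blast
    obtain y where y: "y \<in> kchain n M (Suc 0) e" "chain_at {} u = koszul_diff n y"
      using u(2) unfolding kbd_def by blast
    have "slice (chain_at {} u) {} = slice (koszul_diff n y) {}" using y(2) by simp
    then have ueq: "u = (\<Sum>k\<in>{1..n} - {}. fsc (ksgn k {}) (xmul k (slice y (insert k {}))))"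
      unfolding slice_koszul_diff by (simp add: slice_chain_at)
    have "fsc (ksgn k {}) (xmul k (slice y {k})) \<in> ?Im e" if k: "k \<in> {1..n} - {}" for k
    proof -
      have "slice y {k} \<in> M (e - 1)" using kchainD(1)[OF y(1), of "{k}"] k by simp
      then obtain w where w: "w \<in> gfree n sh (e - 1)" "slice y {k} = mat_map A w" using IH by blast
      have "xmul k w \<in> gfree n sh (e - 1 + 1)"
        using graded_moduleD(3)[OF graded_module_gfree, of k n w sh "e - 1"] k w(1) by simp
      then have "mat_map A (xmul k w) \<in> ?Im e" by simp
      moreover have "mat_map A (xmul k w) = xmul k (slice y {k})"
        using xlinear_mat_map[of A] unfolding xlinear_def w(2) by blast
      ultimately have "xmul k (slice y {k}) \<in> ?Im e" by simp
      then show ?thesis by (rule fs.subspace_scale[OF sIm])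
    qed
    then have 2: "u \<in> ?Im e" by (subst ueq) (rule fs.subspace_sum[OF sIm])
    have "v = (v - u) + u" by simp
    then show "v \<in> ?Im e" using fs.subspace_add[OF sIm 1 2] by simp
  qed
  obtain e0 where e0: "\<And>e. e < e0 \<Longrightarrow> gfree n ts e = ({0} :: (nat \<Rightarrow> 'k mpoly) set)"
    using gfree_bounded_below[of n ts] by metis
  have low: "M e \<subseteq> ?Im e" if "e < e0" for e
  proof -
    have "M e \<subseteq> {0}" using sub[of e] unfolding e0[OF that] .
    then show ?thesis using fs.subspace_0[OF sIm[of e]] by blast
  qed
  have "M e \<subseteq> ?Im e" if "e \<ge> e0 - 1" for e
    using that
  proof (induction e rule: int_ge_induct)
    case base
    show ?case by (rule low) simp
  next
    case (step e)
    then show ?case using im_step[of "e + 1"] by (simp only: add_diff_cancel_right')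
  qed
  then have "M e \<subseteq> ?Im e" for e using low[of e] by (cases "e < e0") simp_all
  then have "?Im e = M e" for e using into by blast
  then show ?thesis using homA by blast
qed

text \<open>Homogeneity is expressed as closure under taking homogeneous components.\<close>

definition homogeneous_ideal :: "nat \<Rightarrow> 'k::field mpoly set \<Rightarrow> bool" where
  "homogeneous_ideal n I \<longleftrightarrow> I \<subseteq> poly_ring n \<and> 0 \<in> I \<and> (\<forall>p\<in>I. \<forall>q\<in>I. p + q \<in> I) \<and>
     (\<forall>p\<in>I. \<forall>q\<in>poly_ring n. q * p \<in> I) \<and> (\<forall>p\<in>I. \<forall>e. pcomp e p \<in> I)"

lemma homogeneous_idealD:
  assumes "homogeneous_ideal n I"
  shows "I \<subseteq> poly_ring n" "0 \<in> I" "p \<in> I \<Longrightarrow> q \<in> I \<Longrightarrow> p + q \<in> I"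
    "p \<in> I \<Longrightarrow> q \<in> poly_ring n \<Longrightarrow> q * p \<in> I" "p \<in> I \<Longrightarrow> pcomp e p \<in> I"
  using assms unfolding homogeneous_ideal_def by blast+

lemma homogeneous_ideal_sum:
  assumes "homogeneous_ideal n I" shows "(\<And>a. a \<in> A \<Longrightarrow> f a \<in> I) \<Longrightarrow> sum f A \<in> I"
  by (induction A rule: infinite_finite_induct) (auto intro: homogeneous_idealD[OF assms])

lemma const_poly_ring: "const c \<in> poly_ring n"
  by (simp add: const_def poly_ring_def)

lemma Var_poly_ring: "k \<in> {1..n} \<Longrightarrow> Var k \<in> poly_ring n"
  by (simp add: Var_def poly_ring_def)

lemma graded_module_ideal_part:
  fixes I :: "'k::field mpoly set"
  assumes I: "homogeneous_ideal n I" shows "graded_module n (ideal_part n I)"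
proof -
  have G: "graded_module n (gfree n [0] :: int \<Rightarrow> (nat \<Rightarrow> 'k mpoly) set)" by (rule graded_module_gfree)
  have "fs.subspace (ideal_part n I e)" for e
  proof (rule fs_subspaceI)
    note sG = graded_moduleD(1)[OF G, of e]
    show "0 \<in> ideal_part n I e"
      using fs.subspace_0[OF sG] homogeneous_idealD(2)[OF I] by (simp add: ideal_part_def)
    show "u + v \<in> ideal_part n I e" if "u \<in> ideal_part n I e" "v \<in> ideal_part n I e" for u v
      using that fs.subspace_add[OF sG] homogeneous_idealD(3)[OF I] by (simp add: ideal_part_def)
    show "fsc c v \<in> ideal_part n I e" if "v \<in> ideal_part n I e" for c v
      using that fs.subspace_scale[OF sG] homogeneous_idealD(4)[OF I _ const_poly_ring[of c]]
      by (simp add: ideal_part_def fsc_apply)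
  qed
  moreover have "fs.fin_dim (ideal_part n I e)" for e
    by (rule fs.fin_dim_subset[OF graded_moduleD(2)[OF G, of e]]) (auto simp: ideal_part_def)
  moreover have "xmul k v \<in> ideal_part n I (e + 1)" if "k \<in> {1..n}" "v \<in> ideal_part n I e" for k v e
    using that graded_moduleD(3)[OF G, of k v e] homogeneous_idealD(4)[OF I _ Var_poly_ring[of k n]]
    by (simp add: ideal_part_def xmul_def)
  ultimately show ?thesis unfolding graded_module_def by blast
qed

lemma homogeneous_decomposition:
  assumes "\<And>i. i \<ge> length sh \<Longrightarrow> v i = 0"
  shows "\<exists>E. finite E \<and> (\<Sum>e\<in>E. hcomp sh e v) = v"
proof -
  let ?E = "\<Union>i<length sh. (\<lambda>m. int (total_deg m) + sh ! i) ` keys (v i)"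
  have fin: "finite ?E" by simp
  have "(\<Sum>e\<in>?E. hcomp sh e v) = v"
  proof (rule ext, rule poly_mapping_eqI)
    fix i m
    show "lookup ((\<Sum>e\<in>?E. hcomp sh e v) i) m = lookup (v i) m"
    proof (cases "i < length sh")
      case True
      have "lookup ((\<Sum>e\<in>?E. hcomp sh e v) i) m = (\<Sum>e\<in>?E. if e = int (total_deg m) + sh ! i then lookup (v i) m else 0)"
        unfolding sum_fun_apply lookup_sum
        by (rule sum.cong[OF refl]) (use True in \<open>auto simp: hcomp_def lookup_pcomp\<close>)
      also have "\<dots> = (if int (total_deg m) + sh ! i \<in> ?E then lookup (v i) m else 0)"
        by (rule sum.delta[OF fin])
      also have "\<dots> = lookup (v i) m"
      proof (cases "lookup (v i) m = 0")
        case False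
        then have "m \<in> keys (v i)" by (simp add: in_keys_iff)
        then have "int (total_deg m) + sh ! i \<in> ?E" using True by blast
        then show ?thesis by simp
      qed simp
      finally show ?thesis .
    next
      case False
      then show ?thesis using assms[of i] by (simp add: sum_fun_apply hcomp_def)
    qed
  qed
  then show ?thesis using fin by blast
qed

lemma fun_free_sum: "(\<And>a. a \<in> A \<Longrightarrow> f a \<in> fun_free n b) \<Longrightarrow> sum f A \<in> fun_free n b"
  by (induction A rule: infinite_finite_induct) (auto simp: fun_free_def poly_ring_add)

lemma hcomp_fun_free: "v \<in> fun_free n (length sh) \<Longrightarrow> hcomp sh e v \<in> gfree n sh e"
  by (rule hcomp_gfree) (simp add: fun_free_def)

lemma hcomp_0 [simp]: "hcomp sh e 0 = 0"
  by (simp add: hcomp_def fun_eq_iff)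

text \<open>Generators are chosen step by step, for the ideal and then for the kernel of the previous map. Since the number of generators in each
degree equals the dimension of the zeroth Koszul homology, the kernel reduces to zero modulo the maximal ideal; this makes the matrices minimal, and
it makes the Koszul homology of the kernel the shifted one, so that the prescribed shifts fit again in the next step. The maps are obtained by
dependent choice, together with the modules they cover, and exactness in every degree is then extended to all elements by decomposing into homogeneous
components.\<close>

lemma minimal_resolution_exists:
  fixes I :: "'k::field mpoly set"
  assumes I: "homogeneous_ideal n I"
    and count: "\<And>i j. count_list (sh i) j = kos n (ideal_part n I) i j"
  shows "\<exists>D. minimal_graded_free_resolution n I sh D"
proof -
  let ?M0 = "ideal_part n I" and ?T = "target_shifts sh"
  define ker where "ker i A = (\<lambda>e. {v \<in> gfree n (sh i) e. mat_map A v = 0})" for i and A :: "'k mpoly mat"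
  \<comment> \<open>\<open>good i M\<close> means that \<open>M\<close> can be the \<open>i\<close>-th syzygy module: its Koszul homology is that of the ideal, shifted by \<open>i\<close>.\<close>
  define good where "good i M \<longleftrightarrow> graded_module n M \<and> (\<forall>e. M e \<subseteq> gfree n (?T i) e) \<and>
      (\<forall>p j. kos n M p j = kos n ?M0 (p + i) j)" for i and M :: "int \<Rightarrow> (nat \<Rightarrow> 'k mpoly) set"
  define cover where "cover i M A \<longleftrightarrow> hom_mat n (?T i) (sh i) A \<and> (\<forall>e. mat_map A ` gfree n (sh i) e = M e)"
    for i and M :: "int \<Rightarrow> (nat \<Rightarrow> 'k mpoly) set" and A
  have ex_cover: "\<exists>A. cover i M A" if "good i M" for i M
  proof -
    have 1: "graded_module n M" and 2: "M e \<subseteq> gfree n (?T i) e" and 3: "count_list (sh i) j = kos n M 0 j" for e j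
      using that count[of i j] unfolding good_def by simp_all
    show ?thesis unfolding cover_def by (rule minimal_generators[OF 1 2 3])
  qed
  have exact: "free_exact n (sh i) M (ker i A) (mat_map A)" if "cover i M A" for i M A
    by unfold_locales (use that in \<open>simp_all add: graded_module_gfree xlinear_mat_map ker_def cover_def\<close>)
  have eps_ker: "eps ` ker i A e \<subseteq> {0}" and good_ker: "good (Suc i) (ker i A)"
    if g: "good i M" and c: "cover i M A" for i M A e
  proof -
    interpret E: free_exact n "sh i" M "ker i A" "mat_map A" by (rule exact[OF c])
    have gk: "kos n M p j = kos n ?M0 (p + i) j" for p j using g unfolding good_def by blast
    have d0: "fs.dim (eps ` ker i A j) = 0" for j
      using E.kos_0_add[of j] gk[of 0 j] count[of i j] unfolding add_0 by linarith
    show "eps ` ker i A e \<subseteq> {0}"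
    proof -
      have "{0} = eps ` ker i A e"
      proof (rule fs.subspace_eq_if_dim_le)
        show "fs.fin_dim (eps ` ker i A e)" by (rule fs_fin_dim_image[OF flinear_eps graded_moduleD(2)[OF E.Z]])
        show s: "fs.subspace (eps ` ker i A e)" by (rule fs_subspace_image[OF flinear_eps graded_moduleD(1)[OF E.Z]])
        show "{0} \<subseteq> eps ` ker i A e" using fs.subspace_0[OF s] by simp
        show "fs.subspace {0}" by (rule fs.subspace_single_0)
        show "fs.dim (eps ` ker i A e) \<le> fs.dim {0}" unfolding d0 by simp
      qed
      then show ?thesis by simp
    qed
    have "kos n (ker i A) p j = kos n ?M0 (p + Suc i) j" for p j
    proof (cases p)
      case 0
      show ?thesis unfolding 0 E.kos_0_kernel[of j] d0[of j] gk by simp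
    next
      case (Suc q)
      show ?thesis unfolding Suc E.kos_Suc_Suc[of q j, symmetric] gk by simp
    qed
    moreover have "ker i A e \<subseteq> gfree n (?T (Suc i)) e" for e by (auto simp: ker_def target_shifts_def)
    ultimately show "good (Suc i) (ker i A)" using E.Z unfolding good_def by blast
  qed
  have "\<exists>F. \<forall>i. (good i (fst (F i)) \<and> cover i (fst (F i)) (snd (F i)) \<and> (i = 0 \<longrightarrow> fst (F i) = ?M0)) \<and>
      fst (F (Suc i)) = ker i (snd (F i))"
  proof (rule dependent_nat_choice)
    have "good 0 ?M0"
      using graded_module_ideal_part[OF I] by (auto simp: good_def ideal_part_def target_shifts_def)
    then obtain A where "cover 0 ?M0 A" using ex_cover by blast
    with \<open>good 0 ?M0\<close> show "\<exists>x. good 0 (fst x) \<and> cover 0 (fst x) (snd x) \<and> (0 = (0::nat) \<longrightarrow> fst x = ?M0)"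
      by (intro exI[of _ "(?M0, A)"]) simp
  next
    fix x i assume x: "good i (fst x) \<and> cover i (fst x) (snd x) \<and> (i = 0 \<longrightarrow> fst x = ?M0)"
    then have g: "good (Suc i) (ker i (snd x))" using good_ker[of i "fst x" "snd x"] by blast
    then obtain A where "cover (Suc i) (ker i (snd x)) A" using ex_cover by blast
    with g show "\<exists>y. (good (Suc i) (fst y) \<and> cover (Suc i) (fst y) (snd y) \<and> (Suc i = 0 \<longrightarrow> fst y = ?M0)) \<and>
        fst y = ker i (snd x)"
      by (intro exI[of _ "(ker i (snd x), A)"]) simp
  qed
  then obtain F where F': "\<forall>i. (good i (fst (F i)) \<and> cover i (fst (F i)) (snd (F i)) \<and> (i = 0 \<longrightarrow> fst (F i) = ?M0)) \<and>
      fst (F (Suc i)) = ker i (snd (F i))" by (rule exE)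
  have F: "good i (fst (F i))" "cover i (fst (F i)) (snd (F i))" "fst (F 0) = ?M0"
    "fst (F (Suc i)) = ker i (snd (F i))" for i
    using F'[rule_format, of i] F'[rule_format, of 0] by simp_all
  define D where "D i = snd (F i)" for i
  have hm: "hom_mat n (?T i) (sh i) (D i)" for i using F(2)[of i] by (simp add: cover_def D_def)
  have im0: "mat_map (D 0) ` gfree n (sh 0) e = ?M0 e" for e
    using F(2)[of 0] by (simp add: cover_def D_def F(3))
  have imS: "mat_map (D (Suc i)) ` gfree n (sh (Suc i)) e = ker i (D i) e" for i e
    using F(2)[of "Suc i"] by (simp add: cover_def D_def F(4))
  have dec: "\<exists>E. finite E \<and> (\<Sum>e\<in>E. hcomp (sh i) e v) = v" if "v \<in> fun_free n (length (sh i))" for i v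
    by (rule homogeneous_decomposition) (use that in \<open>simp add: fun_free_def\<close>)
  have aug: "{mat_map (D 0) w 0 | w. w \<in> fun_free n (length (sh 0))} = I"
  proof
    show "{mat_map (D 0) w 0 | w. w \<in> fun_free n (length (sh 0))} \<subseteq> I"
    proof clarify
      fix w :: "nat \<Rightarrow> 'k mpoly" assume w: "w \<in> fun_free n (length (sh 0))"
      obtain E where E: "(\<Sum>e\<in>E. hcomp (sh 0) e w) = w" using dec[OF w] by blast
      have "mat_map (D 0) w = (\<Sum>e\<in>E. mat_map (D 0) (hcomp (sh 0) e w))"
        by (subst E[symmetric]) (rule flinear_sum[OF flinear_mat_map])
      then have "mat_map (D 0) w 0 = (\<Sum>e\<in>E. mat_map (D 0) (hcomp (sh 0) e w) 0)"
        by (simp add: sum_fun_apply)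
      moreover have "mat_map (D 0) (hcomp (sh 0) e w) 0 \<in> I" for e
      proof -
        have "mat_map (D 0) (hcomp (sh 0) e w) \<in> ?M0 e" using im0[of e] hcomp_fun_free[OF w] by blast
        then show ?thesis by (simp add: ideal_part_def)
      qed
      ultimately show "mat_map (D 0) w 0 \<in> I" by (simp only:) (rule homogeneous_ideal_sum[OF I])
    qed
    show "I \<subseteq> {mat_map (D 0) w 0 | w. w \<in> fun_free n (length (sh 0))}"
    proof
      fix p assume p: "p \<in> I"
      define v where "v = (\<lambda>i :: nat. if i = 0 then p else 0)"
      obtain E where E: "finite E" "(\<Sum>e\<in>E. hcomp [0] e v) = v"
        using homogeneous_decomposition[of "[0]" v] by (auto simp: v_def)
      have "\<exists>w. w \<in> gfree n (sh 0) e \<and> mat_map (D 0) w = hcomp [0] e v" for e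
      proof -
        have "hcomp [0] e v \<in> gfree n [0] e"
          by (rule hcomp_gfree) (use p homogeneous_idealD(1)[OF I] in \<open>auto simp: v_def\<close>)
        moreover have "hcomp [0] e v 0 \<in> I" using homogeneous_idealD(5)[OF I p] by (simp add: hcomp_def v_def)
        ultimately have "hcomp [0] e v \<in> ?M0 e" by (simp add: ideal_part_def)
        then show ?thesis unfolding im0[symmetric] by auto
      qed
      then obtain w where w: "\<And>e. w e \<in> gfree n (sh 0) e" "\<And>e. mat_map (D 0) (w e) = hcomp [0] e v" by metis
      have "mat_map (D 0) (sum w E) = v"
        unfolding flinear_sum[OF flinear_mat_map] w(2) by (rule E(2))
      then have "p = mat_map (D 0) (sum w E) 0" by (simp add: v_def)
      moreover have "sum w E \<in> fun_free n (length (sh 0))"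
        by (rule fun_free_sum) (use w(1) gfree_fun_free in blast)
      ultimately show "p \<in> {mat_map (D 0) w 0 | w. w \<in> fun_free n (length (sh 0))}" by blast
    qed
  qed
  have ex: "{v \<in> fun_free n (length (sh i)). mat_map (D i) v = 0} =
         mat_map (D (Suc i)) ` fun_free n (length (sh (Suc i)))" for i
  proof
    show "{v \<in> fun_free n (length (sh i)). mat_map (D i) v = 0} \<subseteq> mat_map (D (Suc i)) ` fun_free n (length (sh (Suc i)))"
    proof clarify
      fix v assume v: "v \<in> fun_free n (length (sh i))" "mat_map (D i) v = 0"
      obtain E where E: "(\<Sum>e\<in>E. hcomp (sh i) e v) = v" using dec[OF v(1)] by blast
      have "\<exists>w. w \<in> gfree n (sh (Suc i)) e \<and> mat_map (D (Suc i)) w = hcomp (sh i) e v" for e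
      proof -
        have "mat_map (D i) (hcomp (sh i) e v) = 0" unfolding mat_map_hcomp[OF hm] v(2) by simp
        then have "hcomp (sh i) e v \<in> ker i (D i) e" using hcomp_fun_free[OF v(1)] by (simp add: ker_def)
        then show ?thesis unfolding imS[symmetric] by auto
      qed
      then obtain w where w: "\<And>e. w e \<in> gfree n (sh (Suc i)) e" "\<And>e. mat_map (D (Suc i)) (w e) = hcomp (sh i) e v" by metis
      have "mat_map (D (Suc i)) (sum w E) = v"
        unfolding flinear_sum[OF flinear_mat_map] w(2) by (rule E)
      moreover have "sum w E \<in> fun_free n (length (sh (Suc i)))"
        by (rule fun_free_sum) (use w(1) gfree_fun_free in blast)
      ultimately show "v \<in> mat_map (D (Suc i)) ` fun_free n (length (sh (Suc i)))" by blast
    qed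
    show "mat_map (D (Suc i)) ` fun_free n (length (sh (Suc i))) \<subseteq> {v \<in> fun_free n (length (sh i)). mat_map (D i) v = 0}"
    proof clarify
      fix w :: "nat \<Rightarrow> 'k mpoly" assume w: "w \<in> fun_free n (length (sh (Suc i)))"
      obtain E where E: "(\<Sum>e\<in>E. hcomp (sh (Suc i)) e w) = w" using dec[OF w] by blast
      have k: "mat_map (D (Suc i)) (hcomp (sh (Suc i)) e w) \<in> ker i (D i) e" for e
        using imS[of i e] hcomp_fun_free[OF w] by blast
      have eq: "mat_map (D (Suc i)) w = (\<Sum>e\<in>E. mat_map (D (Suc i)) (hcomp (sh (Suc i)) e w))"
        by (subst E[symmetric]) (rule flinear_sum[OF flinear_mat_map])
      have "mat_map (D (Suc i)) w \<in> fun_free n (length (sh i))"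
      proof -
        have "mat_map (D (Suc i)) (hcomp (sh (Suc i)) e w) \<in> fun_free n (length (sh i))" for e
          using k[of e] gfree_fun_free unfolding ker_def by blast
        then show ?thesis unfolding eq by (rule fun_free_sum)
      qed
      moreover have "mat_map (D i) (mat_map (D (Suc i)) w) = 0"
        unfolding eq flinear_sum[OF flinear_mat_map] using k by (intro sum.neutral) (simp add: ker_def)
      ultimately show "mat_map (D (Suc i)) w \<in> fun_free n (length (sh i)) \<and> mat_map (D i) (mat_map (D (Suc i)) w) = 0" by blast
    qed
  qed
  have "graded_free_resolution n I sh D"
    unfolding graded_free_resolution_iff using hm aug ex by blast
  moreover have "lookup (D (Suc i) $$ (r, c)) 0 = 0" if r: "r < length (sh i)" and c: "c < length (sh (Suc i))" for i r c
  proof -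
    let ?u = "unit_vec_fun c :: nat \<Rightarrow> 'k mpoly"
    have "mat_map (D (Suc i)) ?u \<in> ker i (D i) (sh (Suc i) ! c)"
      using unit_vec_fun_gfree[OF c] imS by blast
    then have "eps (mat_map (D (Suc i)) ?u) = 0"
      using eps_ker[OF F(1)[of i] F(2)[of i]] unfolding D_def by blast
    then have "lookup (mat_map (D (Suc i)) ?u r) 0 = 0" unfolding eps_eq_0_iff by blast
    moreover have "mat_map (D (Suc i)) ?u r = D (Suc i) $$ (r, c)"
    proof -
      have "dim_row (D (Suc i)) = length (sh i)" "dim_col (D (Suc i)) = length (sh (Suc i))"
        using hm[of "Suc i"] by (auto simp: hom_mat_def target_shifts_def)
      then have "mat_map (D (Suc i)) ?u r = (\<Sum>d<length (sh (Suc i)). if d = c then D (Suc i) $$ (r, c) else 0)"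
        using r by (simp add: mat_map_def unit_vec_fun_def if_distrib cong: if_cong)
      then show ?thesis using c by simp
    qed
    ultimately show ?thesis by simp
  qed
  ultimately show ?thesis unfolding minimal_graded_free_resolution_def by blast
qed

section \<open>Squarefree ideals with at most two strands\<close>

text \<open>The monomials of degree \<open>e\<close> whose support satisfies \<open>P\<close>, placed at coordinate zero of a tuple.\<close>

definition sf_monoms :: "nat \<Rightarrow> (nat set \<Rightarrow> bool) \<Rightarrow> int \<Rightarrow> (nat \<times> (nat \<Rightarrow>\<^sub>0 nat)) set" where
  "sf_monoms n P e = {(i, m). i = 0 \<and> m \<in> monoms n e \<and> P (keys m)}"

abbreviation sf_module :: "nat \<Rightarrow> (nat set \<Rightarrow> bool) \<Rightarrow> int \<Rightarrow> (nat \<Rightarrow> 'k::field mpoly) set" where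
  "sf_module n P \<equiv> (\<lambda>e. supp_space (sf_monoms n P e))"

lemma finite_sf_monoms: "finite (sf_monoms n P e)"
proof -
  have "sf_monoms n P e \<subseteq> {0} \<times> monoms n e" by (auto simp: sf_monoms_def)
  then show ?thesis by (rule finite_subset) simp
qed

lemma card_keys_le: "card (keys m) \<le> total_deg m"
proof -
  have "(\<Sum>k\<in>keys m. 1) \<le> (\<Sum>k\<in>keys m. lookup m k)"
    by (rule sum_mono) (auto simp: in_keys_iff)
  then show ?thesis by (simp add: total_deg_def)
qed

lemma squarefree_eq_chi: "(\<And>k. lookup m k \<le> 1) \<Longrightarrow> m = chi (keys m)"
proof (rule poly_mapping_eqI)
  fix k assume le: "\<And>k. lookup m k \<le> 1"
  show "lookup m k = lookup (chi (keys m)) k"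
    using le[of k] by (cases "lookup m k = 0") (simp_all add: lookup_chi in_keys_iff)
qed

lemma squarefree_of_card:
  assumes "card (keys m) = total_deg m" shows "m = chi (keys m)"
proof (rule squarefree_eq_chi, rule ccontr)
  fix k assume k: "\<not> lookup m k \<le> 1"
  then have "k \<in> keys m" by (simp add: in_keys_iff)
  then have "(\<Sum>l\<in>keys m. 1) < (\<Sum>l\<in>keys m. lookup m l)"
  proof (intro sum_strict_mono_ex1)
    show "\<exists>l\<in>keys m. 1 < lookup m l" using k \<open>k \<in> keys m\<close> by (intro bexI[of _ k]) simp_all
  qed (auto simp: in_keys_iff)
  then show False using assms by (simp add: total_deg_def)
qed

lemma contraction_nonzero:
  assumes "lookup (contraction n \<kappa> z (G, i)) u \<noteq> 0"
  shows "G \<subseteq> {1..n}" "\<kappa> (u + chi G) \<in> G"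
    "lookup (z (G - {\<kappa> (u + chi G)}, i)) (u + var_mon (\<kappa> (u + chi G))) \<noteq> 0"
  using assms unfolding lookup_contraction Let_def by (auto split: if_splits)

text \<open>A variable of exponent at least two, if there is one, and otherwise any variable of the monomial. Contracting along it does not change the
supports of the coefficients unless the multidegree is squarefree.\<close>

definition repeated_var :: "(nat \<Rightarrow>\<^sub>0 nat) \<Rightarrow> nat" where
  "repeated_var a = (if \<exists>k. lookup a k \<ge> 2 then SOME k. lookup a k \<ge> 2 else SOME k. k \<in> keys a)"

lemma repeated_var_in: "a \<noteq> 0 \<Longrightarrow> repeated_var a \<in> keys a"
proof -
  assume "a \<noteq> 0"
  then obtain l where l: "l \<in> keys a" by (metis keys_eq_empty ex_in_conv)
  show ?thesis
  proof (cases "\<exists>k. lookup a k \<ge> 2")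
    case True
    then have "lookup a (SOME k. lookup a k \<ge> 2) \<ge> 2" by (rule someI_ex)
    then show ?thesis using True by (simp add: repeated_var_def in_keys_iff)
  next
    case False
    have "(SOME k. k \<in> keys a) \<in> keys a" using l by (rule someI)
    then show ?thesis using False by (simp add: repeated_var_def)
  qed
qed

lemma repeated_var_ge_2: "lookup a l \<ge> 2 \<Longrightarrow> lookup a (repeated_var a) \<ge> 2"
proof -
  assume "lookup a l \<ge> 2"
  then have ex: "\<exists>k. lookup a k \<ge> 2" by blast
  then have "lookup a (SOME k. lookup a k \<ge> 2) \<ge> 2" by (rule someI_ex)
  then show ?thesis using ex by (simp add: repeated_var_def)
qed

text \<open>The part of a chain of multidegree \<open>a\<close>; it commutes with the Koszul differential.\<close>

definition mdeg_part :: "(nat \<Rightarrow>\<^sub>0 nat) \<Rightarrow> (nat set \<times> nat \<Rightarrow> 'k::field mpoly) \<Rightarrow> nat set \<times> nat \<Rightarrow> 'k mpoly" where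
  "mdeg_part a z = (\<lambda>(F, i). Abs_poly_mapping (\<lambda>u. if u + chi F = a then lookup (z (F, i)) u else 0))"

lemma lookup_mdeg_part: "lookup (mdeg_part a z (F, i)) u = (if u + chi F = a then lookup (z (F, i)) u else 0)"
proof -
  have "finite {u. (if u + chi F = a then lookup (z (F, i)) u else 0) \<noteq> 0}"
    by (rule finite_subset[OF _ finite_keys[of "z (F, i)"]]) (auto simp: in_keys_iff)
  from lookup_Abs_poly_mapping[OF this] show ?thesis unfolding mdeg_part_def prod.case by (rule fun_cong)
qed

lemma koszul_diff_mdeg_part:
  assumes "\<And>F i. \<not> F \<subseteq> {1..n} \<Longrightarrow> z (F, i) = 0"
  shows "koszul_diff n (mdeg_part a z) = mdeg_part a (koszul_diff n z)"
proof (rule ext, rule poly_mapping_eqI)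
  fix x :: "nat set \<times> nat" and u
  obtain F i where x: "x = (F, i)" by (cases x)
  show "lookup (koszul_diff n (mdeg_part a z) x) u = lookup (mdeg_part a (koszul_diff n z) x) u"
  proof (cases "F \<subseteq> {1..n}")
    case True
    then have fF: "finite F" by (rule finite_subset) simp
    have "(if lookup u l = 0 then 0 else ksgn l F * lookup (mdeg_part a z (insert l F, i)) (u - var_mon l)) =
      (if u + chi F = a then if lookup u l = 0 then 0 else ksgn l F * lookup (z (insert l F, i)) (u - var_mon l) else 0)"
      if "l \<in> {1..n} - F" for l
    proof (cases "lookup u l = 0")
      case False
      have "u - var_mon l + chi (insert l F) = u + chi F" using chi_shift[OF fF _ False] that by blast
      then show ?thesis unfolding lookup_mdeg_part by simp
    qed simp
    then have "lookup (koszul_diff n (mdeg_part a z) x) u = (\<Sum>l\<in>{1..n} - F. if u + chi F = a then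
        if lookup u l = 0 then 0 else ksgn l F * lookup (z (insert l F, i)) (u - var_mon l) else 0)"
      unfolding x lookup_koszul_diff by (rule sum.cong[OF refl])
    also have "\<dots> = lookup (mdeg_part a (koszul_diff n z) x) u"
      unfolding x lookup_mdeg_part lookup_koszul_diff by simp
    finally show ?thesis .
  next
    case False
    then have "z (insert l F, i) = 0" for l using assms by blast
    then have "lookup (koszul_diff n (mdeg_part a z) x) u = 0" "lookup (koszul_diff n z (F, i)) u = 0"
      unfolding x lookup_koszul_diff lookup_mdeg_part by simp_all
    then show ?thesis unfolding x lookup_mdeg_part by simp
  qed
qed

lemma kchain_outside: "z \<in> kchain n M p j \<Longrightarrow> \<not> F \<subseteq> {1..n} \<Longrightarrow> z (F, i) = 0"
  using kchainD(2)[of z n M p j F] by (metis lookup_slice zero_fun_apply)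

text \<open>The sets with property \<open>P\<close> are the nonfaces of a simplicial complex on \<open>{1..n}\<close> that contains all sets with
fewer than \<open>d\<close> elements and none with more than \<open>d\<close>; the monomials with support in \<open>P\<close> span its Stanley-Reisner
ideal.\<close>

locale sf_complex =
  fixes n d :: nat and P :: "nat set \<Rightarrow> bool"
  assumes mono: "P \<sigma> \<Longrightarrow> \<sigma> \<subseteq> \<tau> \<Longrightarrow> P \<tau>"
    and small: "\<sigma> \<subseteq> {1..n} \<Longrightarrow> card \<sigma> < d \<Longrightarrow> \<not> P \<sigma>"
    and big: "\<sigma> \<subseteq> {1..n} \<Longrightarrow> d < card \<sigma> \<Longrightarrow> P \<sigma>"
begin

lemma graded_module_sf: "graded_module n (sf_module n P)"
proof (rule graded_module_supp_space[OF finite_sf_monoms])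
  fix e i m k assume "(i, m) \<in> sf_monoms n P e" "k \<in> {1..n}"
  then show "(i, var_mon k + m) \<in> sf_monoms n P (e + 1)"
    using monoms_add_var[of k n m e] mono[of "keys m" "keys (var_mon k + m)"]
    by (auto simp: sf_monoms_def keys_add_nat)
qed

lemma sf_monoms_small: assumes "e < int d" shows "sf_monoms n P e = {}"
proof -
  have "\<not> P (keys m)" if "m \<in> monoms n e" for m
    using small[of "keys m"] card_keys_le[of m] that assms by (auto simp: monoms_def)
  then show ?thesis by (auto simp: sf_monoms_def)
qed

lemma kchain_small: assumes "j - int p < int d" shows "kchain n (sf_module n P) p j = {0 :: _ \<Rightarrow> 'k::field mpoly}"
proof -
  have 1: "{((F, i), u). F \<subseteq> {1..n} \<and> card F = p \<and> (i, u) \<in> sf_monoms n P (j - int p)} = {}"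
    using sf_monoms_small[OF assms] by simp
  have 2: "supp_space {} = {0 :: nat set \<times> nat \<Rightarrow> 'k mpoly}"
    by (auto simp: supp_space_def fun_eq_iff intro!: poly_mapping_eqI)
  show ?thesis unfolding kchain_supp_space 1 by (rule 2)
qed

lemma kos_small:
  assumes "j - int p < int d"
  shows "kos n (sf_module n P :: int \<Rightarrow> (nat \<Rightarrow> 'k::field mpoly) set) p j = 0"
proof -
  have "kcyc n (sf_module n P) p j \<subseteq> {0 :: _ \<Rightarrow> 'k mpoly}"
    using kchain_small[OF assms, where 'k='k] by (auto simp: kcyc_def)
  then have "fs.dim (kcyc n (sf_module n P) p j :: (_ \<Rightarrow> 'k mpoly) set) = 0"
    using fs.dim_le_card[of _ "{}"] by simp
  then show ?thesis by (simp add: kos_def)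
qed

text \<open>If the multidegree has an exponent at least two at \<open>k\<close>, then dividing a coefficient by \<open>x\<^sub>k\<close> keeps its
support, because \<open>k\<close> occurs only once in the exterior part. Otherwise the multidegree is squarefree, and then so is the coefficient, with
support disjoint from the exterior part.\<close>

lemma contraction_cycle:
  fixes z :: "nat set \<times> nat \<Rightarrow> 'k::field mpoly"
  assumes z: "z \<in> kcyc n (sf_module n P) p j" and pos: "0 < j"
  defines "y \<equiv> contraction n repeated_var z"
  shows "koszul_diff n y = z"
    and "lookup (y (G, i)) u \<noteq> 0 \<Longrightarrow> G \<subseteq> {1..n} \<and> card G = Suc p \<and> i = 0 \<and> u \<in> monoms n (j - int (Suc p)) \<and>
      (P (keys u) \<or> u = chi (keys u) \<and> G \<inter> keys u = {})"
proof -
  have zc: "z \<in> kchain n (sf_module n P) p j" and cyc: "koszul_diff n z = 0"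
    using z by (auto simp: kcyc_def)
  show "koszul_diff n y = z" unfolding y_def
  proof (rule koszul_diff_contraction[OF cyc])
    fix G i u assume nz: "lookup (z (G, i)) u \<noteq> 0"
    have G: "G \<subseteq> {1..n}" "card G = p" "(i, u) \<in> sf_monoms n P (j - int p)"
      using kchain_supp_spaceD[OF zc nz] by blast+
    have fG: "finite G" using G(1) by (rule finite_subset) simp
    have "int (total_deg (u + chi G)) = j"
      using G by (simp add: total_deg_chi[OF fG] sf_monoms_def monoms_def)
    then have "u + chi G \<noteq> 0" using pos by (metis of_nat_0 order_less_irrefl total_deg_0)
    then have "repeated_var (u + chi G) \<in> keys (u + chi G)" by (rule repeated_var_in)
    moreover have "keys (u + chi G) \<subseteq> {1..n}"
      using G fG by (simp add: keys_add_nat keys_chi sf_monoms_def monoms_def)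
    ultimately show "G \<subseteq> {1..n} \<and> repeated_var (u + chi G) \<in> {1..n} \<and> lookup (u + chi G) (repeated_var (u + chi G)) \<noteq> 0"
      using G(1) unfolding in_keys_iff[symmetric] by blast
  qed
  assume nz: "lookup (y (G, i)) u \<noteq> 0"
  define k where "k = repeated_var (u + chi G)"
  have G: "G \<subseteq> {1..n}" "k \<in> G" and l: "lookup (z (G - {k}, i)) (u + var_mon k) \<noteq> 0"
    using contraction_nonzero[OF nz[unfolded y_def]] unfolding k_def by blast+
  have fG: "finite G" using G(1) by (rule finite_subset) simp
  have c: "card (G - {k}) = p" and m: "(i, u + var_mon k) \<in> sf_monoms n P (j - int p)"
    using kchain_supp_spaceD[OF zc l] by blast+
  have cG: "card G = Suc p" using c G(2) fG by (metis card_Suc_Diff1)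
  have k: "k \<in> {1..n}" using G by blast
  have i: "i = 0" and mo: "u + var_mon k \<in> monoms n (j - int p)" and Pk: "P (keys (u + var_mon k))"
    using m by (auto simp: sf_monoms_def)
  have um: "u \<in> monoms n (j - int (Suc p))"
    using monoms_add_var[OF k, of u "j - int (Suc p)"] mo by (simp add: add.commute algebra_simps)
  have "P (keys u) \<or> u = chi (keys u) \<and> G \<inter> keys u = {}"
  proof (cases "\<exists>l. lookup (u + chi G) l \<ge> 2")
    case True
    then have "lookup (u + chi G) k \<ge> 2" unfolding k_def using repeated_var_ge_2 by blast
    then have "lookup u k \<noteq> 0" using G(2) by (simp add: lookup_add lookup_chi[OF fG])
    then have "keys (u + var_mon k) = keys u" by (auto simp: keys_add_nat in_keys_iff)
    then show ?thesis using Pk by simp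
  next
    case False
    then have le: "lookup u l + (if l \<in> G then 1 else 0) \<le> 1" for l
    proof -
      have "lookup u l + lookup (chi G) l < 2" using False by (simp add: lookup_add not_le)
      then show ?thesis unfolding lookup_chi[OF fG] by linarith
    qed
    have "lookup u l \<le> 1" for l using le[of l] by linarith
    then have "u = chi (keys u)" by (rule squarefree_eq_chi)
    moreover have "G \<inter> keys u = {}"
    proof (rule ccontr)
      assume "G \<inter> keys u \<noteq> {}"
      then obtain l where "l \<in> G" "l \<in> keys u" by blast
      then show False using le[of l] by (simp add: in_keys_iff)
    qed
    ultimately show ?thesis by blast
  qed
  then show "G \<subseteq> {1..n} \<and> card G = Suc p \<and> i = 0 \<and> u \<in> monoms n (j - int (Suc p)) \<and>
      (P (keys u) \<or> u = chi (keys u) \<and> G \<inter> keys u = {})"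
    using G(1) cG i um by blast
qed

text \<open>A squarefree coefficient of a contraction has degree above \<open>d\<close> here and hence lies in the ideal, so contracting a cycle shows
that it is a boundary.\<close>

lemma kos_large:
  assumes "j - int p > int d + 1"
  shows "kos n (sf_module n P :: int \<Rightarrow> (nat \<Rightarrow> 'k::field mpoly) set) p j = 0"
proof -
  have "z \<in> kbd n (sf_module n P) p j" if z: "z \<in> kcyc n (sf_module n P) p j" for z :: "nat set \<times> nat \<Rightarrow> 'k mpoly"
  proof -
    have pos: "0 < j" using assms by simp
    let ?y = "contraction n repeated_var z"
    note y = contraction_cycle[OF z pos]
    have "?y \<in> kchain n (sf_module n P) (Suc p) j" unfolding kchain_supp_space supp_space_iff
    proof (intro allI impI)
      fix x u assume nz: "lookup (?y x) u \<noteq> 0"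
      obtain G i where x: "x = (G, i)" by (cases x)
      have *: "G \<subseteq> {1..n}" "card G = Suc p" "i = 0" "u \<in> monoms n (j - int (Suc p))"
        "P (keys u) \<or> u = chi (keys u)" using y(2)[OF nz[unfolded x]] by blast+
      have "P (keys u)"
      proof (cases "u = chi (keys u)")
        case True
        then have "total_deg u = card (keys u)" using total_deg_chi[of "keys u"] by simp
        then have "d < card (keys u)" "keys u \<subseteq> {1..n}" using *(4) assms by (auto simp: monoms_def)
        then show ?thesis using big by blast
      qed (use *(5) in blast)
      then show "(x, u) \<in> {((F, i), u). F \<subseteq> {1..n} \<and> card F = Suc p \<and> (i, u) \<in> sf_monoms n P (j - int (Suc p))}"
        using * x by (simp add: sf_monoms_def)
    qed
    then show ?thesis using y(1) unfolding kbd_def by (metis image_eqI)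
  qed
  then have "kcyc n (sf_module n P) p j = (kbd n (sf_module n P) p j :: (_ \<Rightarrow> 'k mpoly) set)"
    using kbd_subset_kcyc[OF graded_module_sf] by blast
  then show ?thesis by (simp add: kos_def)
qed

end

section \<open>The upper strand\<close>

context sf_complex
begin

definition circuits :: "nat set set" where
  "circuits = {T. T \<subseteq> {1..n} \<and> card T = d \<and> \<not> P T}"

lemma circuitsD: "T \<in> circuits \<Longrightarrow> T \<subseteq> {1..n}" "T \<in> circuits \<Longrightarrow> card T = d" "T \<in> circuits \<Longrightarrow> \<not> P T"
  "T \<in> circuits \<Longrightarrow> finite T"
  using finite_subset[of T "{1..n}"] by (auto simp: circuits_def)

lemma finite_circuits: "finite circuits"
  by (rule finite_subset[of _ "Pow {1..n}"]) (auto simp: circuits_def)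

text \<open>The pairs \<open>(G, T)\<close> that label the squarefree terms \<open>x\<^sub>T e\<^sub>G\<close> with coefficient outside the ideal, in
homological degree \<open>p + 1\<close> and internal degree \<open>p + d + 1\<close>.\<close>

definition free_pairs :: "nat \<Rightarrow> (nat set \<times> nat set) set" where
  "free_pairs p = {(G, T). G \<subseteq> {1..n} \<and> card G = Suc p \<and> T \<in> circuits \<and> G \<inter> T = {}}"

lemma finite_free_pairs: "finite (free_pairs p)"
  by (rule finite_subset[of _ "Pow {1..n} \<times> Pow {1..n}"]) (auto simp: free_pairs_def circuits_def)

text \<open>The chain \<open>x\<^sub>T e\<^sub>G\<close>.\<close>

definition ground :: "nat set \<times> nat set \<Rightarrow> nat set \<times> nat \<Rightarrow> 'k::field mpoly" where
  "ground q = unit_fun (fst q, 0) (chi (snd q))"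

lemma lookup_ground: "lookup (ground (G, T) (F, i)) u = (if F = G \<and> i = 0 \<and> u = chi T then 1 else 0)"
  by (auto simp: ground_def lookup_unit_fun)

text \<open>Subtracting its terms outside the ideal from a contraction leaves a chain of the ideal.\<close>

lemma ground_decomposition:
  fixes y :: "nat set \<times> nat \<Rightarrow> 'k::field mpoly"
  assumes y: "\<And>G i u. lookup (y (G, i)) u \<noteq> 0 \<Longrightarrow> G \<subseteq> {1..n} \<and> card G = Suc p \<and> i = 0 \<and>
      u \<in> monoms n (int d) \<and> (P (keys u) \<or> u = chi (keys u) \<and> G \<inter> keys u = {})"
  shows "y - (\<Sum>q\<in>free_pairs p. fsc (lookup (y (fst q, 0)) (chi (snd q))) (ground q))
    \<in> kchain n (sf_module n P) (Suc p) (int (p + d + 1))"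
proof -
  let ?s = "\<Sum>q\<in>free_pairs p. fsc (lookup (y (fst q, 0)) (chi (snd q))) (ground q)"
  have s: "lookup (?s (G, i)) u =
      (if i = 0 \<and> (G, keys u) \<in> free_pairs p \<and> u = chi (keys u) then lookup (y (G, 0)) u else 0)" for G i u
  proof -
    have "lookup (?s (G, i)) u = (\<Sum>q\<in>free_pairs p. lookup (y (fst q, 0)) (chi (snd q)) * lookup (ground q (G, i)) u)"
      by (simp add: sum_fun_apply lookup_sum fsc_apply)
    also have "\<dots> = (\<Sum>q\<in>free_pairs p. if q = (G, keys u) then (if i = 0 \<and> u = chi (keys u) then lookup (y (G, 0)) u else 0) else 0)"
    proof (rule sum.cong[OF refl])
      fix q assume q: "q \<in> free_pairs p"
      obtain H T where HT: "q = (H, T)" by (cases q)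
      have fT: "finite T" using q HT circuitsD(4) by (simp add: free_pairs_def)
      show "lookup (y (fst q, 0)) (chi (snd q)) * lookup (ground q (G, i)) u =
        (if q = (G, keys u) then (if i = 0 \<and> u = chi (keys u) then lookup (y (G, 0)) u else 0) else 0)"
        unfolding HT lookup_ground using keys_chi[OF fT] by auto
    qed
    also have "\<dots> = (if (G, keys u) \<in> free_pairs p then (if i = 0 \<and> u = chi (keys u) then lookup (y (G, 0)) u else 0) else 0)"
      by (rule sum.delta[OF finite_free_pairs])
    finally show ?thesis by simp
  qed
  show ?thesis unfolding kchain_supp_space supp_space_iff
  proof (intro allI impI)
    fix x u assume nz: "lookup ((y - ?s) x) u \<noteq> 0"
    obtain G i where x: "x = (G, i)" by (cases x)
    have "(y - ?s) x = y (G, i) - ?s (G, i)" unfolding x by (rule minus_apply)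
    then have nz': "lookup (y (G, i)) u - lookup (?s (G, i)) u \<noteq> 0" using nz by (simp add: lookup_minus)
    have y0: "lookup (y (G, i)) u \<noteq> 0"
    proof
      assume "lookup (y (G, i)) u = 0"
      then show False using nz' unfolding s by (cases "i = 0") (simp_all split: if_splits)
    qed
    note * = y[OF y0]
    have "P (keys u)"
    proof (rule ccontr)
      assume nP: "\<not> P (keys u)"
      then have u: "u = chi (keys u)" "G \<inter> keys u = {}" using * by blast+
      have "total_deg u = d" "keys u \<subseteq> {1..n}" using * by (auto simp: monoms_def)
      then have "card (keys u) = d" using u(1) total_deg_chi[of "keys u"] by simp
      then have "keys u \<in> circuits" using nP \<open>keys u \<subseteq> {1..n}\<close> by (simp add: circuits_def)
      then have "(G, keys u) \<in> free_pairs p" using * u(2) by (simp add: free_pairs_def)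
      then have "lookup (?s (G, i)) u = lookup (y (G, i)) u" unfolding s using * u(1) by simp
      then show False using nz' by simp
    qed
    then show "(x, u) \<in> {((F, i), u). F \<subseteq> {1..n} \<and> card F = Suc p \<and> (i, u) \<in> sf_monoms n P (int (p + d + 1) - int (Suc p))}"
      using * x by (simp add: sf_monoms_def)
  qed
qed

text \<open>Each term of the differential of \<open>x\<^sub>T e\<^sub>G\<close> has as coefficient a squarefree monomial of degree \<open>d +
1\<close>, and these lie in the ideal.\<close>

lemma koszul_diff_ground_kcyc:
  assumes q: "q \<in> free_pairs p"
  shows "koszul_diff n (ground q :: _ \<Rightarrow> 'k::field mpoly) \<in> kcyc n (sf_module n P) p (int (p + d + 1))"
proof -
  obtain G T where GT: "q = (G, T)" by (cases q)
  have G: "G \<subseteq> {1..n}" "card G = Suc p" "G \<inter> T = {}" and T: "T \<in> circuits" using q by (auto simp: GT free_pairs_def)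
  have fG: "finite G" using G(1) by (rule finite_subset) simp
  note fT = circuitsD(4)[OF T]
  have "koszul_diff n (ground q :: _ \<Rightarrow> 'k mpoly) \<in> kchain n (sf_module n P) p (int (p + d + 1))"
    unfolding kchain_supp_space supp_space_iff
  proof (intro allI impI)
    fix x u assume nz: "lookup (koszul_diff n (ground q :: _ \<Rightarrow> 'k mpoly) x) u \<noteq> 0"
    obtain F i where x: "x = (F, i)" by (cases x)
    have "\<exists>l\<in>{1..n} - F. (if lookup u l = 0 then 0
        else ksgn l F * lookup (ground q (insert l F, i)) (u - var_mon l)) \<noteq> (0 :: 'k)"
    proof (rule ccontr)
      assume "\<not> ?thesis"
      then have "lookup (koszul_diff n (ground q :: _ \<Rightarrow> 'k mpoly) x) u = 0"
        unfolding x lookup_koszul_diff by (intro sum.neutral) blast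
      then show False using nz by blast
    qed
    then obtain l where "l \<in> {1..n} - F"
      "(if lookup u l = 0 then 0 else ksgn l F * lookup (ground q (insert l F, i)) (u - var_mon l)) \<noteq> (0 :: 'k)" ..
    then have l: "l \<in> {1..n}" "l \<notin> F" "lookup u l \<noteq> 0" "insert l F = G" "i = 0" "u - var_mon l = chi T"
      unfolding GT lookup_ground by (auto split: if_splits)
    have u: "u = var_mon l + chi T" using minus_var_mon_add[OF l(3)] l(6) by simp
    have lT: "l \<notin> T" using l(4) G(3) by blast
    have ku: "keys u = insert l T" unfolding u keys_add_nat keys_chi[OF fT] by simp
    have "card (insert l T) = Suc d" using lT fT circuitsD(2)[OF T] by simp
    moreover have sub: "insert l T \<subseteq> {1..n}" using l(1) circuitsD(1)[OF T] by blast
    ultimately have "P (keys u)" unfolding ku using big[of "insert l T"] by simp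
    moreover have "total_deg u = Suc d" unfolding u by (simp add: total_deg_chi[OF fT] circuitsD(2)[OF T])
    moreover have "card F = p" "F \<subseteq> {1..n}" using l(2,4) G(1,2) fG by auto
    ultimately show "(x, u) \<in> {((F, i), u). F \<subseteq> {1..n} \<and> card F = p \<and> (i, u) \<in> sf_monoms n P (int (p + d + 1) - int p)}"
      using l(5) sub ku by (simp add: x sf_monoms_def monoms_def)
  qed
  then show ?thesis by (simp add: kcyc_def koszul_diff_sq)
qed

text \<open>The hypothesis says that adding \<open>x\<^sub>T\<^sub>0\<close> to the ideal kills the class of \<open>\<partial> (x\<^sub>T
e\<^sub>G)\<close>. A chain of the larger ideal with this boundary may be assumed to have the multidegree of \<open>W = G \<union> T\<close>. Its
coefficients are then squarefree of degree \<open>d\<close>, and the only one that can lie outside the smaller ideal is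
\<open>x\<^sub>T\<^sub>0\<close>, at \<open>W - T\<^sub>0\<close>.\<close>

lemma koszul_diff_ground_exchange:
  fixes T0 :: "nat set" and p :: nat
  defines "P0 \<equiv> \<lambda>\<sigma>. P \<sigma> \<or> T0 \<subseteq> \<sigma>" and "j \<equiv> int (p + d + 1)"
  assumes q: "(G, T) \<in> free_pairs p" and T0: "T0 \<in> circuits"
    and ex: "kcyc n (sf_module n P0) p j \<subseteq> (kbd n (sf_module n P0) p j :: (_ \<Rightarrow> 'k::field mpoly) set)"
  shows "\<exists>c. koszul_diff n (ground (G, T)) - fsc c (koszul_diff n (ground (G \<union> T - T0, T0)))
      \<in> (kbd n (sf_module n P) p j :: (_ \<Rightarrow> 'k mpoly) set) \<and> (\<not> T0 \<subseteq> G \<union> T \<longrightarrow> c = 0)"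
proof -
  let ?W = "G \<union> T" and ?e = "ground (G, T) :: nat set \<times> nat \<Rightarrow> 'k mpoly"
  have G: "G \<subseteq> {1..n}" "G \<inter> T = {}" and T: "T \<in> circuits" using q by (auto simp: free_pairs_def)
  have fG: "finite G" using G(1) by (rule finite_subset) simp
  note fT = circuitsD(4)[OF T] and fT0 = circuitsD(4)[OF T0]
  have fW: "finite ?W" using fG fT by simp
  have "sf_monoms n P e \<subseteq> sf_monoms n P0 e" for e by (auto simp: sf_monoms_def P0_def)
  then have "kchain n (sf_module n P) p j \<subseteq> (kchain n (sf_module n P0) p j :: (_ \<Rightarrow> 'k mpoly) set)"
    unfolding kchain_supp_space subset_iff supp_space_iff by blast
  then have "koszul_diff n ?e \<in> kcyc n (sf_module n P0) p j"
    using koszul_diff_ground_kcyc[OF q] unfolding kcyc_def j_def by blast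
  then have "koszul_diff n ?e \<in> kbd n (sf_module n P0) p j" using ex by blast
  then obtain y where yc: "y \<in> kchain n (sf_module n P0) (Suc p) j" and y: "koszul_diff n ?e = koszul_diff n y"
    unfolding kbd_def by blast
  \<comment> \<open>Both sides may be restricted to the multidegree of \<open>?W\<close>, since the left one is concentrated there.\<close>
  define y' where "y' = mdeg_part (chi ?W) y"
  have "chi T + chi G = chi ?W"
    by (rule poly_mapping_eqI) (use G(2) in \<open>auto simp: lookup_add lookup_chi fT fG\<close>)
  then have "mdeg_part (chi ?W) ?e = ?e"
    by (intro ext poly_mapping_eqI) (auto simp: lookup_mdeg_part lookup_ground)
  moreover have "koszul_diff n (mdeg_part (chi ?W) ?e) = mdeg_part (chi ?W) (koszul_diff n ?e)"
    by (rule koszul_diff_mdeg_part) (use G(1) in \<open>auto intro!: poly_mapping_eqI simp: lookup_ground split: if_splits\<close>)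
  moreover have "koszul_diff n y' = mdeg_part (chi ?W) (koszul_diff n y)"
    unfolding y'_def by (rule koszul_diff_mdeg_part) (rule kchain_outside[OF yc])
  ultimately have dy': "koszul_diff n y' = koszul_diff n ?e" using y by simp
  have coeff: "F \<subseteq> {1..n} \<and> card F = Suc p \<and> i = 0 \<and> u \<in> monoms n (int d) \<and>
      P0 (keys u) \<and> u = chi (keys u) \<and> F \<inter> keys u = {} \<and> F = ?W - keys u \<and> keys u \<subseteq> ?W"
    if nz: "lookup (y' (F, i)) u \<noteq> 0" for F i u
  proof -
    have uF: "u + chi F = chi ?W" and nz': "lookup (y (F, i)) u \<noteq> 0"
      using nz unfolding y'_def lookup_mdeg_part by (auto split: if_splits)
    have F: "F \<subseteq> {1..n}" "card F = Suc p" "(i, u) \<in> sf_monoms n P0 (j - int (Suc p))"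
      using kchain_supp_spaceD[OF yc nz'] by blast+
    have fF: "finite F" using F(1) by (rule finite_subset) simp
    have e: "lookup u k + (if k \<in> F then 1 else 0) = (if k \<in> ?W then 1 else 0)" for k
      using arg_cong[OF uF, of "\<lambda>m. lookup m k"] unfolding lookup_add lookup_chi[OF fF] lookup_chi[OF fW] .
    have "lookup u k \<le> 1" for k using e[of k] by (simp split: if_splits)
    then have "u = chi (keys u)" by (rule squarefree_eq_chi)
    moreover have "k \<in> F \<longleftrightarrow> k \<in> ?W \<and> k \<notin> keys u" "k \<in> keys u \<Longrightarrow> k \<in> ?W" for k
      using e[of k] unfolding in_keys_iff by (simp_all split: if_splits)
    ultimately show ?thesis using F by (auto simp: sf_monoms_def j_def)
  qed
  have "y' - (\<Sum>q\<in>free_pairs p. fsc (lookup (y' (fst q, 0)) (chi (snd q))) (ground q))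
    \<in> kchain n (sf_module n P) (Suc p) (int (p + d + 1))"
    by (rule ground_decomposition) (use coeff in blast)
  then have yP: "y' - (\<Sum>q\<in>free_pairs p. fsc (lookup (y' (fst q, 0)) (chi (snd q))) (ground q))
    \<in> kchain n (sf_module n P) (Suc p) j" (is "y' - ?s \<in> _") unfolding j_def .
  \<comment> \<open>A circuit that satisfies \<open>P0\<close> contains \<open>T0\<close>, hence equals it by cardinality.\<close>
  have only: "q = (?W - T0, T0) \<and> T0 \<subseteq> ?W" if q: "q \<in> free_pairs p" and nz: "lookup (y' (fst q, 0)) (chi (snd q)) \<noteq> 0" for q
  proof -
    obtain H S where HS: "q = (H, S)" by (cases q)
    have S: "S \<in> circuits" using q HS by (simp add: free_pairs_def)
    note c = coeff[OF nz[unfolded HS fst_conv snd_conv], unfolded keys_chi[OF circuitsD(4)[OF S]]]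
    have "T0 \<subseteq> S" using c circuitsD(3)[OF S] by (simp add: P0_def)
    then have "T0 = S" using circuitsD(2)[OF S] circuitsD(2)[OF T0] circuitsD(4)[OF S] by (intro card_subset_eq) auto
    then show ?thesis using c HS by blast
  qed
  define c where "c = (if (?W - T0, T0) \<in> free_pairs p \<and> T0 \<subseteq> ?W then lookup (y' (?W - T0, 0)) (chi T0) else 0)"
  have "?s = (\<Sum>q\<in>free_pairs p. if q = (?W - T0, T0) then fsc c (ground (?W - T0, T0)) else 0)"
  proof (rule sum.cong[OF refl])
    fix q assume q: "q \<in> free_pairs p"
    show "fsc (lookup (y' (fst q, 0)) (chi (snd q))) (ground q) = (if q = (?W - T0, T0) then fsc c (ground (?W - T0, T0)) else 0)"
    proof (cases "lookup (y' (fst q, 0)) (chi (snd q)) = 0")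
      case True
      then have "q = (?W - T0, T0) \<Longrightarrow> c = 0" by (simp add: c_def)
      moreover have "fsc 0 v = 0" for v :: "nat set \<times> nat \<Rightarrow> 'k mpoly" by (rule fs.scale_zero_left)
      ultimately show ?thesis unfolding True by auto
    next
      case False
      then show ?thesis using only[OF q False] q by (simp add: c_def)
    qed
  qed
  also have "\<dots> = (if (?W - T0, T0) \<in> free_pairs p then fsc c (ground (?W - T0, T0)) else 0)"
    by (rule sum.delta[OF finite_free_pairs])
  also have "\<dots> = fsc c (ground (?W - T0, T0))"
    using fs.scale_zero_left[of "ground (?W - T0, T0)"] by (simp add: c_def)
  finally have s: "?s = fsc c (ground (?W - T0, T0))" .
  have "koszul_diff n (y' - ?s) = koszul_diff n ?e - fsc c (koszul_diff n (ground (?W - T0, T0)))"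
    unfolding s flinear_diff[OF flinear_koszul_diff] flinear_scale[OF flinear_koszul_diff] dy' by (rule refl)
  moreover have "koszul_diff n (y' - ?s) \<in> kbd n (sf_module n P) p j" using yP unfolding kbd_def by blast
  ultimately have "koszul_diff n ?e - fsc c (koszul_diff n (ground (?W - T0, T0))) \<in> kbd n (sf_module n P) p j" by simp
  moreover have "\<not> T0 \<subseteq> ?W \<longrightarrow> c = 0" by (simp add: c_def)
  ultimately show ?thesis by blast
qed

text \<open>The boundaries of the chains \<open>x\<^sub>T e\<^sub>G\<close> span the homology: contract a cycle and split off the terms outside the
ideal.\<close>

lemma kcyc_in_ground_span:
  fixes V :: "(nat set \<times> nat \<Rightarrow> 'k::field mpoly) set"
  assumes V: "fs.subspace V" "kbd n (sf_module n P) p (int (p + d + 1)) \<subseteq> V"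
    and g: "\<And>q. q \<in> free_pairs p \<Longrightarrow> koszul_diff n (ground q) \<in> V"
  shows "kcyc n (sf_module n P) p (int (p + d + 1)) \<subseteq> V"
proof
  fix z :: "nat set \<times> nat \<Rightarrow> 'k mpoly" assume z: "z \<in> kcyc n (sf_module n P) p (int (p + d + 1))"
  define y where "y = contraction n repeated_var z"
  have dy: "koszul_diff n y = z" unfolding y_def by (rule contraction_cycle(1)[OF z]) simp
  let ?s = "\<Sum>q\<in>free_pairs p. fsc (lookup (y (fst q, 0)) (chi (snd q))) (ground q)"
  have "y - ?s \<in> kchain n (sf_module n P) (Suc p) (int (p + d + 1))"
  proof (rule ground_decomposition)
    fix G i u assume "lookup (y (G, i)) u \<noteq> 0"
    from contraction_cycle(2)[OF z _ this[unfolded y_def]]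
    show "G \<subseteq> {1..n} \<and> card G = Suc p \<and> i = 0 \<and> u \<in> monoms n (int d) \<and> (P (keys u) \<or> u = chi (keys u) \<and> G \<inter> keys u = {})"
      by simp
  qed
  then have "koszul_diff n (y - ?s) \<in> V" using V(2) unfolding kbd_def by blast
  moreover have "koszul_diff n (y - ?s) = z - (\<Sum>q\<in>free_pairs p. fsc (lookup (y (fst q, 0)) (chi (snd q))) (koszul_diff n (ground q)))"
    unfolding flinear_diff[OF flinear_koszul_diff] flinear_sum[OF flinear_koszul_diff] flinear_scale[OF flinear_koszul_diff] dy
    by (rule refl)
  moreover have s: "(\<Sum>q\<in>free_pairs p. fsc (lookup (y (fst q, 0)) (chi (snd q))) (koszul_diff n (ground q))) \<in> V"
    by (intro fs.subspace_sum[OF V(1)] fs.subspace_scale[OF V(1)] g)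
  ultimately have "z - (\<Sum>q\<in>free_pairs p. fsc (lookup (y (fst q, 0)) (chi (snd q))) (koszul_diff n (ground q))) \<in> V" by simp
  from fs.subspace_add[OF V(1) this s] show "z \<in> V" by simp
qed

lemma kos_zero_iff: "kos n (sf_module n P :: int \<Rightarrow> (nat \<Rightarrow> 'k::field mpoly) set) p j = 0 \<longleftrightarrow> kcyc n (sf_module n P) p j \<subseteq> (kbd n (sf_module n P) p j :: (_ \<Rightarrow> 'k mpoly) set)"
proof
  assume "kos n (sf_module n P :: int \<Rightarrow> (nat \<Rightarrow> 'k mpoly) set) p j = 0"
  then have "kbd n (sf_module n P) p j = (kcyc n (sf_module n P) p j :: (_ \<Rightarrow> 'k mpoly) set)"
    by (intro fs.subspace_eq_if_dim_le fin_dim_kcyc subspace_kcyc subspace_kbd kbd_subset_kcyc graded_module_sf)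
       (simp add: kos_def)
  then show "kcyc n (sf_module n P) p j \<subseteq> (kbd n (sf_module n P) p j :: (_ \<Rightarrow> 'k mpoly) set)" by simp
next
  assume "kcyc n (sf_module n P) p j \<subseteq> (kbd n (sf_module n P) p j :: (_ \<Rightarrow> 'k mpoly) set)"
  then have "kcyc n (sf_module n P) p j = (kbd n (sf_module n P) p j :: (_ \<Rightarrow> 'k mpoly) set)"
    using kbd_subset_kcyc[OF graded_module_sf] by blast
  then show "kos n (sf_module n P :: int \<Rightarrow> (nat \<Rightarrow> 'k mpoly) set) p j = 0" by (simp add: kos_def)
qed

text \<open>If \<open>G \<union> T\<close> is not all of \<open>{1..n}\<close>, some circuit is not contained in it, and the exchange lemma for this
circuit makes the class of \<open>\<partial> (x\<^sub>T e\<^sub>G)\<close> vanish. If \<open>G \<union> T = {1..n}\<close>, the exchange lemma for a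
fixed circuit \<open>T\<^sub>0\<close> makes every class a multiple of one class.\<close>

lemma upper_strand:
  assumes cover: "\<Union>circuits = {1..n}"
    and ex: "\<And>T. T \<in> circuits \<Longrightarrow> kos n (sf_module n (\<lambda>\<sigma>. P \<sigma> \<or> T \<subseteq> \<sigma>) :: int \<Rightarrow> (nat \<Rightarrow> 'k::field mpoly) set) p (int (p + d + 1)) = 0"
  shows "p + d + 1 \<noteq> n \<Longrightarrow> kos n (sf_module n P :: int \<Rightarrow> (nat \<Rightarrow> 'k mpoly) set) p (int (p + d + 1)) = 0"
    and "kos n (sf_module n P :: int \<Rightarrow> (nat \<Rightarrow> 'k mpoly) set) p (int (p + d + 1)) \<le> 1"
proof -
  let ?j = "int (p + d + 1)"
  let ?B = "kbd n (sf_module n P) p ?j :: (_ \<Rightarrow> 'k mpoly) set"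
  note sB = subspace_kbd[OF graded_module_sf, of p ?j]
  have ex': "kcyc n (sf_module n (\<lambda>\<sigma>. P \<sigma> \<or> T \<subseteq> \<sigma>)) p ?j \<subseteq> (kbd n (sf_module n (\<lambda>\<sigma>. P \<sigma> \<or> T \<subseteq> \<sigma>)) p ?j :: (_ \<Rightarrow> 'k mpoly) set)"
    if T: "T \<in> circuits" for T
  proof -
    interpret S: sf_complex n d "\<lambda>\<sigma>. P \<sigma> \<or> T \<subseteq> \<sigma>"
    proof
      fix \<sigma> \<tau> :: "nat set"
      show "P \<sigma> \<or> T \<subseteq> \<sigma> \<Longrightarrow> \<sigma> \<subseteq> \<tau> \<Longrightarrow> P \<tau> \<or> T \<subseteq> \<tau>" using mono by blast
      show "\<sigma> \<subseteq> {1..n} \<Longrightarrow> d < card \<sigma> \<Longrightarrow> P \<sigma> \<or> T \<subseteq> \<sigma>" using big by blast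
      assume s: "\<sigma> \<subseteq> {1..n}" "card \<sigma> < d"
      have "\<not> T \<subseteq> \<sigma>"
      proof
        assume "T \<subseteq> \<sigma>"
        moreover have "finite \<sigma>" using s(1) by (rule finite_subset) simp
        ultimately have "card T \<le> card \<sigma>" by (intro card_mono)
        then show False using s(2) circuitsD(2)[OF T] by simp
      qed
      then show "\<not> (P \<sigma> \<or> T \<subseteq> \<sigma>)" using small s by blast
    qed
    show ?thesis using S.kos_zero_iff[of p ?j, where 'k='k] ex[OF T] by blast
  qed
  have card_pair: "card (G \<union> T) = p + d + 1 \<and> G \<union> T \<subseteq> {1..n}" if "(G, T) \<in> free_pairs p" for G T
  proof -
    have "G \<subseteq> {1..n}" "card G = Suc p" "T \<in> circuits" "G \<inter> T = {}" using that by (auto simp: free_pairs_def)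
    moreover have "finite G" using \<open>G \<subseteq> {1..n}\<close> by (rule finite_subset) simp
    ultimately show ?thesis using circuitsD[of T] by (simp add: card_Un_disjoint)
  qed
  have zero: "kos n (sf_module n P :: int \<Rightarrow> (nat \<Rightarrow> 'k mpoly) set) p ?j = 0" if ne: "p + d + 1 \<noteq> n"
  proof -
    have "koszul_diff n (ground q) \<in> ?B" if q: "q \<in> free_pairs p" for q
    proof -
      obtain G T where GT: "q = (G, T)" by (cases q)
      note c = card_pair[OF q[unfolded GT]]
      have "G \<union> T \<noteq> {1..n}" using c ne by auto
      then obtain x where "x \<in> {1..n}" "x \<notin> G \<union> T" using c by blast
      then obtain T0 where T0: "T0 \<in> circuits" "\<not> T0 \<subseteq> G \<union> T" using cover by blast
      obtain a where "koszul_diff n (ground (G, T)) - fsc a (koszul_diff n (ground (G \<union> T - T0, T0))) \<in> ?B"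
        "\<not> T0 \<subseteq> G \<union> T \<longrightarrow> a = 0"
        using koszul_diff_ground_exchange[OF q[unfolded GT] T0(1) ex'[OF T0(1)]] by blast
      then show ?thesis using T0(2) by (simp add: GT)
    qed
    then have "kcyc n (sf_module n P) p ?j \<subseteq> ?B" by (intro kcyc_in_ground_span[OF sB order_refl])
    then show ?thesis using kos_zero_iff by blast
  qed
  then show "p + d + 1 \<noteq> n \<Longrightarrow> kos n (sf_module n P :: int \<Rightarrow> (nat \<Rightarrow> 'k mpoly) set) p ?j = 0" .
  show "kos n (sf_module n P :: int \<Rightarrow> (nat \<Rightarrow> 'k mpoly) set) p ?j \<le> 1"
  proof (cases "p + d + 1 = n \<and> circuits \<noteq> {}")
    case False
    then consider "p + d + 1 \<noteq> n" | "circuits = {}" by blast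
    then show ?thesis
    proof cases
      case 1
      then show ?thesis using zero by simp
    next
      case 2
      then have "free_pairs p = {}" by (auto simp: free_pairs_def)
      then have "kcyc n (sf_module n P) p ?j \<subseteq> ?B" by (intro kcyc_in_ground_span[OF sB order_refl]) simp
      then have "kos n (sf_module n P :: int \<Rightarrow> (nat \<Rightarrow> 'k mpoly) set) p ?j = 0" using kos_zero_iff by blast
      then show ?thesis by simp
    qed
  next
    case True
    then obtain T0 where T0: "T0 \<in> circuits" and n: "p + d + 1 = n" by blast
    \<comment> \<open>Modulo boundaries, \<open>w\<close> spans all cycles.\<close>
    define w where "w = (koszul_diff n (ground ({1..n} - T0, T0)) :: nat set \<times> nat \<Rightarrow> 'k mpoly)"
    obtain Bs where Bs: "Bs \<subseteq> ?B" "fs.independent Bs" "fs.span Bs = ?B" "card Bs = fs.dim ?B" "finite Bs"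
      using fs.fin_dim_basis[OF fs.fin_dim_subset[OF fin_dim_kcyc[OF graded_module_sf] kbd_subset_kcyc[OF graded_module_sf]] sB] by blast
    let ?V = "fs.span (insert w Bs)"
    have BV: "?B \<subseteq> ?V" unfolding Bs(3)[symmetric] by (rule fs.span_mono) blast
    have "koszul_diff n (ground q) \<in> ?V" if q: "q \<in> free_pairs p" for q
    proof -
      obtain G T where GT: "q = (G, T)" by (cases q)
      have W: "G \<union> T = {1..n}" using card_pair[OF q[unfolded GT]] n by (intro card_subset_eq) auto
      obtain a where "koszul_diff n (ground (G, T)) - fsc a (koszul_diff n (ground (G \<union> T - T0, T0))) \<in> ?B"
        using koszul_diff_ground_exchange[OF q[unfolded GT] T0 ex'[OF T0]] by blast
      then have 1: "koszul_diff n (ground (G, T)) - fsc a w \<in> ?V" using BV unfolding W w_def by blast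
      have 2: "fsc a w \<in> ?V" by (intro fs.span_scale fs.span_base) simp
      show ?thesis using fs.span_add[OF 1 2] by (simp add: GT)
    qed
    then have "kcyc n (sf_module n P) p ?j \<subseteq> ?V" by (intro kcyc_in_ground_span[OF fs.subspace_span BV])
    then have "fs.dim (kcyc n (sf_module n P) p ?j :: (_ \<Rightarrow> 'k mpoly) set) \<le> Suc (card Bs)"
      by (rule fs.dim_insert_le[OF Bs(5)])
    then show ?thesis unfolding kos_def Bs(4) by simp
  qed
qed

end

section \<open>Betti numbers and linearity of squarefree ideals\<close>

lemma prod_Var: "finite T \<Longrightarrow> (\<Prod>k\<in>T. Var k) = Poly_Mapping.single (chi T) (1 :: 'k::field)"
  by (induction T rule: finite_induct) (simp_all add: chi_def Var_def mult_single)

text \<open>The ideal spanned by the monomials whose support satisfies \<open>P\<close>, if \<open>P\<close> is inherited by larger sets.\<close>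

definition sf_ideal :: "nat \<Rightarrow> (nat set \<Rightarrow> bool) \<Rightarrow> 'k::field mpoly set" where
  "sf_ideal n P = {p \<in> poly_ring n. \<forall>m\<in>keys p. P (keys m)}"

lemma chi_le: "finite T \<Longrightarrow> T \<subseteq> keys m \<Longrightarrow> chi T + (m - chi T) = m"
  by (rule poly_mapping_eqI) (auto simp: lookup_add lookup_minus lookup_chi in_keys_iff)

text \<open>A monomial is divisible by a squarefree generator iff its support contains the support of the generator; summands with the same generator
are collected to obtain the required coefficients.\<close>

lemma circuit_ideal_eq:
  "circuit_ideal n d C = (sf_ideal n (\<lambda>\<sigma>. \<exists>T\<in>clutter_complement n d C. T \<subseteq> \<sigma>) :: 'k::field mpoly set)"
proof
  let ?N = "clutter_complement n d C"
  let ?X = "\<lambda>T. \<Prod>k\<in>T. Var k :: 'k mpoly"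
  have N: "T \<subseteq> {1..n}" "finite T" if "T \<in> ?N" for T
    using that finite_subset[of T "{1..n}"] by (auto simp: clutter_complement_def d_subsets_def)
  have X: "?X T = Poly_Mapping.single (chi T) 1" if "T \<in> ?N" for T using prod_Var N(2)[OF that] by blast
  show "circuit_ideal n d C \<subseteq> (sf_ideal n (\<lambda>\<sigma>. \<exists>T\<in>?N. T \<subseteq> \<sigma>) :: 'k mpoly set)"
  proof
    fix p :: "'k mpoly" assume "p \<in> circuit_ideal n d C"
    then obtain B q where p: "p = (\<Sum>a\<in>B. q a * a)" and B: "B \<subseteq> ?X ` ?N" "\<forall>a\<in>B. q a \<in> poly_ring n"
      unfolding circuit_ideal_def ideal_gen_def by blast
    have term_keys: "keys m \<subseteq> {1..n} \<and> (\<exists>T\<in>?N. T \<subseteq> keys m)" if a: "a \<in> B" and m: "m \<in> keys (q a * a)" for a m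
    proof -
      obtain T where T: "T \<in> ?N" "a = ?X T" using a B(1) by blast
      have "keys a = {chi T}" unfolding T(2) X[OF T(1)] by simp
      then obtain s where s: "s \<in> keys (q a)" "m = s + chi T" using m keys_mult[of "q a" a] by auto
      have "keys s \<subseteq> {1..n}" using B(2) a s(1) by (auto simp: poly_ring_def)
      then show ?thesis using T(1) N[OF T(1)] unfolding s(2) keys_add_nat keys_chi[OF N(2)[OF T(1)]] by blast
    qed
    have "\<exists>a\<in>B. m \<in> keys (q a * a)" if "m \<in> keys p" for m
    proof (rule ccontr)
      assume "\<not> (\<exists>a\<in>B. m \<in> keys (q a * a))"
      then have "lookup p m = 0" unfolding p lookup_sum by (intro sum.neutral) (simp add: in_keys_iff)
      then show False using that by (simp add: in_keys_iff)
    qed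
    then show "p \<in> sf_ideal n (\<lambda>\<sigma>. \<exists>T\<in>?N. T \<subseteq> \<sigma>)"
      using term_keys unfolding sf_ideal_def poly_ring_def by blast
  qed
  show "(sf_ideal n (\<lambda>\<sigma>. \<exists>T\<in>?N. T \<subseteq> \<sigma>) :: 'k mpoly set) \<subseteq> circuit_ideal n d C"
  proof
    fix p :: "'k mpoly" assume p: "p \<in> sf_ideal n (\<lambda>\<sigma>. \<exists>T\<in>?N. T \<subseteq> \<sigma>)"
    then have "\<forall>m\<in>keys p. \<exists>T. T \<in> ?N \<and> T \<subseteq> keys m" unfolding sf_ideal_def by blast
    then obtain \<tau> where \<tau>: "\<And>m. m \<in> keys p \<Longrightarrow> \<tau> m \<in> ?N" "\<And>m. m \<in> keys p \<Longrightarrow> \<tau> m \<subseteq> keys m" by metis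
    define B where "B = (\<lambda>m. ?X (\<tau> m)) ` keys p"
    define q where "q a = (\<Sum>m\<in>{m \<in> keys p. ?X (\<tau> m) = a}. Poly_Mapping.single (m - chi (\<tau> m)) (lookup p m))" for a
    have "Poly_Mapping.single m (lookup p m) = Poly_Mapping.single (m - chi (\<tau> m)) (lookup p m) * ?X (\<tau> m)"
      if m: "m \<in> keys p" for m
      using chi_le[OF N(2)[OF \<tau>(1)[OF m]] \<tau>(2)[OF m]] unfolding X[OF \<tau>(1)[OF m]] mult_single by (simp add: add.commute)
    then have "p = (\<Sum>m\<in>keys p. Poly_Mapping.single (m - chi (\<tau> m)) (lookup p m) * ?X (\<tau> m))"
      using mpoly_as_sum[of p] by simp
    also have "\<dots> = (\<Sum>a\<in>B. \<Sum>m\<in>{m \<in> keys p. ?X (\<tau> m) = a}. Poly_Mapping.single (m - chi (\<tau> m)) (lookup p m) * ?X (\<tau> m))"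
      unfolding B_def by (rule sum.image_gen) simp
    also have "\<dots> = (\<Sum>a\<in>B. q a * a)"
      unfolding q_def sum_distrib_right by (intro sum.cong refl) simp
    finally have "p = (\<Sum>a\<in>B. q a * a)" .
    moreover have "finite B" "B \<subseteq> ?X ` ?N" using \<tau>(1) by (auto simp: B_def)
    moreover have "q a \<in> poly_ring n" for a
      unfolding q_def
    proof (rule poly_ring_sum)
      fix m assume "m \<in> {m \<in> keys p. ?X (\<tau> m) = a}"
      then have "keys m \<subseteq> {1..n}" using p by (auto simp: sf_ideal_def poly_ring_def)
      moreover have "keys (m - chi (\<tau> m)) \<subseteq> keys m" by (auto simp: in_keys_iff lookup_minus)
      ultimately show "Poly_Mapping.single (m - chi (\<tau> m)) (lookup p m) \<in> poly_ring n"
        by (auto simp: poly_ring_def split: if_splits)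
    qed
    ultimately show "p \<in> circuit_ideal n d C" unfolding circuit_ideal_def ideal_gen_def by blast
  qed
qed

lemma ideal_part_sf: "ideal_part n (sf_ideal n P) = sf_module n P"
proof (rule ext)
  fix e
  show "ideal_part n (sf_ideal n P) e = (sf_module n P e :: (nat \<Rightarrow> 'a mpoly) set)"
  proof
    show "ideal_part n (sf_ideal n P) e \<subseteq> (sf_module n P e :: (nat \<Rightarrow> 'a mpoly) set)"
    proof
      fix v :: "nat \<Rightarrow> 'a mpoly" assume v: "v \<in> ideal_part n (sf_ideal n P) e"
      show "v \<in> sf_module n P e" unfolding supp_space_iff
      proof (intro allI impI)
        fix i m assume nz: "lookup (v i) m \<noteq> 0"
        then have "(i, m) \<in> free_monoms n [0] e" using v unfolding ideal_part_def gfree_def supp_space_iff by blast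
        then have i: "i = 0" "m \<in> monoms n e" by (auto simp: free_monoms_def)
        then have "P (keys m)" using v nz by (simp add: ideal_part_def sf_ideal_def in_keys_iff)
        then show "(i, m) \<in> sf_monoms n P e" using i by (simp add: sf_monoms_def)
      qed
    qed
    show "(sf_module n P e :: (nat \<Rightarrow> 'a mpoly) set) \<subseteq> ideal_part n (sf_ideal n P) e"
    proof
      fix v :: "nat \<Rightarrow> 'a mpoly" assume v: "v \<in> sf_module n P e"
      have m: "i = 0 \<and> m \<in> monoms n e \<and> P (keys m)" if "lookup (v i) m \<noteq> 0" for i m
        using v that unfolding supp_space_iff sf_monoms_def by blast
      have "v \<in> gfree n [0] e" unfolding gfree_def supp_space_iff
      proof (intro allI impI)
        fix i u assume "lookup (v i) u \<noteq> 0"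
        from m[OF this] show "(i, u) \<in> free_monoms n [0] e" by (simp add: free_monoms_def)
      qed
      moreover have "v 0 \<in> sf_ideal n P"
        using m unfolding sf_ideal_def poly_ring_def monoms_def by (auto simp: in_keys_iff)
      ultimately show "v \<in> ideal_part n (sf_ideal n P) e" by (simp add: ideal_part_def)
    qed
  qed
qed

context sf_complex
begin

lemma homogeneous_sf_ideal: "homogeneous_ideal n (sf_ideal n P)"
  unfolding homogeneous_ideal_def
proof (intro conjI ballI allI)
  fix p q :: "'a mpoly" assume p: "p \<in> sf_ideal n P"
  show "pcomp e p \<in> sf_ideal n P" for e
    using p by (auto simp: sf_ideal_def poly_ring_def in_keys_iff lookup_pcomp split: if_splits)
  show "p + q \<in> sf_ideal n P" if "q \<in> sf_ideal n P"
    using p that keys_add[of p q] poly_ring_add[of p n q] unfolding sf_ideal_def by blast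
  show "q * p \<in> sf_ideal n P" if q: "q \<in> poly_ring n"
  proof -
    have "P (keys m)" if m: "m \<in> keys (q * p)" for m
    proof -
      obtain a b where "m = a + b" "b \<in> keys p" using m keys_mult[of q p] by blast
      then show ?thesis using p mono[of "keys b" "keys m"] by (auto simp: sf_ideal_def keys_add_nat)
    qed
    then show ?thesis using p q poly_ring_mult[of q n p] by (simp add: sf_ideal_def)
  qed
qed (auto simp: sf_ideal_def)

abbreviation beta :: "'k::field itself \<Rightarrow> nat \<Rightarrow> int \<Rightarrow> nat" where
  "beta K p j \<equiv> kos n (sf_module n P :: int \<Rightarrow> (nat \<Rightarrow> 'k mpoly) set) p j"

lemma beta_nonzero: "beta TYPE('k::field) p j \<noteq> 0 \<Longrightarrow> j = int (p + d) \<or> j = int (p + d + 1)"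
  using kos_small[of j p, where 'k='k] kos_large[where p=p and j=j and 'k='k] by linarith

lemma minimal_resolution_sf:
  assumes "\<And>i j. count_list (sh i) j = beta TYPE('k::field) i j"
  shows "\<exists>D. minimal_graded_free_resolution n (sf_ideal n P :: 'k mpoly set) sh D"
  by (rule minimal_resolution_exists[OF homogeneous_sf_ideal]) (simp add: assms ideal_part_sf)

text \<open>The Betti numbers are computed from an arbitrary resolution, so a resolution has to exist. The one constructed has, by
\<open>beta_nonzero\<close>, at most two different shifts in each homological degree.\<close>

lemma betti_sf: "betti n (sf_ideal n P :: 'k::field mpoly set) i j = beta TYPE('k) i j"
proof -
  define sh where "sh i = replicate (beta TYPE('k) i (int (i + d))) (int (i + d)) @
      replicate (beta TYPE('k) i (int (i + d + 1))) (int (i + d + 1))" for i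
  have "count_list (sh i) j = beta TYPE('k) i j" for i j
    unfolding sh_def using beta_nonzero[of i j, where 'k='k]
    by (auto simp: count_list_replicate)
  from minimal_resolution_sf[OF this] obtain D where "minimal_graded_free_resolution n (sf_ideal n P :: 'k mpoly set) sh D" by blast
  then have "graded_free_resolution n (sf_ideal n P :: 'k mpoly set) sh D" by (simp add: minimal_graded_free_resolution_def)
  from betti_eq_kos[OF this] show ?thesis by (simp add: ideal_part_sf)
qed

lemma sf_monoms_degree_d: "sf_monoms n P (int d) = (\<lambda>T. (0, chi T)) ` {T. T \<subseteq> {1..n} \<and> card T = d \<and> P T}"
proof
  show "sf_monoms n P (int d) \<subseteq> (\<lambda>T. (0, chi T)) ` {T. T \<subseteq> {1..n} \<and> card T = d \<and> P T}"
  proof clarify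
    fix i m assume "(i, m) \<in> sf_monoms n P (int d)"
    then have m: "i = 0" "keys m \<subseteq> {1..n}" "total_deg m = d" "P (keys m)" by (auto simp: sf_monoms_def monoms_def)
    have "card (keys m) = d" using small[OF m(2)] m(3,4) card_keys_le[of m] by linarith
    moreover from this have "m = chi (keys m)" using m(3) by (intro squarefree_of_card) simp
    ultimately show "(i, m) \<in> (\<lambda>T. (0, chi T)) ` {T. T \<subseteq> {1..n} \<and> card T = d \<and> P T}"
      using m by (intro image_eqI[of _ _ "keys m"]) auto
  qed
  show "(\<lambda>T. (0, chi T)) ` {T. T \<subseteq> {1..n} \<and> card T = d \<and> P T} \<subseteq> sf_monoms n P (int d)"
  proof clarify
    fix T assume T: "T \<subseteq> {1..n}" "P T" "d = card T"
    have "finite T" using T(1) by (rule finite_subset) simp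
    then show "(0, chi T) \<in> sf_monoms n P (int (card T))"
      using T by (simp add: sf_monoms_def monoms_def keys_chi total_deg_chi)
  qed
qed

lemma card_sf_monoms_degree_d: "card (sf_monoms n P (int d)) = card {T. T \<subseteq> {1..n} \<and> card T = d \<and> P T}"
proof -
  have "inj_on (\<lambda>T. (0 :: nat, chi T)) {T. T \<subseteq> {1..n} \<and> card T = d \<and> P T}"
  proof (rule inj_onI)
    fix S T assume S: "S \<in> {T. T \<subseteq> {1..n} \<and> card T = d \<and> P T}" and T: "T \<in> {T. T \<subseteq> {1..n} \<and> card T = d \<and> P T}"
      and e: "(0 :: nat, chi S) = (0, chi T)"
    have "finite S" by (rule finite_subset[of S "{1..n}"]) (use S in blast, rule finite_atLeastAtMost)
    then have "S = keys (chi S)" by (rule keys_chi[symmetric])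
    also have "chi S = chi T" using e by blast
    also have "finite T" by (rule finite_subset[of T "{1..n}"]) (use T in blast, rule finite_atLeastAtMost)
    then have "keys (chi T) = T" by (rule keys_chi)
    finally show "S = T" .
  qed
  then show ?thesis unfolding sf_monoms_degree_d by (rule card_image)
qed

lemma beta_0: "beta TYPE('k::field) 0 (int d) = card {T. T \<subseteq> {1..n} \<and> card T = d \<and> P T}"
proof -
  have "kbd n (sf_module n P) 0 (int d) = {0 :: _ \<Rightarrow> 'k mpoly}"
    unfolding kbd_def using kchain_small[of "int d" "Suc 0", where 'k='k] flinear_0[OF flinear_koszul_diff] by simp
  moreover have "fs.dim (kcyc n (sf_module n P) 0 (int d) :: (_ \<Rightarrow> 'k mpoly) set) = card (sf_monoms n P (int d))"
    unfolding kcyc_0 using dim_kchain_supp_space[of "sf_monoms n P" "int d" 0 n, where 'k='k] finite_sf_monoms by simp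
  ultimately show ?thesis by (simp add: kos_def card_sf_monoms_degree_d)
qed

lemma sf_ideal_hom_part: "(sf_ideal n P :: 'k::field mpoly set) \<inter> hom_part n e = {p. keys p \<subseteq> {m \<in> monoms n e. P (keys m)}}"
  by (auto simp: sf_ideal_def hom_part_def poly_ring_def monoms_def)

text \<open>The regularity is at least \<open>d\<close> because of the generators in degree \<open>d\<close>, and only the upper strand can make it
larger.\<close>

lemma linear_iff:
  assumes ne: "\<exists>T. T \<subseteq> {1..n} \<and> card T = d \<and> P T"
  shows "has_linear_resolution n d (sf_ideal n P :: 'k::field mpoly set) \<longleftrightarrow>
    (\<forall>p. beta TYPE('k) p (int (p + d + 1)) = 0)"
proof -
  let ?I = "sf_ideal n P :: 'k mpoly set"
  obtain T where T: "T \<subseteq> {1..n}" "card T = d" "P T" using ne by blast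
  have fT: "finite T" using T(1) by (rule finite_subset) simp
  have xT: "Poly_Mapping.single (chi T) 1 \<in> ?I \<inter> hom_part n (int d)"
    unfolding sf_ideal_hom_part using T fT by (simp add: monoms_def keys_chi total_deg_chi)
  have x0: "Poly_Mapping.single (chi T) 1 \<noteq> (0 :: 'k mpoly)"
    by (metis lookup_single_eq lookup_zero zero_neq_one)
  have nz: "?I \<noteq> {0}" using xT x0 by blast
  have "{t. ?I \<inter> hom_part n (int t) \<noteq> {0}} \<subseteq> {d..}"
  proof
    fix t assume t: "t \<in> {t. ?I \<inter> hom_part n (int t) \<noteq> {0}}"
    show "t \<in> {d..}"
    proof (rule ccontr)
      assume "t \<notin> {d..}"
      then have e: "sf_monoms n P (int t) = {}" by (intro sf_monoms_small) simp
      have "{m \<in> monoms n (int t). P (keys m)} = {}" using e by (auto simp: sf_monoms_def)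
      then have "?I \<inter> hom_part n (int t) = {p. keys p \<subseteq> {}}" unfolding sf_ideal_hom_part by (simp only:)
      moreover have "{p :: 'k mpoly. keys p \<subseteq> {}} = {0}" by auto
      ultimately show False using t by simp
    qed
  qed
  moreover have d_in: "d \<in> {t. ?I \<inter> hom_part n (int t) \<noteq> {0}}" using xT x0 by blast
  ultimately have indeg: "indeg n ?I = d"
    unfolding indeg_def by (intro cInf_eq_minimum) auto
  let ?R = "{ereal (real_of_int j - real i) | i j. betti n ?I i j \<noteq> 0}"
  have "beta TYPE('k) 0 (int d) \<noteq> 0"
  proof -
    have "finite {T. T \<subseteq> {1..n} \<and> card T = d \<and> P T}" by (rule finite_subset[of _ "Pow {1..n}"]) auto
    then have "card {T. T \<subseteq> {1..n} \<and> card T = d \<and> P T} \<noteq> 0" using T by auto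
    then show ?thesis by (simp add: beta_0)
  qed
  then have "ereal (real_of_int (int d) - real 0) \<in> ?R" unfolding betti_sf by blast
  then have d_R: "ereal (real d) \<in> ?R" by simp
  have "reg n ?I = ereal (real d) \<longleftrightarrow> (\<forall>p. beta TYPE('k) p (int (p + d + 1)) = 0)"
  proof
    assume reg: "reg n ?I = ereal (real d)"
    show "\<forall>p. beta TYPE('k) p (int (p + d + 1)) = 0"
    proof (rule allI, rule ccontr)
      fix p assume "beta TYPE('k) p (int (p + d + 1)) \<noteq> 0"
      then have "ereal (real_of_int (int (p + d + 1)) - real p) \<in> ?R" unfolding betti_sf by blast
      then have "ereal (real_of_int (int (p + d + 1)) - real p) \<le> reg n ?I" unfolding reg_def by (rule Sup_upper)
      then show False unfolding reg by simp
    qed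
  next
    assume z: "\<forall>p. beta TYPE('k) p (int (p + d + 1)) = 0"
    have "r \<le> ereal (real d)" if r: "r \<in> ?R" for r
    proof -
      obtain i j where r: "r = ereal (real_of_int j - real i)" and b: "beta TYPE('k) i j \<noteq> 0" using r unfolding betti_sf by blast
      have "j \<noteq> int (i + d + 1)" using b z[rule_format, of i] by metis
      then have "j = int (i + d)" using beta_nonzero[OF b] by blast
      then show ?thesis unfolding r by simp
    qed
    then show "reg n ?I = ereal (real d)" unfolding reg_def using d_R by (intro antisym Sup_least Sup_upper)
  qed
  then show ?thesis unfolding has_linear_resolution_def using nz indeg by simp
qed

end

section \<open>Hilbert series and the lower strand\<close>

text \<open>The usual infix sign for coefficients of power series denotes the entries of vectors here.\<close>

notation fps_nth (infixl "$$$" 75)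

definition supp_monoms :: "nat set \<Rightarrow> nat \<Rightarrow> (nat \<Rightarrow>\<^sub>0 nat) set" where
  "supp_monoms \<sigma> t = {m. keys m = \<sigma> \<and> total_deg m = t}"

lemma finite_supp_monoms: assumes "\<sigma> \<subseteq> {1..n}" shows "finite (supp_monoms \<sigma> t)"
proof -
  have "supp_monoms \<sigma> t \<subseteq> monoms n (int t)" using assms by (auto simp: supp_monoms_def monoms_def)
  then show ?thesis by (rule finite_subset) simp
qed

text \<open>Dividing a monomial by \<open>x\<close> either keeps \<open>x\<close> in the support or removes it.\<close>

lemma card_supp_monoms_insert:
  assumes "insert x \<sigma> \<subseteq> {1..n}" "x \<notin> \<sigma>"
  shows "card (supp_monoms (insert x \<sigma>) (Suc t)) = card (supp_monoms (insert x \<sigma>) t) + card (supp_monoms \<sigma> t)"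
proof -
  let ?A = "supp_monoms (insert x \<sigma>) t" and ?B = "supp_monoms \<sigma> t"
  have im: "supp_monoms (insert x \<sigma>) (Suc t) = (+) (var_mon x) ` (?A \<union> ?B)"
  proof
    show "supp_monoms (insert x \<sigma>) (Suc t) \<subseteq> (+) (var_mon x) ` (?A \<union> ?B)"
    proof
      fix m assume m: "m \<in> supp_monoms (insert x \<sigma>) (Suc t)"
      then have k: "keys m = insert x \<sigma>" and dg: "total_deg m = Suc t" by (auto simp: supp_monoms_def)
      have "x \<in> keys m" using k by blast
      then have "lookup m x \<noteq> 0" unfolding in_keys_iff .
      define u where "u = m - var_mon x"
      have mu: "m = var_mon x + u" unfolding u_def by (rule minus_var_mon_add[symmetric]) fact
      have "total_deg u = t" using dg unfolding mu by simp
      have ins: "insert x (keys u) = insert x \<sigma>" using k unfolding mu keys_add_nat by simp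
      have "keys u = insert x \<sigma> \<or> keys u = \<sigma>"
      proof (cases "x \<in> keys u")
        case True
        then show ?thesis using ins insert_absorb[OF True] by blast
      next
        case False
        then have "keys u = insert x (keys u) - {x}" by blast
        also have "\<dots> = \<sigma>" unfolding ins using assms(2) by blast
        finally show ?thesis by blast
      qed
      with \<open>total_deg u = t\<close> have "u \<in> ?A \<union> ?B" unfolding supp_monoms_def by blast
      then show "m \<in> (+) (var_mon x) ` (?A \<union> ?B)" unfolding mu by (rule imageI[of u])
    qed
    show "(+) (var_mon x) ` (?A \<union> ?B) \<subseteq> supp_monoms (insert x \<sigma>) (Suc t)"
    proof
      fix m assume "m \<in> (+) (var_mon x) ` (?A \<union> ?B)"
      then obtain u where u: "m = var_mon x + u" "u \<in> ?A \<union> ?B" by (rule imageE)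
      then have ku: "keys u = insert x \<sigma> \<or> keys u = \<sigma>" and du: "total_deg u = t"
        unfolding supp_monoms_def by blast+
      have "keys m = insert x (keys u)" unfolding u(1) keys_add_nat by simp
      then have "keys m = insert x \<sigma>" using ku by blast
      moreover have "total_deg m = Suc t" unfolding u(1) total_deg_add total_deg_single du by (rule plus_1_eq_Suc[THEN fun_cong])
      ultimately show "m \<in> supp_monoms (insert x \<sigma>) (Suc t)" unfolding supp_monoms_def by blast
    qed
  qed
  have "card ((+) (var_mon x) ` (?A \<union> ?B)) = card (?A \<union> ?B)"
    by (rule card_image) (simp add: inj_on_def)
  also have "\<dots> = card ?A + card ?B"
  proof (rule card_Un_disjoint)
    show "finite ?A" by (rule finite_supp_monoms[OF assms(1)])
    show "finite ?B" by (rule finite_supp_monoms[of _ n]) (use assms(1) in blast)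
    show "?A \<inter> ?B = {}" using assms(2) by (auto simp: supp_monoms_def)
  qed
  finally show ?thesis unfolding im .
qed

text \<open>The monomials with support \<open>\<sigma>\<close> have Hilbert series \<open>(t / (1 - t))\<^sup>s\<close>, where \<open>s = card
\<sigma>\<close>.\<close>

lemma supp_monoms_series:
  assumes "\<sigma> \<subseteq> {1..n}"
  shows "Abs_fps (\<lambda>t. int (card (supp_monoms \<sigma> t))) * (1 - fps_X) ^ card \<sigma> = fps_X ^ card \<sigma>"
proof -
  have "finite \<sigma>" using assms by (rule finite_subset) simp
  then show ?thesis using assms
  proof (induction \<sigma> rule: finite_induct)
    case empty
    have "supp_monoms {} t = (if t = 0 then {0} else {})" for t by (auto simp: supp_monoms_def)
    then have "Abs_fps (\<lambda>t. int (card (supp_monoms {} t))) = 1" by (auto simp: fps_eq_iff)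
    then show ?case by simp
  next
    case (insert x \<sigma>)
    let ?F = "\<lambda>\<sigma>. Abs_fps (\<lambda>t. int (card (supp_monoms \<sigma> t)))"
    have 0: "supp_monoms (insert x \<sigma>) 0 = {}" by (auto simp: supp_monoms_def)
    have step: "?F (insert x \<sigma>) * (1 - fps_X) = fps_X * ?F \<sigma>"
    proof (rule fps_ext)
      fix t
      show "(?F (insert x \<sigma>) * (1 - fps_X)) $$$ t = (fps_X * ?F \<sigma>) $$$ t"
      proof (cases t)
        case 0
        then show ?thesis using \<open>supp_monoms (insert x \<sigma>) 0 = {}\<close> by (simp add: right_diff_distrib)
      next
        case (Suc s)
        then show ?thesis using card_supp_monoms_insert[OF insert.prems insert.hyps(2), of s]
          by (simp add: right_diff_distrib)
      qed
    qed
    have "?F (insert x \<sigma>) * (1 - fps_X) ^ card (insert x \<sigma>) = (?F (insert x \<sigma>) * (1 - fps_X)) * (1 - fps_X) ^ card \<sigma>"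
      using insert.hyps by (simp add: mult.assoc)
    also have "\<dots> = fps_X * (?F \<sigma> * (1 - fps_X) ^ card \<sigma>)" unfolding step by (rule mult.assoc)
    also have "\<dots> = fps_X * fps_X ^ card \<sigma>" using insert.IH insert.prems by simp
    finally show ?case using insert.hyps by simp
  qed
qed

lemma card_monoms_pred:
  "card {m \<in> monoms n (int t). Q (keys m)} = (\<Sum>\<sigma> | \<sigma> \<subseteq> {1..n} \<and> Q \<sigma>. card (supp_monoms \<sigma> t))"
proof -
  have fin: "finite {\<sigma>. \<sigma> \<subseteq> {1..n} \<and> Q \<sigma>}" by (rule finite_subset[of _ "Pow {1..n}"]) auto
  have "{m \<in> monoms n (int t). Q (keys m)} = (\<Union>\<sigma>\<in>{\<sigma>. \<sigma> \<subseteq> {1..n} \<and> Q \<sigma>}. supp_monoms \<sigma> t)"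
    by (auto simp: monoms_def supp_monoms_def)
  moreover have "card (\<Union>\<sigma>\<in>{\<sigma>. \<sigma> \<subseteq> {1..n} \<and> Q \<sigma>}. supp_monoms \<sigma> t) = (\<Sum>\<sigma> | \<sigma> \<subseteq> {1..n} \<and> Q \<sigma>. card (supp_monoms \<sigma> t))"
  proof (rule card_UN_disjoint[OF fin])
    show "\<forall>\<sigma>\<in>{\<sigma>. \<sigma> \<subseteq> {1..n} \<and> Q \<sigma>}. finite (supp_monoms \<sigma> t)"
      using finite_supp_monoms by blast
    show "\<forall>\<sigma>\<in>{\<sigma>. \<sigma> \<subseteq> {1..n} \<and> Q \<sigma>}. \<forall>\<tau>\<in>{\<sigma>. \<sigma> \<subseteq> {1..n} \<and> Q \<sigma>}. \<sigma> \<noteq> \<tau> \<longrightarrow> supp_monoms \<sigma> t \<inter> supp_monoms \<tau> t = {}"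
      by (auto simp: supp_monoms_def)
  qed
  ultimately show ?thesis by simp
qed

definition hilbert_fps :: "nat \<Rightarrow> (nat set \<Rightarrow> bool) \<Rightarrow> int fps" where
  "hilbert_fps n Q = Abs_fps (\<lambda>t. int (card {m \<in> monoms n (int t). Q (keys m)}))"

lemma hilbert_fps_times:
  assumes "\<And>\<sigma>. \<sigma> \<subseteq> {1..n} \<Longrightarrow> Q \<sigma> \<Longrightarrow> card \<sigma> \<le> N"
  shows "hilbert_fps n Q * (1 - fps_X) ^ N = (\<Sum>\<sigma> | \<sigma> \<subseteq> {1..n} \<and> Q \<sigma>. fps_X ^ card \<sigma> * (1 - fps_X) ^ (N - card \<sigma>))"
proof -
  have "hilbert_fps n Q = (\<Sum>\<sigma> | \<sigma> \<subseteq> {1..n} \<and> Q \<sigma>. Abs_fps (\<lambda>t. int (card (supp_monoms \<sigma> t))))"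
    unfolding hilbert_fps_def card_monoms_pred by (simp add: fps_eq_iff fps_sum_nth)
  then have "hilbert_fps n Q * (1 - fps_X) ^ N =
      (\<Sum>\<sigma> | \<sigma> \<subseteq> {1..n} \<and> Q \<sigma>. Abs_fps (\<lambda>t. int (card (supp_monoms \<sigma> t))) * (1 - fps_X) ^ N)"
    by (simp add: sum_distrib_right)
  also have "\<dots> = (\<Sum>\<sigma> | \<sigma> \<subseteq> {1..n} \<and> Q \<sigma>. fps_X ^ card \<sigma> * (1 - fps_X) ^ (N - card \<sigma>))"
  proof (rule sum.cong[OF refl])
    fix \<sigma> assume "\<sigma> \<in> {\<sigma>. \<sigma> \<subseteq> {1..n} \<and> Q \<sigma>}"
    then have s: "\<sigma> \<subseteq> {1..n}" "card \<sigma> \<le> N" using assms by auto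
    have "(1 - fps_X :: int fps) ^ N = (1 - fps_X) ^ card \<sigma> * (1 - fps_X) ^ (N - card \<sigma>)"
      unfolding power_add[symmetric] using s(2) by simp
    then show "Abs_fps (\<lambda>t. int (card (supp_monoms \<sigma> t))) * (1 - fps_X) ^ N = fps_X ^ card \<sigma> * (1 - fps_X) ^ (N - card \<sigma>)"
      using supp_monoms_series[OF s(1)] by (simp only: mult.assoc[symmetric])
  qed
  finally show ?thesis .
qed

lemma one_minus_X_power_nth: "((1 - fps_X :: int fps) ^ n) $$$ k = (-1) ^ k * int (n choose k)"
proof (induction n arbitrary: k)
  case 0
  then show ?case by (cases k) simp_all
next
  case (Suc n)
  show ?case
  proof (cases k)
    case 0
    then show ?thesis using Suc[of 0] by (simp add: left_diff_distrib)
  next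
    case (Suc l)
    then show ?thesis using Suc.IH[of k] Suc.IH[of l] by (simp add: left_diff_distrib algebra_simps)
  qed
qed

lemma X_power_one_minus_X_nth:
  "(fps_X ^ s * (1 - fps_X :: int fps) ^ k) $$$ j = (if j < s then 0 else (-1) ^ (j - s) * int (k choose (j - s)))"
  by (simp add: fps_X_power_mult_nth one_minus_X_power_nth)

lemma alternating_binomial_partial: "j \<ge> 1 \<Longrightarrow> (\<Sum>s\<le>m. (-1) ^ s * int (j choose s)) = (-1) ^ m * int ((j - 1) choose m)"
proof (induction m)
  case (Suc m)
  obtain i where "j = Suc i" using Suc.prems by (cases j) auto
  then show ?case using Suc by (simp add: algebra_simps)
qed simp

lemma sum_subsets_by_card:
  "(\<Sum>\<sigma> | \<sigma> \<subseteq> {1..n::nat} \<and> card \<sigma> < d. f (card \<sigma>)) = (\<Sum>s<d. of_nat (n choose s) * (f s :: 'a::comm_semiring_1))"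
proof -
  have fin: "finite {\<sigma>. \<sigma> \<subseteq> {1..n} \<and> card \<sigma> < d}" by (rule finite_subset[of _ "Pow {1..n}"]) auto
  have "(\<Sum>\<sigma> | \<sigma> \<subseteq> {1..n} \<and> card \<sigma> < d. f (card \<sigma>)) =
      (\<Sum>s<d. \<Sum>\<sigma>\<in>{\<sigma> \<in> {\<sigma>. \<sigma> \<subseteq> {1..n} \<and> card \<sigma> < d}. card \<sigma> = s}. f (card \<sigma>))"
    by (rule sum.group[symmetric, OF fin]) auto
  also have "\<dots> = (\<Sum>s<d. of_nat (n choose s) * f s)"
  proof (rule sum.cong[OF refl])
    fix s assume "s \<in> {..<d}"
    then have eq: "{\<sigma> \<in> {\<sigma>. \<sigma> \<subseteq> {1..n} \<and> card \<sigma> < d}. card \<sigma> = s} = {\<sigma>. \<sigma> \<subseteq> {1..n} \<and> card \<sigma> = s}" by auto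
    have "(\<Sum>\<sigma>\<in>{\<sigma>. \<sigma> \<subseteq> {1..n} \<and> card \<sigma> = s}. f (card \<sigma>)) = (\<Sum>\<sigma>\<in>{\<sigma>. \<sigma> \<subseteq> {1..n} \<and> card \<sigma> = s}. f s)"
      by (rule sum.cong) auto
    then show "(\<Sum>\<sigma>\<in>{\<sigma> \<in> {\<sigma>. \<sigma> \<subseteq> {1..n} \<and> card \<sigma> < d}. card \<sigma> = s}. f (card \<sigma>)) = of_nat (n choose s) * f s"
      unfolding eq using n_subsets[of "{1..n}" s] by simp
  qed
  finally show ?thesis .
qed

context sf_complex
begin

lemma faces_split: "{\<sigma>. \<sigma> \<subseteq> {1..n} \<and> \<not> P \<sigma>} = {\<sigma>. \<sigma> \<subseteq> {1..n} \<and> card \<sigma> < d} \<union> circuits"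
  using small big unfolding circuits_def by (auto simp: not_less_iff_gr_or_eq)

lemma sum_faces:
  "(\<Sum>\<sigma> | \<sigma> \<subseteq> {1..n} \<and> \<not> P \<sigma>. f (card \<sigma>)) =
    (\<Sum>s<d. of_nat (n choose s) * f s) + of_nat (card circuits) * (f d :: 'a::comm_semiring_1)"
proof -
  have fin: "finite {\<sigma>. \<sigma> \<subseteq> {1..n} \<and> card \<sigma> < d}" by (rule finite_subset[of _ "Pow {1..n}"]) auto
  have "(\<Sum>\<sigma> | \<sigma> \<subseteq> {1..n} \<and> \<not> P \<sigma>. f (card \<sigma>)) = (\<Sum>\<sigma> | \<sigma> \<subseteq> {1..n} \<and> card \<sigma> < d. f (card \<sigma>)) + (\<Sum>\<sigma>\<in>circuits. f (card \<sigma>))"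
    unfolding faces_split by (rule sum.union_disjoint[OF fin finite_circuits]) (auto simp: circuits_def)
  moreover have "(\<Sum>\<sigma>\<in>circuits. f (card \<sigma>)) = (\<Sum>\<sigma>\<in>circuits. f d)"
    by (rule sum.cong) (auto simp: circuits_def)
  ultimately show ?thesis unfolding sum_subsets_by_card by simp
qed

text \<open>By the binomial theorem the contributions of all supports add up to \<open>(t + (1 - t))\<^sup>n = 1\<close>, so those of faces and
nonfaces are complementary.\<close>

lemma hilbert_fps_complement: "hilbert_fps n P * (1 - fps_X) ^ n = 1 - hilbert_fps n (\<lambda>\<sigma>. \<not> P \<sigma>) * (1 - fps_X) ^ n"
proof -
  have le: "card \<sigma> \<le> n" if "\<sigma> \<subseteq> {1..n}" for \<sigma> :: "nat set" using card_mono[OF _ that] by simp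
  let ?g = "\<lambda>\<sigma> :: nat set. fps_X ^ card \<sigma> * (1 - fps_X :: int fps) ^ (n - card \<sigma>)"
  have fin: "finite {\<sigma>. \<sigma> \<subseteq> {1..n} \<and> R \<sigma>}" for R by (rule finite_subset[of _ "Pow {1..n}"]) auto
  have "hilbert_fps n P * (1 - fps_X) ^ n + hilbert_fps n (\<lambda>\<sigma>. \<not> P \<sigma>) * (1 - fps_X) ^ n
      = sum ?g {\<sigma>. \<sigma> \<subseteq> {1..n} \<and> P \<sigma>} + sum ?g {\<sigma>. \<sigma> \<subseteq> {1..n} \<and> \<not> P \<sigma>}"
    using hilbert_fps_times[of n P n] hilbert_fps_times[of n "\<lambda>\<sigma>. \<not> P \<sigma>" n] le by simp
  also have "\<dots> = sum ?g ({\<sigma>. \<sigma> \<subseteq> {1..n} \<and> P \<sigma>} \<union> {\<sigma>. \<sigma> \<subseteq> {1..n} \<and> \<not> P \<sigma>})"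
    by (rule sum.union_disjoint[symmetric, OF fin fin]) auto
  also have "{\<sigma>. \<sigma> \<subseteq> {1..n} \<and> P \<sigma>} \<union> {\<sigma>. \<sigma> \<subseteq> {1..n} \<and> \<not> P \<sigma>} = {\<sigma>. \<sigma> \<subseteq> {1..n} \<and> card \<sigma> < Suc n}"
    using le by (auto simp: less_Suc_eq_le)
  also have "sum ?g {\<sigma>. \<sigma> \<subseteq> {1..n} \<and> card \<sigma> < Suc n} = (\<Sum>s<Suc n. of_nat (n choose s) * (fps_X ^ s * (1 - fps_X) ^ (n - s)))"
    by (rule sum_subsets_by_card)
  also have "\<dots> = (fps_X + (1 - fps_X)) ^ n"
    unfolding binomial_ring lessThan_Suc_atMost by (simp add: mult.assoc)
  also have "\<dots> = 1" by simp
  finally show ?thesis by (simp add: eq_diff_eq)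
qed

text \<open>The dimension of the chains is a binomial coefficient times a value of the Hilbert function, so the Euler characteristic is a convolution
with the coefficients of \<open>(1 - t)\<^sup>n\<close>.\<close>

lemma euler_sum:
  "(\<Sum>p\<le>n. (-1) ^ p * int (beta TYPE('k::field) p (int j))) = (hilbert_fps n P * (1 - fps_X) ^ n) $$$ j"
proof -
  have dim: "fs.dim (kchain n (sf_module n P) p (int j) :: (_ \<Rightarrow> 'k mpoly) set) = (n choose p) * card (sf_monoms n P (int j - int p))" for p
    by (rule dim_kchain_supp_space[OF finite_sf_monoms])
  have c: "card (sf_monoms n P (int t)) = card {m \<in> monoms n (int t). P (keys m)}" for t
  proof -
    have "sf_monoms n P (int t) = Pair 0 ` {m \<in> monoms n (int t). P (keys m)}" by (auto simp: sf_monoms_def)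
    then show ?thesis by (simp add: card_image inj_on_def)
  qed
  have neg: "card (sf_monoms n P (int j - int p)) = 0" if "j < p" for p
  proof -
    have "sf_monoms n P (int j - int p) = {}" using that by (auto simp: sf_monoms_def monoms_def)
    then show ?thesis by simp
  qed
  have "(\<Sum>p\<le>n. (-1) ^ p * int (beta TYPE('k) p (int j))) = (\<Sum>p\<le>n. (-1) ^ p * int ((n choose p) * card (sf_monoms n P (int j - int p))))"
    unfolding euler_characteristic[OF graded_module_sf] dim by (rule refl)
  also have "\<dots> = (\<Sum>p\<le>n + j. (-1) ^ p * int ((n choose p) * card (sf_monoms n P (int j - int p))))"
    by (rule sum.mono_neutral_left) auto
  also have "\<dots> = (\<Sum>p\<le>j. (-1) ^ p * int ((n choose p) * card (sf_monoms n P (int j - int p))))"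
    by (rule sum.mono_neutral_right) (auto simp: neg)
  also have "\<dots> = (\<Sum>p\<le>j. ((1 - fps_X) ^ n) $$$ p * hilbert_fps n P $$$ (j - p))"
  proof (rule sum.cong[OF refl])
    fix p assume "p \<in> {..j}"
    then have e: "int j - int p = int (j - p)" by (simp add: of_nat_diff)
    show "(-1) ^ p * int ((n choose p) * card (sf_monoms n P (int j - int p))) = ((1 - fps_X) ^ n) $$$ p * hilbert_fps n P $$$ (j - p)"
      unfolding e c one_minus_X_power_nth hilbert_fps_def by (simp only: fps_nth_Abs_fps of_nat_mult mult.assoc)
  qed
  also have "\<dots> = ((1 - fps_X) ^ n * hilbert_fps n P) $$$ j"
    unfolding fps_mult_nth by (simp add: atLeast0AtMost)
  finally show ?thesis by (simp only: mult.commute)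
qed

text \<open>The complementary sum over faces is elementary: the sets with fewer than \<open>d\<close> elements give a partial alternating sum of
binomial coefficients, and the circuits give one summand each.\<close>

lemma hilbert_coefficient:
  assumes d: "1 \<le> d" "d \<le> n"
  shows "(hilbert_fps n P * (1 - fps_X) ^ n) $$$ (i + d) =
    (-1) ^ i * (int (n choose (i + d)) * int ((i + d - 1) choose (d - 1)) - int (card circuits) * int ((n - d) choose i))"
proof -
  let ?j = "i + d"
  have le: "card \<sigma> \<le> n" if "\<sigma> \<subseteq> {1..n}" for \<sigma> :: "nat set" using card_mono[OF _ that] by simp
  have "(hilbert_fps n (\<lambda>\<sigma>. \<not> P \<sigma>) * (1 - fps_X) ^ n) $$$ ?j =
      (\<Sum>\<sigma> | \<sigma> \<subseteq> {1..n} \<and> \<not> P \<sigma>. (fps_X ^ card \<sigma> * (1 - fps_X :: int fps) ^ (n - card \<sigma>)) $$$ ?j)"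
    using hilbert_fps_times[of n "\<lambda>\<sigma>. \<not> P \<sigma>" n] le by (simp add: fps_sum_nth)
  also have "\<dots> = (\<Sum>s<d. int (n choose s) * (fps_X ^ s * (1 - fps_X :: int fps) ^ (n - s)) $$$ ?j)
      + int (card circuits) * (fps_X ^ d * (1 - fps_X :: int fps) ^ (n - d)) $$$ ?j"
    by (rule sum_faces)
  also have "(\<Sum>s<d. int (n choose s) * (fps_X ^ s * (1 - fps_X :: int fps) ^ (n - s)) $$$ ?j) =
      (\<Sum>s<d. (-1) ^ ?j * int (n choose ?j) * ((-1) ^ s * int (?j choose s)))"
  proof (rule sum.cong[OF refl])
    fix s assume "s \<in> {..<d}"
    then have s: "s < d" by simp
    have "(n choose s) * ((n - s) choose (?j - s)) = (n choose ?j) * (?j choose s)"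
    proof (cases "?j \<le> n")
      case True
      then show ?thesis using choose_mult[of s ?j n] s by simp
    next
      case False
      then have a: "n - s < ?j - s" and b: "n < ?j" using s d(2) by arith+
      show ?thesis unfolding binomial_eq_0[OF a] binomial_eq_0[OF b] by simp
    qed
    then have "int (n choose s) * int ((n - s) choose (?j - s)) = int (n choose ?j) * int (?j choose s)"
      unfolding of_nat_mult[symmetric] by (rule arg_cong)
    moreover have "(-1 :: int) ^ (?j - s) = (-1) ^ ?j * (-1) ^ s"
    proof -
      have "(-1 :: int) ^ (?j - s) = (-1) ^ (?j - s) * ((-1) ^ s * (-1) ^ s)"
        by (simp add: power_mult_distrib[symmetric])
      also have "\<dots> = (-1) ^ (?j - s + s) * (-1) ^ s" by (simp only: power_add mult.assoc)
      finally show ?thesis using s by simp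
    qed
    ultimately show "int (n choose s) * (fps_X ^ s * (1 - fps_X :: int fps) ^ (n - s)) $$$ ?j =
      (-1) ^ ?j * int (n choose ?j) * ((-1) ^ s * int (?j choose s))"
      using s unfolding X_power_one_minus_X_nth by (simp add: mult.left_commute mult.assoc)
  qed
  also have "\<dots> = (-1) ^ ?j * int (n choose ?j) * (\<Sum>s\<le>d - 1. (-1) ^ s * int (?j choose s))"
  proof -
    have "{..<d} = {..d - 1}" using d by auto
    then show ?thesis by (simp add: sum_distrib_left)
  qed
  also have "(\<Sum>s\<le>d - 1. (-1) ^ s * int (?j choose s)) = (-1) ^ (d - 1) * int ((?j - 1) choose (d - 1))"
    by (rule alternating_binomial_partial) (use d in simp)
  also have "(fps_X ^ d * (1 - fps_X :: int fps) ^ (n - d)) $$$ ?j = (-1) ^ i * int ((n - d) choose i)"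
    unfolding X_power_one_minus_X_nth by simp
  finally have face: "(hilbert_fps n (\<lambda>\<sigma>. \<not> P \<sigma>) * (1 - fps_X) ^ n) $$$ ?j =
      (-1) ^ ?j * int (n choose ?j) * ((-1) ^ (d - 1) * int ((?j - 1) choose (d - 1))) + int (card circuits) * ((-1) ^ i * int ((n - d) choose i))" .
  have sign: "(-1 :: int) ^ ?j * (-1) ^ (d - 1) = - ((-1) ^ i)"
  proof -
    obtain e where e: "d = Suc e" using d(1) by (cases d) auto
    have "(-1 :: int) ^ e * (-1) ^ e = 1" by (simp add: power_mult_distrib[symmetric])
    then show ?thesis unfolding e by (simp add: power_add mult.assoc)
  qed
  have "(hilbert_fps n P * (1 - fps_X) ^ n) $$$ ?j = - ((hilbert_fps n (\<lambda>\<sigma>. \<not> P \<sigma>) * (1 - fps_X) ^ n) $$$ ?j)"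
    unfolding hilbert_fps_complement using d(1) by simp
  also have "\<dots> = - (((-1) ^ ?j * (-1) ^ (d - 1)) * (int (n choose ?j) * int ((?j - 1) choose (d - 1)))) - (-1) ^ i * (int (card circuits) * int ((n - d) choose i))"
    unfolding face by (simp add: algebra_simps)
  also have "\<dots> = (-1) ^ i * (int (n choose ?j) * int ((?j - 1) choose (d - 1)) - int (card circuits) * int ((n - d) choose i))"
    unfolding sign by (simp add: algebra_simps)
  finally show ?thesis .
qed

text \<open>In a fixed internal degree only two consecutive homological degrees carry homology, so the Euler characteristic determines one of the two
dimensions from the other.\<close>

lemma lower_strand:
  assumes d: "1 \<le> d" "d \<le> n" and i: "i \<le> n"
  shows "int (beta TYPE('k::field) i (int (i + d))) =
    int (n choose (i + d)) * int ((i + d - 1) choose (d - 1)) - int (card circuits) * int ((n - d) choose i)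
    + (if i = 0 then 0 else int (beta TYPE('k) (i - 1) (int (i + d))))"
proof -
  let ?b = "\<lambda>p. (-1) ^ p * int (beta TYPE('k) p (int (i + d)))"
  have z: "?b p = 0" if "p \<noteq> i" "Suc p \<noteq> i" for p
  proof -
    have "beta TYPE('k) p (int (i + d)) = 0"
    proof (rule ccontr)
      assume "beta TYPE('k) p (int (i + d)) \<noteq> 0"
      from beta_nonzero[OF this] show False using that by auto
    qed
    then show ?thesis by simp
  qed
  have "sum ?b {..n} = sum ?b (if i = 0 then {0} else {i - 1, i})"
  proof (rule sum.mono_neutral_right)
    show "\<forall>p\<in>{..n} - (if i = 0 then {0} else {i - 1, i}). ?b p = 0"
    proof
      fix p assume "p \<in> {..n} - (if i = 0 then {0} else {i - 1, i})"
      then have "p \<noteq> i" "Suc p \<noteq> i" by (auto split: if_splits)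
      then show "?b p = 0" by (rule z)
    qed
  qed (use i in auto)
  also have "\<dots> = ?b i + (if i = 0 then 0 else ?b (i - 1))"
    by (cases i) auto
  finally have e: "(-1) ^ i * (int (n choose (i + d)) * int ((i + d - 1) choose (d - 1)) - int (card circuits) * int ((n - d) choose i))
      = ?b i + (if i = 0 then 0 else ?b (i - 1))"
    unfolding euler_sum hilbert_coefficient[OF d] .
  show ?thesis
  proof (cases i)
    case 0
    then show ?thesis using e by simp
  next
    case (Suc k)
    have "(-1 :: int) ^ k * (-1) ^ k = 1" by (simp add: power_mult_distrib[symmetric])
    then have "(-1) ^ i * ((-1) ^ i * X) = X" "(-1) ^ i * ((-1) ^ k * Y) = - Y" for X Y :: int
      unfolding Suc by (simp_all add: mult.assoc[symmetric])
    with arg_cong[OF e, of "\<lambda>x. (-1) ^ i * x"] Suc show ?thesis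
      by (simp only: distrib_left diff_Suc_1 nat.distinct if_False)
  qed
qed

end

section \<open>Multiplicity and number of generators\<close>

text \<open>Two representations of the Hilbert series with different exponents have numerators that differ by a power of \<open>1 - t\<close>; a
positive power would vanish at \<open>1\<close>.\<close>

lemma mult_quot_eqI:
  fixes I :: "'k::field mpoly set"
  assumes ne: "\<not> poly_ring n \<subseteq> I"
    and H: "Abs_fps (\<lambda>t. int (hilbert_quot n I t)) * (1 - fps_X) ^ \<delta> = fps_of_poly Q" "poly Q 1 \<noteq> 0"
  shows "mult_quot n I = poly Q 1"
proof -
  let ?H = "Abs_fps (\<lambda>t. int (hilbert_quot n I t))"
  let ?P = "\<lambda>e. \<exists>(\<delta>::nat) (Q::int poly). ?H * (1 - fps_X) ^ \<delta> = fps_of_poly Q \<and> poly Q 1 \<noteq> 0 \<and> e = poly Q 1"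
  have le: "poly R 1 = poly R' 1"
    if "\<gamma> \<le> \<gamma>'" "?H * (1 - fps_X) ^ \<gamma> = fps_of_poly R" "?H * (1 - fps_X) ^ \<gamma>' = fps_of_poly R'" "poly R' 1 \<noteq> 0" for \<gamma> \<gamma>' R R'
  proof -
    have o: "fps_of_poly [:1, -1:] = (1 - fps_X :: int fps)" by (simp add: fps_of_poly_pCons)
    have "fps_of_poly R' = ?H * (1 - fps_X) ^ (\<gamma> + (\<gamma>' - \<gamma>))" using that by simp
    also have "\<dots> = fps_of_poly (R * [:1, -1:] ^ (\<gamma>' - \<gamma>))"
      unfolding power_add mult.assoc[symmetric] that(2) fps_of_poly_mult fps_of_poly_power o by (rule refl)
    finally have R': "R' = R * [:1, -1:] ^ (\<gamma>' - \<gamma>)" by (simp only: fps_of_poly_eq_iff)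
    have "\<gamma>' - \<gamma> = 0"
    proof (rule ccontr)
      assume "\<gamma>' - \<gamma> \<noteq> 0"
      then have "poly R' 1 = 0" unfolding R' by (simp add: poly_power)
      then show False using that(4) by blast
    qed
    then show ?thesis unfolding R' by simp
  qed
  have "(THE e. ?P e) = poly Q 1"
  proof (rule the_equality)
    show "?P (poly Q 1)" using H by blast
    fix e assume "?P e"
    then obtain \<gamma> R where R: "?H * (1 - fps_X) ^ \<gamma> = fps_of_poly R" "poly R 1 \<noteq> 0" "e = poly R 1" by blast
    show "e = poly Q 1" unfolding R(3)
      using le[OF _ R(1) H(1) H(2)] le[OF _ H(1) R(1) R(2)] by (cases "\<gamma> \<le> \<delta>") simp_all
  qed
  then show ?thesis using ne by (simp add: mult_quot_def)
qed

text \<open>As the ideal has no elements of degree below \<open>d\<close>, the components of degree \<open>d\<close> of any generators span the whole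
component of degree \<open>d\<close>, whose dimension is the number of generating monomials.\<close>

lemma minimal_generator_count:
  fixes I :: "'k::field mpoly set"
  assumes X: "finite X" "X \<subseteq> monoms n (int d)"
    and low: "\<And>p m. p \<in> I \<Longrightarrow> m \<in> keys p \<Longrightarrow> d \<le> total_deg m \<and> (total_deg m = d \<longrightarrow> m \<in> X)"
    and sub: "I \<subseteq> poly_ring n"
    and gen: "ideal_gen n ((\<lambda>m. Poly_Mapping.single m 1) ` X) = I"
  shows "min_gens n I = card X"
  unfolding min_gens_def
proof (rule Least_equality)
  let ?g = "\<lambda>m. Poly_Mapping.single m (1::'k)"
  have inj: "inj_on ?g X"
  proof (rule inj_onI)
    fix a b assume "?g a = ?g b"
    then have "keys (?g a) = keys (?g b)" by (rule arg_cong)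
    then show "a = b" by simp
  qed
  have "?g ` X \<subseteq> poly_ring n" using X(2) by (auto simp: poly_ring_def monoms_def)
  then show "\<exists>A\<subseteq>poly_ring n. finite A \<and> card A = card X \<and> ideal_gen n A = I"
    using X(1) gen card_image[OF inj] by (intro exI[of _ "?g ` X"]) simp
next
  let ?g = "\<lambda>m. Poly_Mapping.single m (1::'k)"
  fix k assume "\<exists>A\<subseteq>poly_ring n. finite A \<and> card A = k \<and> ideal_gen n A = I"
  then obtain A where A: "finite A" "card A = k" "ideal_gen n A = I" "A \<subseteq> poly_ring n" by blast
  have AI: "a \<in> I" if a: "a \<in> A" for a
  proof -
    have "a = (\<Sum>b\<in>{a}. 1 * b)" by simp
    moreover have "(1 :: 'k mpoly) \<in> poly_ring n" using const_poly_ring[of 1 n] by simp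
    ultimately show ?thesis unfolding A(3)[symmetric] ideal_gen_def using a
      by (intro CollectI exI[of _ "{a}"] exI[of _ "\<lambda>_. 1"]) simp
  qed
  let ?h = "\<lambda>p _ :: unit. pcomp (int d) (p :: 'k mpoly)"
  let ?S = "supp_space (UNIV \<times> X) :: (unit \<Rightarrow> 'k mpoly) set"
  have "?S \<subseteq> fs.span (?h ` A)"
  proof
    fix v assume v: "v \<in> ?S"
    have kv: "keys (v ()) \<subseteq> X" using v unfolding supp_space_iff by (auto simp: in_keys_iff)
    have "v () = (\<Sum>m\<in>keys (v ()). const (lookup (v ()) m) * ?g m)"
      using mpoly_as_sum[of "v ()"] by (simp add: const_def mult_single)
    moreover have "(\<Sum>m\<in>keys (v ()). const (lookup (v ()) m) * ?g m) = (\<Sum>a\<in>?g ` keys (v ()). const (lookup (v ()) (THE m. ?g m = a)) * a)"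
    proof -
      have injg: "inj_on ?g (keys (v ()))"
      proof (rule inj_onI)
        fix a b assume "?g a = ?g b"
        then have "keys (?g a) = keys (?g b)" by (rule arg_cong)
        then show "a = b" by simp
      qed
      have "(THE m'. ?g m' = ?g m) = m" for m :: "nat \<Rightarrow>\<^sub>0 nat"
      proof (rule the_equality)
        show "?g m = ?g m" by (rule refl)
        fix m' assume "?g m' = ?g m"
        then have "keys (?g m') = keys (?g m)" by (rule arg_cong)
        then show "m' = m" by simp
      qed
      then show ?thesis unfolding sum.reindex[OF injg] by simp
    qed
    ultimately have "v () \<in> I" unfolding gen[symmetric] ideal_gen_def
      using kv const_poly_ring
      by (intro CollectI exI[of _ "?g ` keys (v ())"] exI[of _ "\<lambda>a. const (lookup (v ()) (THE m. ?g m = a))"]) auto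
    then obtain B q where B: "v () = (\<Sum>a\<in>B. q a * a)" "finite B" "B \<subseteq> A" unfolding A(3)[symmetric] ideal_gen_def by blast
    have term_comp: "pcomp (int d) (q a * a) = const (lookup (q a) 0) * pcomp (int d) a" if a: "a \<in> B" for a
    proof -
      have low': "pcomp (int e) a = 0" if "e < d" for e
      proof (rule poly_mapping_eqI)
        fix m
        have "m \<notin> keys a" if "total_deg m = e"
          using low[OF AI, of a m] subsetD[OF B(3) a] \<open>e < d\<close> that by fastforce
        then show "lookup (pcomp (int e) a) m = lookup 0 m"
          by (simp add: lookup_pcomp in_keys_iff)
      qed
      have neg: "pcomp e a = 0" if "e < 0" for e
        by (rule poly_mapping_eqI) (use that in \<open>simp add: lookup_pcomp\<close>)
      have "pcomp (int d) (q a * a) = (\<Sum>m\<in>keys (q a). Poly_Mapping.single m (lookup (q a) m) * pcomp (int d - int (total_deg m)) a)"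
        by (subst mpoly_as_sum[of "q a", symmetric]) (simp only: sum_distrib_right pcomp_sum pcomp_single_mult)
      also have "\<dots> = (\<Sum>m\<in>keys (q a). if m = 0 then const (lookup (q a) 0) * pcomp (int d) a else 0)"
      proof (rule sum.cong[OF refl])
        fix m
        show "Poly_Mapping.single m (lookup (q a) m) * pcomp (int d - int (total_deg m)) a =
            (if m = 0 then const (lookup (q a) 0) * pcomp (int d) a else 0)"
        proof (cases "m = 0")
          case False
          then have pos: "0 < total_deg m" by (simp add: neq0_conv[symmetric] del: neq0_conv)
          have "pcomp (int d - int (total_deg m)) a = 0"
          proof (cases "total_deg m \<le> d")
            case True
            then have "int d - int (total_deg m) = int (d - total_deg m)" by simp
            moreover have "d - total_deg m < d" using True pos by simp
            ultimately show ?thesis using low' by metis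
          next
            case False
            then show ?thesis by (intro neg) simp
          qed
          then show ?thesis using False by simp
        qed (simp add: const_def)
      qed
      also have "\<dots> = const (lookup (q a) 0) * pcomp (int d) a"
        by (simp add: sum.delta in_keys_iff)
      finally show ?thesis .
    qed
    have "pcomp (int d) (v ()) = v ()"
    proof (rule poly_mapping_eqI)
      fix m show "lookup (pcomp (int d) (v ())) m = lookup (v ()) m"
        using kv X(2) by (auto simp: lookup_pcomp monoms_def in_keys_iff)
    qed
    then have vu: "v () = (\<Sum>a\<in>B. const (lookup (q a) 0) * pcomp (int d) a)"
      unfolding B(1) pcomp_sum using term_comp by simp
    have "v = (\<Sum>a\<in>B. fsc (lookup (q a) 0) (?h a))"
    proof (rule ext)
      fix x :: unit
      have "v x = v ()" by simp
      also note vu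
      finally show "v x = (\<Sum>a\<in>B. fsc (lookup (q a) 0) (?h a)) x" by (simp only: sum_fun_apply fsc_apply)
    qed
    moreover have "(\<Sum>a\<in>B. fsc (lookup (q a) 0) (?h a)) \<in> fs.span (?h ` A)"
      by (intro fs.span_sum fs.span_scale fs.span_base) (use B(3) in blast)
    ultimately show "v \<in> fs.span (?h ` A)" by (simp only:)
  qed
  then have "fs.dim ?S \<le> card (?h ` A)" by (rule fs.dim_le_card) (use A(1) in simp)
  also have "\<dots> \<le> card A" by (rule card_image_le[OF A(1)])
  finally show "card X \<le> k"
    using dim_supp_space[of "(UNIV :: unit set) \<times> X", where 'k='k] X(1) A(2) by (simp add: card_cartesian_product)
qed

context sf_complex
begin

lemma hilbert_quot_sf:
  "hilbert_quot n (sf_ideal n P :: 'k::field mpoly set) t = card {m \<in> monoms n (int t). \<not> P (keys m)}"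
proof -
  have 1: "dim_K (hom_part n (int t) :: 'k mpoly set) = card (monoms n (int t))"
    unfolding hom_part_eq by (rule dim_K_monomials) simp
  have 2: "dim_K ((sf_ideal n P :: 'k mpoly set) \<inter> hom_part n (int t)) = card {m \<in> monoms n (int t). P (keys m)}"
    unfolding sf_ideal_hom_part by (rule dim_K_monomials) simp
  have "card (monoms n (int t)) = card ({m \<in> monoms n (int t). P (keys m)} \<union> {m \<in> monoms n (int t). \<not> P (keys m)})"
    by (rule arg_cong[of _ _ card]) blast
  also have "\<dots> = card {m \<in> monoms n (int t). P (keys m)} + card {m \<in> monoms n (int t). \<not> P (keys m)}"
    by (rule card_Un_disjoint) auto
  finally show ?thesis unfolding hilbert_quot_def 1 2 by simp
qed

text \<open>With denominator \<open>(1 - t)\<^sup>d\<close> a face \<open>\<sigma>\<close> contributes \<open>t\<^sup>s (1 - t)\<^bsup>d -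
s\<^esup>\<close> with \<open>s = card \<sigma>\<close> to the numerator, which at \<open>1\<close> survives for \<open>s = d\<close> only.\<close>

lemma mult_quot_sf:
  assumes "1 \<le> d" "circuits \<noteq> {}"
  shows "mult_quot n (sf_ideal n P :: 'k::field mpoly set) = int (card circuits)"
proof -
  let ?Q = "\<Sum>\<sigma> | \<sigma> \<subseteq> {1..n} \<and> \<not> P \<sigma>. [:0, 1:] ^ card \<sigma> * [:1, -1 :: int:] ^ (d - card \<sigma>)"
  have o: "fps_of_poly [:1, -1:] = (1 - fps_X :: int fps)" "fps_of_poly [:0, 1:] = (fps_X :: int fps)"
    by (simp_all add: fps_of_poly_pCons)
  have le: "card \<sigma> \<le> d" if "\<sigma> \<subseteq> {1..n}" "\<not> P \<sigma>" for \<sigma> using big[of \<sigma>] that by force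
  have H: "Abs_fps (\<lambda>t. int (hilbert_quot n (sf_ideal n P :: 'k mpoly set) t)) * (1 - fps_X) ^ d = fps_of_poly ?Q"
  proof -
    have "Abs_fps (\<lambda>t. int (hilbert_quot n (sf_ideal n P :: 'k mpoly set) t)) = hilbert_fps n (\<lambda>\<sigma>. \<not> P \<sigma>)"
      unfolding hilbert_quot_sf hilbert_fps_def by (rule refl)
    then show ?thesis
      using hilbert_fps_times[of n "\<lambda>\<sigma>. \<not> P \<sigma>" d] le
      by (simp add: fps_of_poly_sum fps_of_poly_mult fps_of_poly_power o)
  qed
  have "poly ?Q 1 = (\<Sum>\<sigma> | \<sigma> \<subseteq> {1..n} \<and> \<not> P \<sigma>. if card \<sigma> = d then 1 else 0)"
    unfolding poly_sum
  proof (rule sum.cong[OF refl])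
    fix \<sigma> assume s: "\<sigma> \<in> {\<sigma>. \<sigma> \<subseteq> {1..n} \<and> \<not> P \<sigma>}"
    then have "card \<sigma> \<le> d" using le by blast
    then show "poly ([:0, 1:] ^ card \<sigma> * [:1, -1 :: int:] ^ (d - card \<sigma>)) 1 = (if card \<sigma> = d then 1 else 0)"
      by (simp add: poly_power)
  qed
  also have "\<dots> = (\<Sum>s<d. of_nat (n choose s) * (if s = d then 1 else 0)) + of_nat (card circuits) * (if d = d then 1 else 0)"
    by (rule sum_faces)
  also have "\<dots> = int (card circuits)" by simp
  finally have Q1: "poly ?Q 1 = int (card circuits)" .
  have "\<not> poly_ring n \<subseteq> (sf_ideal n P :: 'k mpoly set)"
  proof
    assume "poly_ring n \<subseteq> (sf_ideal n P :: 'k mpoly set)"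
    then have "(const 1 :: 'k mpoly) \<in> sf_ideal n P" using const_poly_ring by blast
    then have "P {}" by (simp add: sf_ideal_def)
    then show False using small[of "{}"] assms(1) by simp
  qed
  moreover have "poly ?Q 1 \<noteq> 0" unfolding Q1 using assms(2) finite_circuits by simp
  ultimately show ?thesis using mult_quot_eqI[OF _ H] Q1 by simp
qed

end

section \<open>Clutters that are minimal to linearity\<close>

abbreviation nonface :: "nat \<Rightarrow> nat \<Rightarrow> nat set set \<Rightarrow> nat set \<Rightarrow> bool" where
  "nonface n d C \<equiv> \<lambda>\<sigma>. \<exists>T\<in>clutter_complement n d C. T \<subseteq> \<sigma>"

lemma complement_memD:
  assumes "T \<in> clutter_complement n d C"
  shows "T \<subseteq> {1..n}" "card T = d" "T \<notin> C" "finite T"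
  using assms finite_subset[of T "{1..n}"] by (auto simp: clutter_complement_def d_subsets_def)

lemma clique_card_le:
  assumes dim: "complex_dim (clique_complex n d C) = int d - 1" and \<sigma>: "\<sigma> \<in> clique_complex n d C"
  shows "card \<sigma> \<le> d"
proof -
  have "finite (clique_complex n d C)"
    by (rule finite_subset[of _ "Pow {1..n}"]) (auto simp: clique_complex_def)
  then have "card \<sigma> \<le> Max (card ` clique_complex n d C)" using \<sigma> by (intro Max_ge) auto
  then show ?thesis using dim by (simp add: complex_dim_def)
qed

text \<open>Removing circuits only removes cliques, so the bound on the size of cliques passes to subclutters. This is what makes the exchange
argument applicable to the clutter without one circuit.\<close>

lemma sf_complex_clutter:
  assumes dim: "complex_dim (clique_complex n d C) = int d - 1" and sub: "C' \<subseteq> C"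
  shows "sf_complex n d (nonface n d C')"
proof
  fix \<sigma> \<tau> :: "nat set"
  show "nonface n d C' \<sigma> \<Longrightarrow> \<sigma> \<subseteq> \<tau> \<Longrightarrow> nonface n d C' \<tau>" by blast
  show "\<not> nonface n d C' \<sigma>" if s: "\<sigma> \<subseteq> {1..n}" "card \<sigma> < d"
  proof
    assume "nonface n d C' \<sigma>"
    then obtain T where T: "T \<in> clutter_complement n d C'" "T \<subseteq> \<sigma>" by blast
    have "finite \<sigma>" using s(1) by (rule finite_subset) simp
    then have "card T \<le> card \<sigma>" using T(2) by (rule card_mono)
    then show False using complement_memD(2)[OF T(1)] s(2) by simp
  qed
  show "nonface n d C' \<sigma>" if s: "\<sigma> \<subseteq> {1..n}" "d < card \<sigma>"
  proof (rule ccontr)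
    assume no: "\<not> nonface n d C' \<sigma>"
    have "\<sigma> \<in> clique_complex n d C" unfolding clique_complex_def
    proof (intro CollectI conjI allI impI)
      fix T assume T: "T \<subseteq> \<sigma>" "card T = d"
      then have "T \<in> d_subsets n d" using s(1) by (auto simp: d_subsets_def)
      then have "T \<in> C'" using no T(1) by (auto simp: clutter_complement_def)
      then show "T \<in> C" using sub by blast
    qed (rule s(1))
    from clique_card_le[OF dim this] show False using s(2) by simp
  qed
qed

lemma circuits_clutter:
  assumes "C \<subseteq> d_subsets n d" and sf: "sf_complex n d (nonface n d C)"
  shows "sf_complex.circuits n d (nonface n d C) = C"
proof -
  have mem: "T \<in> C \<longleftrightarrow> \<not> nonface n d C T" if T: "T \<subseteq> {1..n}" "card T = d" for T
  proof
    assume "T \<in> C"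
    show "\<not> nonface n d C T"
    proof
      assume "nonface n d C T"
      then obtain S where S: "S \<in> clutter_complement n d C" "S \<subseteq> T" by blast
      have "finite T" using T(1) by (rule finite_subset) simp
      then have "S = T" using S(2) complement_memD(2)[OF S(1)] T(2) by (intro card_subset_eq) auto
      then show False using complement_memD(3)[OF S(1)] \<open>T \<in> C\<close> by blast
    qed
  next
    assume no: "\<not> nonface n d C T"
    have "T \<in> d_subsets n d" using T by (simp add: d_subsets_def)
    then show "T \<in> C" using no by (auto simp: clutter_complement_def)
  qed
  show ?thesis unfolding sf_complex.circuits_def[OF sf]
  proof (intro equalityI subsetI)
    fix T assume "T \<in> {T. T \<subseteq> {1..n} \<and> card T = d \<and> \<not> nonface n d C T}"
    then show "T \<in> C" using mem[of T] by blast
  next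
    fix T assume T: "T \<in> C"
    then have "T \<subseteq> {1..n}" "card T = d" using assms(1) by (auto simp: d_subsets_def)
    then show "T \<in> {T. T \<subseteq> {1..n} \<and> card T = d \<and> \<not> nonface n d C T}" using mem T by blast
  qed
qed

lemma min_gens_circuit_ideal:
  "min_gens n (circuit_ideal n d C :: 'k::field mpoly set) = card (clutter_complement n d C)"
proof -
  let ?N = "clutter_complement n d C"
  have fin: "finite ?N"
    by (rule finite_subset[of _ "Pow {1..n}"]) (auto simp: clutter_complement_def d_subsets_def)
  have inj: "inj_on chi ?N"
  proof (rule inj_onI)
    fix S T assume "S \<in> ?N" "T \<in> ?N" and e: "chi S = chi T"
    have "S = keys (chi S)" by (rule keys_chi[symmetric]) (rule complement_memD(4)[OF \<open>S \<in> ?N\<close>])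
    also have "chi S = chi T" by (rule e)
    also have "keys (chi T) = T" by (rule keys_chi) (rule complement_memD(4)[OF \<open>T \<in> ?N\<close>])
    finally show "S = T" .
  qed
  have "min_gens n (circuit_ideal n d C :: 'k mpoly set) = card (chi ` ?N)"
  proof (rule minimal_generator_count)
    show "finite (chi ` ?N)" using fin by simp
    show "chi ` ?N \<subseteq> monoms n (int d)"
    proof clarify
      fix T assume T: "T \<in> ?N"
      note D = complement_memD[OF T]
      show "chi T \<in> monoms n (int d)" unfolding monoms_def using D by (simp add: keys_chi total_deg_chi)
    qed
    show "circuit_ideal n d C \<subseteq> (poly_ring n :: 'k mpoly set)"
      unfolding circuit_ideal_eq sf_ideal_def by blast
    have "(\<lambda>m. Poly_Mapping.single m 1) ` chi ` ?N = (\<lambda>T. \<Prod>k\<in>T. Var k :: 'k mpoly) ` ?N"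
      unfolding image_image by (rule image_cong[OF refl], rule prod_Var[symmetric], erule complement_memD(4))
    then show "ideal_gen n ((\<lambda>m. Poly_Mapping.single m 1) ` chi ` ?N) = (circuit_ideal n d C :: 'k mpoly set)"
      unfolding circuit_ideal_def by (rule arg_cong)
  next
    fix p :: "'k mpoly" and m assume p: "p \<in> circuit_ideal n d C" and m: "m \<in> keys p"
    then obtain T where T: "T \<in> ?N" "T \<subseteq> keys m" unfolding circuit_ideal_eq sf_ideal_def by blast
    have le: "d \<le> card (keys m)" using card_mono[OF finite_keys T(2)] complement_memD(2)[OF T(1)] by simp
    have "m \<in> chi ` ?N" if dm: "total_deg m = d"
    proof -
      have c: "card (keys m) = d" using le card_keys_le[of m] dm by linarith
      then have "T = keys m" using complement_memD(2)[OF T(1)] by (intro card_subset_eq[OF finite_keys T(2)]) simp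
      moreover have "m = chi (keys m)" by (rule squarefree_of_card) (simp add: c dm)
      ultimately show ?thesis using T(1) by blast
    qed
    then show "d \<le> total_deg m \<and> (total_deg m = d \<longrightarrow> m \<in> chi ` ?N)" using le card_keys_le[of m] by linarith
  qed
  then show ?thesis unfolding card_image[OF inj] .
qed

lemma card_complement:
  assumes "C \<subseteq> d_subsets n d"
  shows "int (card (clutter_complement n d C)) = int (n choose d) - int (card C)"
proof -
  have fin: "finite (d_subsets n d)" by (rule finite_subset[of _ "Pow {1..n}"]) (auto simp: d_subsets_def)
  have "card (d_subsets n d) = n choose d" unfolding d_subsets_def using n_subsets[of "{1..n}" d] by simp
  then show ?thesis unfolding clutter_complement_def
    using card_Diff_subset[OF finite_subset[OF assms fin] assms] card_mono[OF fin assms] by simp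
qed

text \<open>Removing a circuit \<open>T\<close> adds \<open>T\<close> to the generating nonfaces, and by minimality the ideal obtained has no upper
strand; this is the hypothesis of \<open>upper_strand\<close>. As the ideal of the clutter itself is not linear, its upper strand is not zero, hence
one-dimensional and in degree \<open>n\<close>.\<close>

lemma minimal_to_linearity_facts:
  fixes n d :: nat and C :: "nat set set"
  assumes min: "minimal_to_linearity TYPE('k::field) n d C" and cover: "\<Union>C = {1..n}"
  shows "sf_complex n d (nonface n d C)" "C \<noteq> {}" "1 \<le> d" "d + 1 \<le> n"
    "\<And>p. p + d + 1 \<noteq> n \<Longrightarrow> kos n (sf_module n (nonface n d C) :: int \<Rightarrow> (nat \<Rightarrow> 'k mpoly) set) p (int (p + d + 1)) = 0"
    "kos n (sf_module n (nonface n d C) :: int \<Rightarrow> (nat \<Rightarrow> 'k mpoly) set) (n - d - 1) (int n) = 1"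
proof -
  have uni: "C \<subseteq> d_subsets n d" and nonlin: "\<not> has_linear_resolution n d (circuit_ideal n d C :: 'k mpoly set)"
    and lin: "\<And>C'. C' \<subset> C \<Longrightarrow> has_linear_resolution n d (circuit_ideal n d C' :: 'k mpoly set)"
    and dim: "complex_dim (clique_complex n d C) = int d - 1"
    using min unfolding minimal_to_linearity_def uniform_clutter_def by blast+
  show sf: "sf_complex n d (nonface n d C)" by (rule sf_complex_clutter[OF dim order_refl])
  interpret sf_complex n d "nonface n d C" by (rule sf)
  have circ: "circuits = C" by (rule circuits_clutter[OF uni sf])
  have "clutter_complement n d C \<noteq> {}"
  proof
    assume e: "clutter_complement n d C = {}"
    have "(circuit_ideal n d C :: 'k mpoly set) = {0}"
    proof -
      have "p = 0" if "p \<in> (sf_ideal n (nonface n d C) :: 'k mpoly set)" for p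
      proof -
        have "keys p = {}" using that unfolding sf_ideal_def e by blast
        then show ?thesis by simp
      qed
      moreover have "0 \<in> (sf_ideal n (nonface n d C) :: 'k mpoly set)" by (simp add: sf_ideal_def)
      ultimately show ?thesis unfolding circuit_ideal_eq by blast
    qed
    then show False using nonlin by (simp add: has_linear_resolution_def)
  qed
  then obtain S where S: "S \<in> clutter_complement n d C" by blast
  have "\<exists>T. T \<subseteq> {1..n} \<and> card T = d \<and> nonface n d C T"
    using complement_memD(1,2)[OF S] S by blast
  from linear_iff[OF this, where 'k='k] nonlin
  obtain p where p: "kos n (sf_module n (nonface n d C) :: int \<Rightarrow> (nat \<Rightarrow> 'k mpoly) set) p (int (p + d + 1)) \<noteq> 0"
    unfolding circuit_ideal_eq by blast
  have ex: "kos n (sf_module n (\<lambda>\<sigma>. nonface n d C \<sigma> \<or> T \<subseteq> \<sigma>) :: int \<Rightarrow> (nat \<Rightarrow> 'k mpoly) set) q (int (q + d + 1)) = 0"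
    if T: "T \<in> circuits" for T q
  proof -
    have TC: "T \<in> C" using T unfolding circ .
    have Td: "T \<in> d_subsets n d" using TC uni by blast
    have ins: "clutter_complement n d (C - {T}) = insert T (clutter_complement n d C)"
      using Td TC unfolding clutter_complement_def by blast
    have eq: "nonface n d (C - {T}) = (\<lambda>\<sigma>. nonface n d C \<sigma> \<or> T \<subseteq> \<sigma>)" unfolding ins by auto
    have sf': "sf_complex n d (nonface n d (C - {T}))" by (rule sf_complex_clutter[OF dim]) blast
    have nf: "\<exists>U. U \<subseteq> {1..n} \<and> card U = d \<and> nonface n d (C - {T}) U"
    proof (intro exI conjI)
      show "T \<subseteq> {1..n}" "card T = d" using Td by (simp_all add: d_subsets_def)
      show "nonface n d (C - {T}) T" unfolding ins by simp
    qed
    have lr: "has_linear_resolution n d (sf_ideal n (nonface n d (C - {T})) :: 'k mpoly set)"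
    proof -
      have "C - {T} \<subset> C" using TC by blast
      then show ?thesis unfolding circuit_ideal_eq[symmetric] by (rule lin)
    qed
    have "kos n (sf_module n (nonface n d (C - {T})) :: int \<Rightarrow> (nat \<Rightarrow> 'k mpoly) set) q (int (q + d + 1)) = 0"
      using iffD1[OF sf_complex.linear_iff[OF sf' nf, where 'k='k] lr] by (rule spec)
    then show ?thesis unfolding eq .
  qed
  have cover': "\<Union>circuits = {1..n}" unfolding circ by (rule cover)
  show zero: "\<And>p. p + d + 1 \<noteq> n \<Longrightarrow> kos n (sf_module n (nonface n d C) :: int \<Rightarrow> (nat \<Rightarrow> 'k mpoly) set) p (int (p + d + 1)) = 0"
    by (rule upper_strand(1)[OF cover' ex])
  have pn: "p + d + 1 = n"
  proof (rule ccontr)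
    assume "p + d + 1 \<noteq> n"
    with p show False by (rule notE[OF _ zero])
  qed
  then show "d + 1 \<le> n" by simp
  have "kos n (sf_module n (nonface n d C) :: int \<Rightarrow> (nat \<Rightarrow> 'k mpoly) set) p (int (p + d + 1)) \<le> 1"
    by (rule upper_strand(2)[OF cover' ex])
  then have "kos n (sf_module n (nonface n d C) :: int \<Rightarrow> (nat \<Rightarrow> 'k mpoly) set) p (int (p + d + 1)) = 1" using p by linarith
  moreover have "n - d - 1 = p" using pn by simp
  ultimately show "kos n (sf_module n (nonface n d C) :: int \<Rightarrow> (nat \<Rightarrow> 'k mpoly) set) (n - d - 1) (int n) = 1"
    unfolding pn by (simp only:)
  show ne: "C \<noteq> {}" using cover pn by auto
  show "1 \<le> d"
  proof (rule ccontr)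
    assume "\<not> 1 \<le> d"
    then have d0: "d = 0" by simp
    have "T = {}" if "T \<in> C" for T
    proof -
      have "T \<subseteq> {1..n}" "card T = 0" using subsetD[OF uni that] d0 by (simp_all add: d_subsets_def)
      then show ?thesis using finite_subset[of T "{1..n}"] by simp
    qed
    then have "C \<subseteq> {{}}" by blast
    then have "\<Union>C = {}" by blast
    then show False using cover pn by simp
  qed
qed

theorem theorem5p3:
  fixes n d :: nat
    and C :: "nat set set"
    and I :: "'k::field mpoly set"
    and shifts :: "nat \<Rightarrow> int list"
  assumes "minimal_to_linearity TYPE('k) n d C"
    and "\<Union>C = {1..n}"
    and "I = circuit_ideal n d C"
    and "shifts = (\<lambda>i.
           if i + d + 1 < n then replicate (betti n I i (int (i + d))) (int (i + d))
           else if i + d + 1 = n then int n # replicate (betti n I i (int n - 1)) (int n - 1)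
           else if i + d = n then replicate (betti n I i (int n)) (int n)
           else [])"
  shows "(\<exists>D. minimal_graded_free_resolution n I shifts D)
    \<and> (\<forall>sh D. minimal_graded_free_resolution n I sh D \<longrightarrow> (\<forall>i. mset (sh i) = mset (shifts i)))
    \<and> int (betti n I (n - d) (int n)) =
        1 - mult_quot n I + (\<Sum>i<d. (-1) ^ (d + i - 1) * int (n choose i))
    \<and> (\<forall>i. i + d + 1 \<le> n \<longrightarrow>
        real (betti n I i (int (i + d))) =
          real ((n - d) choose i) *
            (real d / real (d + i) * real (n choose d) - real_of_int (mult_quot n I)))
    \<and> mult_quot n I = int (n choose d) - int (min_gens n I)"
proof -
  note min = assms(1) and cover = assms(2)
  let ?P = "nonface n d C"
  have uni: "C \<subseteq> d_subsets n d"
    using min unfolding minimal_to_linearity_def uniform_clutter_def by blast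
  note facts = minimal_to_linearity_facts[OF min cover]
  interpret sf_complex n d ?P by (rule facts(1))
  have circ: "circuits = C" by (rule circuits_clutter[OF uni facts(1)])
  note ne = facts(2) and d = facts(3) and dn = facts(4) and zero = facts(5) and top = facts(6)
  define \<beta> where "\<beta> i j = beta TYPE('k) i j" for i j
  have I: "I = sf_ideal n ?P" using assms(3) by (simp only: circuit_ideal_eq)
  have betti: "betti n I i j = \<beta> i j" for i j unfolding I \<beta>_def by (rule betti_sf)
  have mult: "mult_quot n I = int (card C)"
    unfolding I using mult_quot_sf[OF d, where 'k='k] ne unfolding circ by blast
  have nz: "\<beta> i j \<noteq> 0 \<Longrightarrow> j = int (i + d) \<or> j = int (i + d + 1)" for i j
    unfolding \<beta>_def by (rule beta_nonzero)
  have up: "\<beta> i (int (i + d + 1)) = (if i + d + 1 = n then 1 else 0)" for i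
  proof (cases "i + d + 1 = n")
    case True
    then have "n - d - 1 = i" by simp
    then show ?thesis using True top unfolding \<beta>_def by (simp only: refl if_True)
  next
    case False
    then show ?thesis using zero unfolding \<beta>_def by (simp only: if_False)
  qed
  \<comment> \<open>The last summand is the contribution of the upper strand, which by \<open>up\<close> sits in homological degree \<open>n - d - 1\<close>.\<close>
  have low: "int (\<beta> i (int (i + d))) = int (n choose (i + d)) * int ((i + d - 1) choose (d - 1)) - int (card C) * int ((n - d) choose i)
      + (if i + d = n then 1 else 0)" if i: "i \<le> n" for i
  proof -
    have "(if i = 0 then 0 else int (\<beta> (i - 1) (int (i + d)))) = (if i + d = n then 1 else 0)"
    proof (cases i)
      case 0
      then show ?thesis using dn by simp
    next
      case (Suc k)
      then show ?thesis using up[of k] by simp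
    qed
    then show ?thesis using lower_strand[OF d _ i, where 'k='k] dn unfolding \<beta>_def circ by simp
  qed
  have beyond: "\<beta> i (int (i + d)) = 0" if "n < i + d" for i
  proof (cases "i \<le> n")
    case True
    have n0: "n choose (i + d) = 0" "(n - d) choose i = 0" using that dn by (simp_all add: binomial_eq_0)
    moreover have "i + d \<noteq> n" using that by simp
    ultimately have "int (\<beta> i (int (i + d))) = 0" using low[OF True] by (simp only: if_False n0 mult_zero_left mult_zero_right of_nat_0 diff_zero add_0_right)
    then show ?thesis by (simp only: of_nat_eq_0_iff)
  next
    case False
    then show ?thesis unfolding \<beta>_def by (intro kos_gt) simp
  qed
  \<comment> \<open>Beyond the lower strand the only nonzero Betti number is the one in degree \<open>n\<close>.\<close>
  have out: "\<beta> i j = 0" if "j \<noteq> int (i + d)" "i + d + 1 = n \<longrightarrow> j \<noteq> int n" for i j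
  proof (rule ccontr)
    assume b: "\<beta> i j \<noteq> 0"
    have j: "j = int (i + d + 1)" using nz[OF b] that(1) by argo
    show False
    proof (cases "i + d + 1 = n")
      case True
      then show ?thesis using that(2) j by simp
    next
      case False
      then show ?thesis using up[of i] b unfolding j by (simp only: if_False)
    qed
  qed
  have count: "count_list (shifts i) j = \<beta> i j" for i j
  proof -
    consider "i + d + 1 < n" | "i + d + 1 = n" | "i + d = n" | "n < i + d" by linarith
    then show ?thesis
    proof cases
      case 1
      then have s: "shifts i = replicate (\<beta> i (int (i + d))) (int (i + d))" unfolding assms(4) betti by simp
      show ?thesis unfolding s count_list_replicate using out[of j i] 1 by (cases "j = int (i + d)") simp_all
    next
      case 2
      then have n1: "int n - 1 = int (i + d)" by simp
      have s: "shifts i = int n # replicate (\<beta> i (int (i + d))) (int (i + d))"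
        unfolding assms(4) betti n1 using 2 by simp
      have u: "\<beta> i (int n) = 1" using up[of i] 2 by (simp only: refl if_True)
      have ne: "int n \<noteq> int (i + d)" using 2 by simp
      consider "j = int n" | "j = int (i + d)" | "j \<noteq> int n" "j \<noteq> int (i + d)" by blast
      then show ?thesis
      proof cases
        case 1
        then show ?thesis unfolding s count_list.simps count_list_replicate using u ne by simp
      next
        case 2
        then show ?thesis unfolding s count_list.simps count_list_replicate using ne by simp
      next
        case 3
        then show ?thesis unfolding s count_list.simps count_list_replicate using out[of j i] by simp
      qed
    next
      case 3
      then have s: "shifts i = replicate (\<beta> i (int n)) (int n)" unfolding assms(4) betti by simp
      show ?thesis unfolding s count_list_replicate using out[of j i] 3 by (cases "j = int n") simp_all
    next
      case 4
      then have s: "shifts i = []" unfolding assms(4) by simp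
      have "\<beta> i j = 0" using beyond[OF 4] out[of j i] 4 by (cases "j = int (i + d)") simp_all
      then show ?thesis unfolding s by simp
    qed
  qed
  have A: "\<exists>D. minimal_graded_free_resolution n I shifts D"
    unfolding I by (rule minimal_resolution_sf) (simp add: count \<beta>_def)
  \<comment> \<open>The shifts of every minimal resolution are counted by the same Betti numbers.\<close>
  have B: "mset (sh i) = mset (shifts i)" if m: "minimal_graded_free_resolution n I sh D" for sh D i
  proof (rule multiset_eqI)
    fix j
    have "graded_free_resolution n I sh D" using m by (simp add: minimal_graded_free_resolution_def)
    from count_shifts_minimal[OF this m] have "count_list (sh i) j = \<beta> i j"
      unfolding I ideal_part_sf \<beta>_def .
    then show "count (mset (sh i)) j = count (mset (shifts i)) j"
      unfolding count_mset count .
  qed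
  have C: "int (betti n I (n - d) (int n)) = 1 - mult_quot n I + (\<Sum>i<d. (-1) ^ (d + i - 1) * int (n choose i))"
  proof -
    have "n - d + d = n" using dn by simp
    with low[of "n - d"] have "int (\<beta> (n - d) (int n)) = int ((n - 1) choose (d - 1)) - int (card C) + 1" by simp
    \<comment> \<open>The alternating sum in the first formula is a partial sum of a row of the Pascal triangle.\<close>
    moreover have "(\<Sum>i<d. (-1) ^ (d + i - 1) * int (n choose i)) = int ((n - 1) choose (d - 1))"
    proof -
      have "(\<Sum>i<d. (-1) ^ (d + i - 1) * int (n choose i)) = (\<Sum>i\<le>d - 1. (-1) ^ (d - 1) * ((-1) ^ i * int (n choose i)))"
      proof (rule sum.cong)
        show "{..<d} = {..d - 1}" using d by auto
        fix i
        have "d + i - 1 = (d - 1) + i" using d by simp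
        then show "(-1) ^ (d + i - 1) * int (n choose i) = (-1) ^ (d - 1) * ((-1) ^ i * int (n choose i))"
          by (simp only: power_add mult.assoc)
      qed
      also have "\<dots> = (-1) ^ (d - 1) * ((-1) ^ (d - 1) * int ((n - 1) choose (d - 1)))"
        unfolding sum_distrib_left[symmetric] using dn by (subst alternating_binomial_partial) simp_all
      also have "\<dots> = int ((n - 1) choose (d - 1))"
        by (simp add: mult.assoc[symmetric] power_mult_distrib[symmetric])
      finally show ?thesis .
    qed
    ultimately show ?thesis unfolding betti mult by simp
  qed
  have E: "real (betti n I i (int (i + d))) =
      real ((n - d) choose i) * (real d / real (d + i) * real (n choose d) - real_of_int (mult_quot n I))"
    if i: "i + d + 1 \<le> n" for i
  proof -
    have "int (\<beta> i (int (i + d))) = int (n choose (i + d)) * int ((i + d - 1) choose (d - 1)) - int (card C) * int ((n - d) choose i)"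
      using low[of i] i by simp
    from arg_cong[OF this, of real_of_int] have b: "real (\<beta> i (int (i + d))) = real (n choose (i + d)) * real ((i + d - 1) choose (d - 1)) - real (card C) * real ((n - d) choose i)"
      by (simp only: of_int_diff of_int_mult of_int_of_nat_eq)
    have "(i + d) * ((i + d - 1) choose (d - 1)) = d * ((i + d) choose d)"
      using times_binomial_minus1_eq[of d "i + d"] d by simp
    then have "real (i + d) * real ((i + d - 1) choose (d - 1)) = real d * real ((i + d) choose d)"
      unfolding of_nat_mult[symmetric] by (rule arg_cong)
    then have q: "real ((i + d - 1) choose (d - 1)) = real d / real (d + i) * real ((i + d) choose d)"
      using d by (simp add: field_simps)
    have "(n choose (i + d)) * ((i + d) choose d) = (n choose d) * ((n - d) choose i)"
      using choose_mult[of d "i + d" n] i by simp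
    then have r: "real (n choose (i + d)) * real ((i + d) choose d) = real (n choose d) * real ((n - d) choose i)"
      unfolding of_nat_mult[symmetric] by (rule arg_cong)
    have "real (n choose (i + d)) * real ((i + d - 1) choose (d - 1)) = real d / real (d + i) * (real (n choose (i + d)) * real ((i + d) choose d))"
      unfolding q by simp
    also have "\<dots> = real ((n - d) choose i) * (real d / real (d + i) * real (n choose d))"
      unfolding r by simp
    finally show ?thesis unfolding betti mult b by (simp add: right_diff_distrib)
  qed
  have G: "mult_quot n I = int (n choose d) - int (min_gens n I)"
  proof -
    have "min_gens n I = card (clutter_complement n d C)"
      unfolding assms(3) by (rule min_gens_circuit_ideal)
    then show ?thesis using card_complement[OF uni] unfolding mult by simp
  qed
  show ?thesis using A B C E G by blast
qed

end
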